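(* Let $M,C,K\in\mathbb C^{n\times n}$ be Hermitian with $M,K$ nonsingular, and let $\widetilde M=M+\delta M$, $\widetilde C=C+\delta C$, $\widetilde K=K+\delta K$ be Hermitian with $\widetilde M,\widetilde K$ nonsingular. Consider the quadratic eigenvalue problems $(\lambda^2M+\lambda C+K)x=0$ and $(\widetilde\lambda^2\widetilde M+\widetilde\lambda\widetilde C+\widetilde K)\widetilde x=0$ and their linearized Hermitian pairs $$A=\begin{bmatrix}-K&0\\ 0&M\end{bmatrix},\ B=\begin{bmatrix}C&M\\ M&0\end{bmatrix},\qquad \widetilde A=\begin{bmatrix}-\widetilde K&0\\ 0&\widetilde M\end{bmatrix},\ \widetilde B=\begin{bmatrix}\widetilde C&\widetilde M\\ \widetilde M&0\end{bmatrix}.$$ Let $X=[X_1\ X_2]$ and $\widetilde X=[\widetilde X_1\ \widetilde X_2]$ be nonsingular matrices (representing the associated eigenspaces) such that assumptions (A1)--(A4) listed in the context hold for $(A,B)$, $(\widetilde A,\widetilde B)$, $X,\widetilde X$. Then $$\|\sin\Theta(\operatorname{span}(X_1),\operatorname{span}(\widetilde X_1))\|_F\le\kappa_2(X)\kappa_2(\widetilde X)\left(\phi_1^{\max}\,\delta a_F+\phi_2^{\max}\,\delta b_F\right),$$ where $$\delta a_F=\sqrt{\|K^{-1}\delta K\|_F^2+\|M^{-1}\delta M\|_F^2},\qquad \delta b_F=\sqrt{2\|M^{-1}\delta M\|_F^2+\|M^{-1}\delta C-M^{-1}CM^{-1}\delta M\|_F^2},$$ $$\phi_i^{\max}=\max_{1\le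 j_1\le\widetilde m_1,\;1\le j_2\le m_2}\phi_i(\widetilde\lambda_{1,j_1},\lambda_{2,j_2},\widetilde n_{1,j_1},n_{2,j_2}),\quad i=1,2,$$ with $\phi_1,\phi_2$ the functions defined in the context.
   Context: Notation: $\|\cdot\|_2$ and $\|\cdot\|_F$ are the spectral and Frobenius norms, $\kappa_2(Z)=\|Z\|_2\|Z^{-1}\|_2$, $A^H$ the conjugate transpose, $\operatorname{span}(X)$ the column space. For subspaces $\mathcal X,\mathcal Y$ of the same dimension $k$ with canonical angles $\theta_1,\dots,\theta_k\in[0,\pi/2]$, $\sin\Theta(\mathcal X,\mathcal Y)$ is the diagonal matrix $\operatorname{diag}(\sin\theta_1,\dots,\sin\theta_k)$. A pair $(A,B)$ is regular if $\det(A-\lambda B)$ is not identically zero in $\lambda$; $\lambda(A,B)\subset\mathbb C\cup\{\infty\}$ is its set of eigenvalues ($\infty$ is an eigenvalue iff $B$ is singular). $W^H(A,B)W:=(W^HAW,W^HBW)$, and $(A_1,B_1)\oplus(A_2,B_2)$ is the pair of block diagonal matrices $(\operatorname{diag}(A_1,A_2),\operatorname{diag}(B_1,B_2))$. Canonical blocks. $F_m$ is the $m\times m$ matrix with $(F_m)_{ij}=1$ if $i+j=m+1$ and $0$ otherwise; $G_m$ is the $m\times m$ matrix with $(G_m)_{ij}=1$ if $i+j=m$ and $0$ otherwise. The block types are: R1: $\delta(F_k,G_k)$, $\delta\in\{\pm1\}$ (eigenvalue $\infty$); R2: $\eta'(G_\ell,F_\ell)$, $\eta'\in\{\pm1\}$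 (eigenvalue $0$); R3: $\eta(\alpha F_\ell+|\alpha|G_\ell,F_\ell)$, $\eta\in\{\pm1\}$, $\alpha\in\mathbb R\setminus\{0\}$ (eigenvalue $\alpha$); R4: $\left(\begin{bmatrix}0&\beta F_m+|\beta|G_m\\ \overline\beta F_m+|\beta|G_m&0\end{bmatrix},F_{2m}\right)$, $\beta\in\mathbb C\setminus\mathbb R$ (eigenvalues $\beta,\overline\beta$). Assumptions: (A1) Both pairs $(A,B)$, $(\widetilde A,\widetilde B)$ are regular. (A2) (a) $X^H(A,B)X=(\Lambda,\Omega)=(\Lambda_1,\Omega_1)\oplus(\Lambda_2,\Omega_2)$, i.e. $X_i^HAX_i=\Lambda_i$, $X_i^HBX_i=\Omega_i$, $X_1^HAX_2=X_1^HBX_2=0$, where $(\Lambda_i,\Omega_i)=\bigoplus_{j=1}^{m_i}(\Lambda_{i,j},\Omega_{i,j})$ and each $(\Lambda_{i,j},\Omega_{i,j})$ is a block of one of the types R1--R4, of size $n_{i,j}$, with corresponding eigenvalue $\lambda_{i,j}$. (b) Likewise $\widetilde X^H(\widetilde A,\widetilde B)\widetilde X=(\widetilde\Lambda_1,\widetilde\Omega_1)\oplus(\widetilde\Lambda_2,\widetilde\Omega_2)$ with $(\widetilde\Lambda_i,\widetilde\Omega_i)=\bigoplus_{j=1}^{\widetilde m_i}(\widetilde\Lambda_{i,j},\widetilde\Omega_{i,j})$, each a block of type R1--R4 of size $\widetilde n_{i,j}$ with corresponding eigenvalue $\widetilde\lambda_{i,j}$. (c) For $i=1,2$, $\Lambda_i,\Omega_i,\widetilde\Lambda_i,\widetilde\Omega_i$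 have the same size (so $X_i,\widetilde X_i$ have the same size). (A3) The sets $\lambda(\Lambda_1,\Omega_1)\cap\lambda(\Lambda_2,\Omega_2)$, $\lambda(\widetilde\Lambda_1,\widetilde\Omega_1)\cap\lambda(\widetilde\Lambda_2,\widetilde\Omega_2)$, $\lambda(\Lambda_1,\Omega_1)\cap\lambda(\widetilde\Lambda_2,\widetilde\Omega_2)$, $\lambda(\Lambda_2,\Omega_2)\cap\lambda(\widetilde\Lambda_1,\widetilde\Omega_1)$ are all empty. (A4) $\infty\notin\lambda(\Lambda_1,\Omega_1)$, $0\notin\lambda(\Lambda_2,\Omega_2)$, $\infty\notin\lambda(\widetilde\Lambda_1,\widetilde\Omega_1)$, $0\notin\lambda(\widetilde\Lambda_2,\widetilde\Omega_2)$. The functions $\phi_1,\phi_2$. For $\alpha>0$ and $m\in\{0,1,2,\dots\}$ put $\varphi_-(\alpha,m):=\alpha^{1-m}\frac{1-\alpha^m}{1-\alpha}$ and $\varphi_+(\alpha,m):=\alpha^{-m}\frac{1+\alpha-2\alpha^m}{1-\alpha}$ (at $\alpha=1$ the limits, $m$ and $2m-1$ respectively). For $\lambda,\lambda'\notin\{0,\infty\}$ with $\lambda'\ne\lambda$, $\overline{\lambda'}\neq\lambda$, put $\gamma:=\min\{|\frac{\lambda'-\lambda}{\lambda}|,|\frac{\overline{\lambda'}-\lambda}{\lambda}|\}$, $\gamma':=\min\{|\frac{\lambda'-\lambda}{\lambda'}|,|\frac{\overline{\lambda'}-\lambda}{\lambda'}|\}$ and $\phi_1(\lambda,\lambda',n,n')=\binom{n'+n-1}{n}\varphi_-(\gamma,n)\varphi_+(\gamma',n')$,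 $\phi_2(\lambda,\lambda',n,n')=\binom{n'+n-1}{n'}\varphi_-(\gamma',n')\varphi_+(\gamma,n)$, $\phi_1(0,\lambda',n,n')=\binom{n'+n-1}{n}|\lambda'|^{-1}\varphi_-(|\lambda'|,n-1)+1$, $\phi_2(0,\lambda',n,n')=\binom{n'+n-1}{n}|\lambda'|^{-1}\varphi_-(|\lambda'|,n-1)$, $\phi_1(\lambda,0,n,n')=\binom{n'+n-1}{n'}|\lambda|^{-1}\varphi_-(|\lambda|,n'-1)$, $\phi_2(\lambda,0,n,n')=\binom{n'+n-1}{n'}|\lambda|^{-1}\varphi_-(|\lambda|,n'-1)+1$, $\phi_1(\lambda,\infty,n,n')=2|\lambda|\varphi_-(\frac1{2|\lambda|},n'-1)+1$, $\phi_2(\lambda,\infty,n,n')=2|\lambda|\varphi_-(\frac1{2|\lambda|},n'-1)$, $\phi_1(0,\infty,n,n')=\min\{n,n'\}$, $\phi_2(0,\infty,n,n')=\min\{n,n'\}-1$. (Since $M,K$ and $\widetilde M,\widetilde K$ are nonsingular, neither $0$ nor $\infty$ actually occurs as an eigenvalue here.) *)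

theory Defs
  imports
    "Jordan_Normal_Form.Schur_Decomposition"
    "Jordan_Normal_Form.VS_Connect"
    "HOL-Computational_Algebra.Fundamental_Theorem_Algebra"
begin

section \<open>Norms, inverses and Hermitian matrices\<close>

definition hermitian_mat :: "complex mat \<Rightarrow> bool" where
  "hermitian_mat A \<longleftrightarrow> mat_adjoint A = A"

definition vec_norm2 :: "complex vec \<Rightarrow> real" where
  "vec_norm2 v = sqrt (\<Sum>i<dim_vec v. (cmod (v $ i))\<^sup>2)"

definition frob_norm :: "'a :: real_normed_field mat \<Rightarrow> real" where
  "frob_norm A = sqrt (\<Sum>i<dim_row A. \<Sum>j<dim_col A. (norm (A $$ (i, j)))\<^sup>2)"

definition spec_norm :: "complex mat \<Rightarrow> real" where
  "spec_norm A = Sup {vec_norm2 (A *\<^sub>v v) | v. v \<in> carrier_vec (dim_col A) \<and> vec_norm2 v \<le> 1}"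

(* Only applied to nonsingular matrices, for which mat_inverse does not return None. *)
definition inv_mat :: "complex mat \<Rightarrow> complex mat" where
  "inv_mat A = the (mat_inverse A)"

definition kappa2 :: "complex mat \<Rightarrow> real" where
  "kappa2 Z = spec_norm Z * spec_norm (inv_mat Z)"

definition hcat :: "complex mat \<Rightarrow> complex mat \<Rightarrow> complex mat" where
  "hcat X Y = mat_of_cols (dim_row X) (cols X @ cols Y)"

definition col_span :: "complex mat \<Rightarrow> complex vec set" where
  "col_span X = vec_space.col_space (dim_row X) X"


section \<open>Canonical angles\<close>

(* Square roots of the eigenvalues of A^H A, counted with algebraic multiplicity and in
   decreasing order; a matrix with k columns gets k singular values. *)
definition singular_values :: "complex mat \<Rightarrow> real list" where
  "singular_values A =
     rev (sorted_list_of_multiset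
       (image_mset (\<lambda>z. sqrt (Re z)) (proots (char_poly (mat_adjoint A * A)))))"

definition orthonormal_basis_mat :: "complex vec set \<Rightarrow> complex mat \<Rightarrow> bool" where
  "orthonormal_basis_mat S U \<longleftrightarrow>
     mat_adjoint U * U = 1\<^sub>m (dim_col U) \<and> col_span U = S"

(* For subspaces S, T of the same dimension. The singular values of V^H U do not depend on the
   choice of the orthonormal bases U of S and V of T. *)
definition canonical_angles :: "complex vec set \<Rightarrow> complex vec set \<Rightarrow> real list" where
  "canonical_angles S T =
     (let U = (SOME U. orthonormal_basis_mat S U); V = (SOME V. orthonormal_basis_mat T V)
      in map arccos (singular_values (mat_adjoint V * U)))"

definition sin_Theta :: "complex vec set \<Rightarrow> complex vec set \<Rightarrow> real mat" where
  "sin_Theta S T =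
     (let \<theta> = canonical_angles S T in mat_diag (length \<theta>) (\<lambda>j. sin (\<theta> ! j)))"


section \<open>Matrix pairs\<close>

datatype ext_complex = Fin complex | Infty

type_synonym mat_pair = "complex mat \<times> complex mat"

definition regular_pair :: "mat_pair \<Rightarrow> bool" where
  "regular_pair P \<longleftrightarrow> (\<exists>z. det (fst P - z \<cdot>\<^sub>m snd P) \<noteq> 0)"

definition pair_eigenvalues :: "mat_pair \<Rightarrow> ext_complex set" where
  "pair_eigenvalues P =
     {Fin z | z. det (fst P - z \<cdot>\<^sub>m snd P) = 0} \<union> {\<mu>. \<mu> = Infty \<and> det (snd P) = 0}"

definition pair_congr :: "complex mat \<Rightarrow> mat_pair \<Rightarrow> mat_pair" where
  "pair_congr W P = (mat_adjoint W * fst P * W, mat_adjoint W * snd P * W)"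

definition pair_sum :: "mat_pair list \<Rightarrow> mat_pair" where
  "pair_sum Ps = (diag_block_mat (map fst Ps), diag_block_mat (map snd Ps))"


section \<open>Canonical blocks\<close>

(* Indices start at 0 here, so the conditions i + j = m + 1 and i + j = m on 1-based indices
   become i + j + 1 = m and i + j + 2 = m. *)
definition F_mat :: "nat \<Rightarrow> complex mat" where
  "F_mat m = mat m m (\<lambda>(i, j). if i + j + 1 = m then 1 else 0)"

definition G_mat :: "nat \<Rightarrow> complex mat" where
  "G_mat m = mat m m (\<lambda>(i, j). if i + j + 2 = m then 1 else 0)"

(* The real argument of R1, R2 and the first one of R3 is the sign. *)
datatype canon_block =
    R1 real nat
  | R2 real nat
  | R3 real real nat
  | R4 complex nat

fun valid_block :: "canon_block \<Rightarrow> bool" where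
  "valid_block (R1 \<delta> k) \<longleftrightarrow> \<delta> \<in> {1, -1} \<and> k \<ge> 1"
| "valid_block (R2 \<eta> l) \<longleftrightarrow> \<eta> \<in> {1, -1} \<and> l \<ge> 1"
| "valid_block (R3 \<eta> \<alpha> l) \<longleftrightarrow> \<eta> \<in> {1, -1} \<and> \<alpha> \<noteq> 0 \<and> l \<ge> 1"
| "valid_block (R4 \<beta> m) \<longleftrightarrow> \<beta> \<notin> \<real> \<and> m \<ge> 1"

fun block_pair :: "canon_block \<Rightarrow> mat_pair" where
  "block_pair (R1 \<delta> k) = (of_real \<delta> \<cdot>\<^sub>m F_mat k, of_real \<delta> \<cdot>\<^sub>m G_mat k)"
| "block_pair (R2 \<eta> l) = (of_real \<eta> \<cdot>\<^sub>m G_mat l, of_real \<eta> \<cdot>\<^sub>m F_mat l)"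
| "block_pair (R3 \<eta> \<alpha> l) =
     (of_real \<eta> \<cdot>\<^sub>m (of_real \<alpha> \<cdot>\<^sub>m F_mat l + of_real \<bar>\<alpha>\<bar> \<cdot>\<^sub>m G_mat l), of_real \<eta> \<cdot>\<^sub>m F_mat l)"
| "block_pair (R4 \<beta> m) =
     (four_block_mat
        (0\<^sub>m m m) (\<beta> \<cdot>\<^sub>m F_mat m + of_real (cmod \<beta>) \<cdot>\<^sub>m G_mat m)
        (cnj \<beta> \<cdot>\<^sub>m F_mat m + of_real (cmod \<beta>) \<cdot>\<^sub>m G_mat m) (0\<^sub>m m m),
      F_mat (2 * m))"

fun block_size :: "canon_block \<Rightarrow> nat" where
  "block_size (R1 \<delta> k) = k"
| "block_size (R2 \<eta> l) = l"
| "block_size (R3 \<eta> \<alpha> l) = l"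
| "block_size (R4 \<beta> m) = 2 * m"

(* An R4 block has the two eigenvalues \<beta> and its conjugate; which one is recorded is immaterial,
   since phi1 and phi2 below are unchanged when an eigenvalue argument is conjugated. *)
fun block_eigenvalue :: "canon_block \<Rightarrow> ext_complex" where
  "block_eigenvalue (R1 \<delta> k) = Infty"
| "block_eigenvalue (R2 \<eta> l) = Fin 0"
| "block_eigenvalue (R3 \<eta> \<alpha> l) = Fin (of_real \<alpha>)"
| "block_eigenvalue (R4 \<beta> m) = Fin \<beta>"


section \<open>The coefficient functions\<close>

(* Both are used for \<alpha> > 0 only; the values at \<alpha> = 1 are the limits. *)
definition phi_minus :: "real \<Rightarrow> nat \<Rightarrow> real" where
  "phi_minus \<alpha> m =
     (if \<alpha> = 1 then real m else \<alpha> powi (1 - int m) * ((1 - \<alpha> ^ m) / (1 - \<alpha>)))"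

definition phi_plus :: "real \<Rightarrow> nat \<Rightarrow> real" where
  "phi_plus \<alpha> m =
     (if \<alpha> = 1 then 2 * real m - 1
      else \<alpha> powi (- int m) * ((1 + \<alpha> - 2 * \<alpha> ^ m) / (1 - \<alpha>)))"

definition rel_gap :: "complex \<Rightarrow> complex \<Rightarrow> real" where
  "rel_gap l l' = min (cmod ((l' - l) / l)) (cmod ((cnj l' - l) / l))"

definition rel_gap' :: "complex \<Rightarrow> complex \<Rightarrow> real" where
  "rel_gap' l l' = min (cmod ((l' - l) / l')) (cmod ((cnj l' - l) / l'))"

(* Meaningful only if the first eigenvalue is not Infty, and the second differs from the first
   and from its conjugate. *)
fun phi1 :: "ext_complex \<Rightarrow> ext_complex \<Rightarrow> nat \<Rightarrow> nat \<Rightarrow> real" where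
  "phi1 (Fin l) (Fin l') n n' =
     (if l = 0 then
        real ((n' + n - 1) choose n) * inverse (cmod l') * phi_minus (cmod l') (n - 1) + 1
      else if l' = 0 then
        real ((n' + n - 1) choose n') * inverse (cmod l) * phi_minus (cmod l) (n' - 1)
      else
        real ((n' + n - 1) choose n) * phi_minus (rel_gap l l') n * phi_plus (rel_gap' l l') n')"
| "phi1 (Fin l) Infty n n' =
     (if l = 0 then real (min n n')
      else 2 * cmod l * phi_minus (1 / (2 * cmod l)) (n' - 1) + 1)"
| "phi1 Infty l' n n' = undefined"

fun phi2 :: "ext_complex \<Rightarrow> ext_complex \<Rightarrow> nat \<Rightarrow> nat \<Rightarrow> real" where
  "phi2 (Fin l) (Fin l') n n' =
     (if l = 0 then
        real ((n' + n - 1) choose n) * inverse (cmod l') * phi_minus (cmod l') (n - 1)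
      else if l' = 0 then
        real ((n' + n - 1) choose n') * inverse (cmod l) * phi_minus (cmod l) (n' - 1) + 1
      else
        real ((n' + n - 1) choose n') * phi_minus (rel_gap' l l') n' * phi_plus (rel_gap l l') n)"
| "phi2 (Fin l) Infty n n' =
     (if l = 0 then real (min n n') - 1
      else 2 * cmod l * phi_minus (1 / (2 * cmod l)) (n' - 1))"
| "phi2 Infty l' n n' = undefined"

definition phi_max ::
  "(ext_complex \<Rightarrow> ext_complex \<Rightarrow> nat \<Rightarrow> nat \<Rightarrow> real) \<Rightarrow> canon_block list \<Rightarrow> canon_block list \<Rightarrow> real"
where
  "phi_max \<phi> bs bs' =
     Max {\<phi> (block_eigenvalue (bs ! j)) (block_eigenvalue (bs' ! j'))
            (block_size (bs ! j)) (block_size (bs' ! j')) | j j'. j < length bs \<and> j' < length bs'}"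

end

theory Submission
  imports Defs "HOL-Analysis.L2_Norm"
begin

text \<open>
  Put \<open>Z = X\<^sup>-\<^sup>1 X'\<close>, \<open>E = X\<^sup>-\<^sup>1 (A\<^sup>-\<^sup>1 \<delta>A) X'\<close>, \<open>F = X\<^sup>-\<^sup>1 (B\<^sup>-\<^sup>1 \<delta>B) X'\<close> and \<open>W = X\<^sup>H X'\<^sup>-\<^sup>H\<close>. Then
  \<open>\<Lambda> (Z + E) = W \<Lambda>'\<close> and \<open>\<Omega> (Z + F) = W \<Omega>'\<close>, and \<open>\<Omega>, \<Omega>'\<close> are involutions because \<open>0\<close> and
  \<open>\<infinity>\<close> are not eigenvalues. Eliminating \<open>W\<close> from the (2,1) blocks leaves the Sylvester equation
  \<open>T\<^sub>2 (Z + E) = (Z + F) T\<^sub>1\<close> with \<open>T = \<Omega> \<Lambda>\<close> a direct sum of blocks \<open>\<mu> I + \<bar>\<mu>\<bar> L\<close>, \<open>L\<close> the lower shift.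
  For a single pair of blocks the operator \<open>Z \<mapsto> T\<^sub>2 Z - Z T\<^sub>1\<close> is \<open>\<mu>' - \<mu>\<close> plus two commuting nilpotent
  shifts, so its inverse is a finite double Neumann series; bounding its binomial coefficients by the
  largest one gives exactly the functions \<open>\<phi>\<^sub>1, \<phi>\<^sub>2\<close>. Finally, if \<open>U, V\<close> are orthonormal bases of the
  spans of \<open>X\<^sub>1, X\<^sub>1'\<close>, then the Frobenius norm of \<open>sin \<Theta>\<close> is that of \<open>(I - U U\<^sup>H) V\<close>, which is at most
  \<open>\<parallel>X\<parallel> \<parallel>X'\<^sup>-\<^sup>1\<parallel>\<close> times that of the (2,1) block of \<open>Z\<close>.
\<close>

section \<open>The Neumann series of a single Sylvester block\<close>

text \<open>The perturbation is kept multiplicative, A' = A (I + A^-1 dA), and this is why the gaps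
  are relative. E meets a chain whose diagonal and shift both have modulus |\<mu>'|, F one with
  modulus |\<mu>|, and the series divides by powers of |\<mu>' - \<mu>|; so it sees only the ratios
  x = |\<mu>'| / |\<mu>' - \<mu>| and y = |\<mu>| / |\<mu>' - \<mu>|, which the reciprocals of the
  two gaps bound. An R4 block brings chains for \<beta> and for its conjugate, and the minimum over
  conjugates in the gaps covers every pairing. W can be eliminated because it is built from X and X'
  alone and hence is the same in both equations. The condition numbers arise in halves: |X| |X'^-1|
  from the angles, |X^-1| |X'| from passing from A^-1 dA and B^-1 dB to E and F. The obstacle is
  that E and F carry different constants and that each pair of blocks has its own. What is carried
  through the direct sums is therefore the inequality |Z| <= c1 |E| + c2 |F| in Frobenius norms,
  with both maxima as constants.\<close>

definition neumann_coeff :: "complex \<Rightarrow> complex \<Rightarrow> complex \<Rightarrow> nat \<Rightarrow> nat \<Rightarrow> complex" where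
  "neumann_coeff d p q a b = of_nat ((a + b) choose a) * (- p) ^ a * q ^ b / d ^ Suc (a + b)"

text \<open>\<open>neumann_coeff d p q a b\<close> is the coefficient of s^a t^b in 1 / (d + p s - q
  t), expanded as the sum of (q t - p s)^k / d^(k+1). Multiplying by the denominator gives the
  recursion; the binomials match by Pascal's rule.\<close>

lemma neumann_coeff_rec:
  assumes "d \<noteq> 0"
  shows "d * neumann_coeff d p q a b =
    (if a = 0 \<and> b = 0 then 1 else 0) - p * (if a = 0 then 0 else neumann_coeff d p q (a - 1) b)
      + q * (if b = 0 then 0 else neumann_coeff d p q a (b - 1))"
proof (cases a)
  case 0
  then show ?thesis
    using assms by (cases b) (simp_all add: neumann_coeff_def)
next
  case (Suc a')
  show ?thesis
  proof (cases b)
    case 0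
    then show ?thesis
      using assms Suc by (simp add: neumann_coeff_def)
  next
    case b: (Suc b')
    have "(of_nat ((a + b) choose a) :: complex) = of_nat ((a' + b) choose a') + of_nat ((a + b') choose a)"
      by (simp add: Suc b)
    then show ?thesis
      using assms by (simp add: Suc b neumann_coeff_def divide_simps) (simp add: algebra_simps)
  qed
qed

text \<open>
  Integer indices let both shifts act without boundary cases; \<open>z\<close> and \<open>r\<close> are extended by zero.
\<close>
lemma sylvester_recurrence_solution:
  fixes z r :: "int \<Rightarrow> int \<Rightarrow> complex" and P Q :: nat
  assumes d: "d \<noteq> 0"
    and r0: "\<And>i j. i < 0 \<or> j > int Q \<Longrightarrow> r i j = 0"
    and z0: "\<And>i j. i < 0 \<or> j > int Q \<Longrightarrow> z i j = 0"
    and rec: "\<And>i j. 0 \<le> i \<Longrightarrow> i \<le> int P \<Longrightarrow> 0 \<le> j \<Longrightarrow> j \<le> int Q \<Longrightarrow>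
        d * z i j = r i j - p * z (i - 1) j + q * z i (j + 1)"
    and ij: "i \<le> int P" "0 \<le> j"
  shows "z i j = (\<Sum>a<Suc P. \<Sum>b<Suc Q. neumann_coeff d p q a b * r (i - int a) (j + int b))"
    (is "_ = ?S i j")
  using ij
\<comment> \<open>The recurrence refers to the entry above and to the entry on the right, so the
  measure is the distance to the top border plus the distance to the right border, beyond which
  \<open>z\<close> vanishes.\<close>
proof (induction "nat (i + 1) + nat (int Q + 1 - j)" arbitrary: i j rule: less_induct)
  case less
  let ?c = "neumann_coeff d p q"
  show ?case
  proof (cases "i < 0 \<or> j > int Q")
    case True
    then show ?thesis
      using r0 z0[OF True] by auto
  next
    case False
    then have i: "0 \<le> i" "i \<le> int P" and j: "0 \<le> j" "j \<le> int Q"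
      using less.prems by auto
    have IH1: "z (i - 1) j = ?S (i - 1) j"
      by (rule less.hyps) (use i j in auto)
    have IH2: "z i (j + 1) = ?S i (j + 1)"
      by (rule less.hyps) (use i j in auto)
    \<comment> \<open>Reindexing loses the last summand of the right-hand side; it has row index i -
      1 - P, which is negative because i <= P, so it is zero. In \<open>shift_b\<close> the lost
      column index lies beyond Q.\<close>
    have shift_a: "(\<Sum>a<Suc P. (if a = 0 then 0 else ?c (a - 1) b) * r (i - int a) (j + int b)) =
      (\<Sum>a<Suc P. ?c a b * r (i - 1 - int a) (j + int b))" for b
      using r0[of "i - 1 - int P" "j + int b"] i
      by (subst sum.lessThan_Suc_shift) (simp add: algebra_simps)
    have shift_b: "(\<Sum>b<Suc Q. (if b = 0 then 0 else ?c a (b - 1)) * r (i - int a) (j + int b)) =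
      (\<Sum>b<Suc Q. ?c a b * r (i - int a) (j + 1 + int b))" for a
      using r0[of "j + 1 + int Q" "i - int a"] r0[of "i - int a" "j + 1 + int Q"] j
      by (subst sum.lessThan_Suc_shift) (simp add: algebra_simps)
    have "d * ?S i j = (\<Sum>a<Suc P. \<Sum>b<Suc Q. d * ?c a b * r (i - int a) (j + int b))"
      by (simp only: sum_distrib_left mult.assoc)
    also have "\<dots> = (\<Sum>a<Suc P. \<Sum>b<Suc Q. (if a = 0 \<and> b = 0 then 1 else 0) * r (i - int a) (j + int b))
      - p * (\<Sum>a<Suc P. \<Sum>b<Suc Q. (if a = 0 then 0 else ?c (a - 1) b) * r (i - int a) (j + int b))
      + q * (\<Sum>a<Suc P. \<Sum>b<Suc Q. (if b = 0 then 0 else ?c a (b - 1)) * r (i - int a) (j + int b))"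
      unfolding neumann_coeff_rec[OF d] sum_distrib_left sum_subtractf[symmetric] sum.distrib[symmetric]
      by (intro sum.cong refl) (simp add: algebra_simps)
    also have "(\<Sum>a<Suc P. \<Sum>b<Suc Q. (if a = 0 \<and> b = 0 then 1 else 0) * r (i - int a) (j + int b)) = r i j"
    proof -
      have "(\<Sum>b<Suc Q. (if a = 0 \<and> b = 0 then 1 else 0) * r (i - int a) (j + int b)) =
        (if a = 0 then r i j else 0)" for a :: nat
        by (subst sum.lessThan_Suc_shift) auto
      then show ?thesis
        by (simp add: sum.delta del: sum.lessThan_Suc)
    qed
    also have "(\<Sum>a<Suc P. \<Sum>b<Suc Q. (if a = 0 then 0 else ?c (a - 1) b) * r (i - int a) (j + int b)) = ?S (i - 1) j"
      by (subst sum.swap, subst shift_a, subst sum.swap) simp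
    also have "(\<Sum>a<Suc P. \<Sum>b<Suc Q. (if b = 0 then 0 else ?c a (b - 1)) * r (i - int a) (j + int b)) = ?S i (j + 1)"
      by (subst shift_b) simp
    also have "r i j - p * ?S (i - 1) j + q * ?S i (j + 1) = d * z i j"
      unfolding rec[OF i j] IH1 IH2 ..
    finally show ?thesis
      using d by simp
  qed
qed

section \<open>Frobenius norms of shifted matrices\<close>

definition mat_ext :: "complex mat \<Rightarrow> int \<Rightarrow> int \<Rightarrow> complex" where
  "mat_ext Z i j =
     (if 0 \<le> i \<and> i < int (dim_row Z) \<and> 0 \<le> j \<and> j < int (dim_col Z) then Z $$ (nat i, nat j) else 0)"

lemma frob_norm_nonneg [simp]: "0 \<le> frob_norm Z"
  by (simp add: frob_norm_def sum_nonneg)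

lemma frob_norm_L2_set:
  "frob_norm Z = L2_set (\<lambda>(i, j). cmod (mat_ext Z i j)) ({0..<int (dim_row Z)} \<times> {0..<int (dim_col Z)})"
proof -
  have *: "{0..<int m} = int ` {..<m}" for m
    by (simp add: image_int_atLeastLessThan lessThan_atLeast0)
  have sq: "(\<lambda>x. (case x of (i, j) \<Rightarrow> cmod (mat_ext Z i j))\<^sup>2) = (\<lambda>(i, j). (cmod (mat_ext Z i j))\<^sup>2)"
    by auto
  show ?thesis
    unfolding frob_norm_def L2_set_def sq sum.cartesian_product[symmetric] *
    by (simp add: sum.reindex mat_ext_def)
qed

text \<open>A translation is injective, so it can only push entries out of the window. The value 0
  for large shifts is the nilpotency of the shifts; it later turns the last weight 2 into 1.\<close>

lemma frob_norm_shift_le: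
  assumes "dim_row Z = m" "dim_col Z = n"
  shows "L2_set (\<lambda>(i, j). cmod (mat_ext Z (i - int a) (j + int b))) ({0..<int m} \<times> {0..<int n})
    \<le> (if a < m \<and> b < n then frob_norm Z else 0)"
proof (cases "a < m \<and> b < n")
  case True
  let ?S = "{0..<int m} \<times> {0..<int n}"
  let ?f = "\<lambda>(i, j). (i - int a, j + int b)"
  have inj: "inj_on ?f ?S"
    by (auto simp: inj_on_def)
  have "(\<Sum>x\<in>?S. (case x of (i, j) \<Rightarrow> cmod (mat_ext Z (i - int a) (j + int b)))\<^sup>2)
      = (\<Sum>x\<in>?f ` ?S. (case x of (i, j) \<Rightarrow> cmod (mat_ext Z i j))\<^sup>2)"
    by (subst sum.reindex[OF inj]) (auto intro!: sum.cong)
  also have "\<dots> = (\<Sum>x\<in>?f ` ?S \<inter> ?S. (case x of (i, j) \<Rightarrow> cmod (mat_ext Z i j))\<^sup>2)"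
    by (intro sum.mono_neutral_right) (auto simp: mat_ext_def assms split: if_splits)
  also have "\<dots> \<le> (\<Sum>x\<in>?S. (case x of (i, j) \<Rightarrow> cmod (mat_ext Z i j))\<^sup>2)"
    by (intro sum_mono2) auto
  finally show ?thesis
    using True by (simp add: frob_norm_L2_set assms L2_set_def)
next
  case False
  then have "L2_set (\<lambda>(i, j). cmod (mat_ext Z (i - int a) (j + int b))) ({0..<int m} \<times> {0..<int n}) = 0"
    by (intro L2_set_0') (auto simp: mat_ext_def assms)
  then show ?thesis
    using False by auto
qed

lemma L2_set_sum_le: "L2_set (\<lambda>x. \<Sum>k\<in>K. f k x) S \<le> (\<Sum>k\<in>K. L2_set (f k) S)"
proof (induction K rule: infinite_finite_induct)
  case (insert k K)
  then show ?case
    using L2_set_triangle_ineq[of "f k" "\<lambda>x. \<Sum>k\<in>K. f k x" S] by simp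
qed (auto simp: L2_set_def)

section \<open>Scaled Jordan blocks and the sums behind the coefficient functions\<close>

definition chain_block :: "complex \<Rightarrow> nat \<Rightarrow> complex mat" where
  "chain_block \<mu> m =
     mat m m (\<lambda>(i, j). if i = j then \<mu> else if i = Suc j then of_real (cmod \<mu>) else 0)"

lemma chain_block_carrier [simp]: "chain_block \<mu> m \<in> carrier_mat m m"
  by (simp add: chain_block_def)

lemma index_mult_mat_sum:
  assumes "A \<in> carrier_mat m k" "B \<in> carrier_mat k n" "i < m" "j < n"
  shows "(A * B) $$ (i, j) = (\<Sum>l<k. A $$ (i, l) * B $$ (l, j))"
  using assms by (simp add: scalar_prod_def lessThan_atLeast0)

lemma chain_block_mult_left:
  assumes "Y \<in> carrier_mat m n" "i < m" "j < n"
  shows "(chain_block \<mu> m * Y) $$ (i, j) =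
    \<mu> * mat_ext Y (int i) (int j) + of_real (cmod \<mu>) * mat_ext Y (int i - 1) (int j)"
proof -
  have "(chain_block \<mu> m * Y) $$ (i, j) =
      (\<Sum>k<m. (if k = i then \<mu> * Y $$ (k, j) else 0) +
         (if Suc k = i then of_real (cmod \<mu>) * Y $$ (k, j) else 0))"
    unfolding index_mult_mat_sum[OF chain_block_carrier assms]
    by (intro sum.cong refl) (use assms in \<open>auto simp: chain_block_def\<close>)
  also have "\<dots> = \<mu> * Y $$ (i, j) + (if i = 0 then 0 else of_real (cmod \<mu>) * Y $$ (i - 1, j))"
    using assms by (cases i) (simp_all add: sum.distrib)
  also have "\<dots> = \<mu> * mat_ext Y (int i) (int j) + of_real (cmod \<mu>) * mat_ext Y (int i - 1) (int j)"
    using assms by (auto simp: mat_ext_def nat_diff_distrib)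
  finally show ?thesis .
qed

lemma chain_block_mult_right:
  assumes "Y \<in> carrier_mat m n" "i < m" "j < n"
  shows "(Y * chain_block \<mu> n) $$ (i, j) =
    \<mu> * mat_ext Y (int i) (int j) + of_real (cmod \<mu>) * mat_ext Y (int i) (int j + 1)"
proof -
  have "(Y * chain_block \<mu> n) $$ (i, j) =
      (\<Sum>k<n. (if k = j then \<mu> * Y $$ (i, k) else 0) +
         (if k = Suc j then of_real (cmod \<mu>) * Y $$ (i, k) else 0))"
    unfolding index_mult_mat_sum[OF assms(1) chain_block_carrier assms(2,3)]
    by (intro sum.cong refl) (use assms in \<open>auto simp: chain_block_def\<close>)
  also have "\<dots> = \<mu> * Y $$ (i, j) + (if Suc j < n then of_real (cmod \<mu>) * Y $$ (i, Suc j) else 0)"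
    using assms by (simp add: sum.distrib)
  also have "\<dots> = \<mu> * mat_ext Y (int i) (int j) + of_real (cmod \<mu>) * mat_ext Y (int i) (int j + 1)"
    using assms by (auto simp: mat_ext_def nat_add_distrib)
  finally show ?thesis .
qed

text \<open>The geometric sum shows nonnegativity and monotonicity in the size at once, which the
  closed form with its removable singularity at 1 hides.\<close>

lemma phi_minus_eq_sum:
  assumes "0 < g"
  shows "phi_minus g N = (\<Sum>b<N. (1 / g) ^ b)"
proof (cases "g = 1")
  case False
  have "g powi (1 - int N) = g * (1 / g) ^ N"
    using assms by (simp add: power_int_diff power_int_of_nat power_one_over field_simps)
  moreover have "(\<Sum>b<N. (1 / g) ^ b) = ((1 / g) ^ N - 1) / (1 / g - 1)"
    using False assms by (intro geometric_sum) auto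
  moreover have "((1 / g) ^ N - 1) / (1 / g - 1) = g * (1 / g) ^ N * ((1 - g ^ N) / (1 - g))"
  proof -
    have h: "(1 / g) ^ N * g ^ N = 1"
      using assms by (simp flip: power_mult_distrib)
    have "g * (1 / g) ^ N * (1 - g ^ N) = g * ((1 / g) ^ N - (1 / g) ^ N * g ^ N)"
      by (simp add: algebra_simps)
    then have "g * (1 / g) ^ N * (1 - g ^ N) = g * ((1 / g) ^ N - 1)"
      unfolding h .
    moreover have "1 / g - 1 = (1 - g) / g"
      using assms by (simp add: field_simps)
    ultimately show ?thesis
      using assms by simp
  qed
  ultimately show ?thesis
    using False by (simp add: phi_minus_def)
qed (simp add: phi_minus_def)

text \<open>
  The factor 2 comes from \<open>\<mu> I + \<bar>\<mu>\<bar> L\<close> having two entries per row; the last term is counted once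
  because \<open>L\<^sup>N = 0\<close>. Empty blocks are excluded: \<open>phi_plus g 0 = -1\<close>.
\<close>
lemma phi_plus_eq_sum:
  assumes "0 < g" "1 \<le> N"
  shows "phi_plus g N = (\<Sum>a<N. (1 / g) ^ Suc a * (if Suc a < N then 2 else 1))"
proof -
  obtain k where N: "N = Suc k"
    using assms by (cases N) auto
  have split: "(\<Sum>a<N. (1 / g) ^ Suc a * (if Suc a < N then 2 else 1)) =
      (1 / g) * (\<Sum>a<N. (1 / g) ^ a) + (1 / g) * (\<Sum>a<k. (1 / g) ^ a)"
    by (simp add: N sum_distrib_left algebra_simps flip: sum.distrib)
  show ?thesis
  proof (cases "g = 1")
    case False
    have gs: "(\<Sum>a<n. (1 / g) ^ a) = ((1 / g) ^ n - 1) / (1 / g - 1)" for n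
      using False assms by (intro geometric_sum) auto
    have powi: "g powi (- int N) = (1 / g) ^ N"
      using assms by (simp add: power_int_minus power_one_over field_simps)
    have "(1 / g) / (1 / g - 1) = 1 / (1 - g)"
      using False assms by (simp add: field_simps)
    then have "(1 / g) * (\<Sum>a<N. (1 / g) ^ a) + (1 / g) * (\<Sum>a<k. (1 / g) ^ a) =
        (((1 / g) ^ N - 1) + ((1 / g) ^ k - 1)) * (1 / (1 - g))"
      unfolding gs by (metis add_divide_distrib distrib_right mult.commute times_divide_eq_left)
    also have "\<dots> = (1 / g) ^ N * ((1 + g - 2 * g ^ N) / (1 - g))"
    proof -
      have h: "(1 / g) ^ N * g ^ N = 1" "(1 / g) ^ k = g * (1 / g) ^ N"
        using assms by (simp_all add: N flip: power_mult_distrib)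
      have "(1 / g) ^ N * (1 + g - 2 * g ^ N) = (1 / g) ^ N + g * (1 / g) ^ N - 2 * ((1 / g) ^ N * g ^ N)"
        by (simp add: algebra_simps)
      also have "\<dots> = ((1 / g) ^ N - 1) + ((1 / g) ^ k - 1)"
        unfolding h by simp
      finally show ?thesis
        by simp
    qed
    finally show ?thesis
      unfolding split using False by (simp add: phi_plus_def powi)
  qed (simp add: split, simp add: N phi_plus_def)
qed

lemma phi_minus_nonneg: "0 < g \<Longrightarrow> 0 \<le> phi_minus g N"
  by (simp add: phi_minus_eq_sum sum_nonneg)

lemma phi_plus_nonneg: "0 < g \<Longrightarrow> 1 \<le> N \<Longrightarrow> 0 \<le> phi_plus g N"
  unfolding phi_plus_eq_sum by (intro sum_nonneg) auto

lemma binomial_add_mono: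
  assumes "a \<le> a'" "b \<le> b'"
  shows "((a + b) choose a) \<le> ((a' + b') choose a')"
proof -
  have "((a + b) choose a) \<le> ((a' + b) choose a')"
    by (rule lift_Suc_mono_le[where f = "\<lambda>a. (a + b) choose a", OF _ assms(1)]) simp
  also have "\<dots> \<le> ((a' + b') choose a')"
    by (rule lift_Suc_mono_le[where f = "\<lambda>b. (a' + b) choose a'", OF _ assms(2)]) (cases a'; simp)
  finally show ?thesis .
qed

text \<open>Once \<open>w a b\<close> is replaced by its bound \<open>K\<close>, the double sum
  factors into two geometric sums, and both grow when the chain sizes \<open>m\<close>,
  \<open>m'\<close> are replaced by the block sizes \<open>N\<close>, \<open>N'\<close>. The weight
  \<open>w\<close> is arbitrary so that the lemma serves E and, with the roles of the two indices
  exchanged, also F.\<close>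

lemma weighted_double_sum_le:
  fixes x y g g' K :: real
  assumes g: "0 < g" "0 < g'" and x: "0 \<le> x" "x \<le> 1 / g'" and y: "0 \<le> y" "y \<le> 1 / g"
    and m: "1 \<le> m'" "m' \<le> N'" "1 \<le> m" "m \<le> N"
    and K: "\<And>a b. a < m' \<Longrightarrow> b < m \<Longrightarrow> real (w a b) \<le> K"
  shows "(\<Sum>a<m'. \<Sum>b<m. real (w a b) * x ^ Suc a * y ^ b * (if Suc a < m' then 2 else 1))
    \<le> K * phi_minus g N * phi_plus g' N'"
proof -
  have K0: "0 \<le> K"
    using K[of 0 0] m by (simp add: order_trans[of 0 "real (w 0 0)"])
  have "(\<Sum>a<m'. \<Sum>b<m. real (w a b) * x ^ Suc a * y ^ b * (if Suc a < m' then 2 else 1))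
      \<le> (\<Sum>a<m'. \<Sum>b<m. K * (1 / g') ^ Suc a * (1 / g) ^ b * (if Suc a < N' then 2 else 1))"
    using x y m g K0
    by (intro sum_mono mult_mono power_mono K mult_nonneg_nonneg) auto
  also have "\<dots> = K * ((\<Sum>b<m. (1 / g) ^ b) *
      (\<Sum>a<m'. (1 / g') ^ Suc a * (if Suc a < N' then 2 else 1)))"
    unfolding sum_product
    by (subst sum.swap) (simp only: sum_distrib_left mult_ac)
  also have "\<dots> \<le> K * ((\<Sum>b<N. (1 / g) ^ b) *
      (\<Sum>a<N'. (1 / g') ^ Suc a * (if Suc a < N' then 2 else 1)))"
    using g m K0
    by (intro mult_left_mono mult_mono sum_mono2 mult_nonneg_nonneg sum_nonneg) auto
  also have "\<dots> = K * phi_minus g N * phi_plus g' N'"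
    using g m by (simp add: phi_minus_eq_sum phi_plus_eq_sum del: power_Suc)
  finally show ?thesis .
qed

text \<open>Entrywise the equation expresses d z(i,j), with d = \<mu>' - \<mu>, by z(i-1,j),
  z(i,j+1) and entries of E and F, so z is the finite Neumann series and Minkowski's inequality sums
  its shifted copies of E and F. The gaps enter as lower bounds because \<open>rel_gap\<close> and
  \<open>rel_gap'\<close> are minima over conjugates.\<close>

lemma chain_block_sylvester_bound:
  assumes Z: "Z \<in> carrier_mat m' m" and E: "E \<in> carrier_mat m' m" and F: "F \<in> carrier_mat m' m"
    and eq: "chain_block \<mu>' m' * (Z + E) = (Z + F) * chain_block \<mu> m"
    and \<mu>: "\<mu> \<noteq> 0" "\<mu>' \<noteq> 0"
    and g: "0 < g" "g \<le> cmod ((\<mu>' - \<mu>) / \<mu>)"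
    and g': "0 < g'" "g' \<le> cmod ((\<mu>' - \<mu>) / \<mu>')"
    and m: "1 \<le> m" "m \<le> N" and m': "1 \<le> m'" "m' \<le> N'"
  shows "frob_norm Z \<le>
    real ((N' + N - 1) choose N) * phi_minus g N * phi_plus g' N' * frob_norm E +
    real ((N' + N - 1) choose N') * phi_minus g' N' * phi_plus g N * frob_norm F"
proof -
  define d p q where "d = \<mu>' - \<mu>" and "p = cmod \<mu>'" and "q = cmod \<mu>"
  have d: "d \<noteq> 0"
    using g by (auto simp: d_def)
  define z e f where "z = mat_ext Z" and "e = mat_ext E" and "f = mat_ext F"
  define r where "r = (\<lambda>i j. - \<mu>' * e i j - of_real p * e (i - 1) j + \<mu> * f i j + of_real q * f i (j + 1))"
  define P Q where "P = m' - 1" and "Q = m - 1"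
  have PQ: "Suc P = m'" "Suc Q = m"
    using m m' by (auto simp: P_def Q_def)
  note dims = carrier_matD[OF Z] carrier_matD[OF E] carrier_matD[OF F]
  let ?c = "neumann_coeff d (of_real p) (of_real q)"
  have sol: "z i j = (\<Sum>a<Suc P. \<Sum>b<Suc Q. ?c a b * r (i - int a) (j + int b))"
    if ij: "i \<le> int P" "0 \<le> j" for i j
  proof (rule sylvester_recurrence_solution[OF d _ _ _ ij])
    show "r i j = 0" "z i j = 0" if "i < 0 \<or> int Q < j" for i j
      using that PQ by (auto simp: r_def z_def e_def f_def mat_ext_def dims)
    show "d * z i j = r i j - of_real p * z (i - 1) j + of_real q * z i (j + 1)"
      if ij: "0 \<le> i" "i \<le> int P" "0 \<le> j" "j \<le> int Q" for i j
    proof -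
      obtain k l where kl: "i = int k" "j = int l" "k < m'" "l < m"
        using ij PQ by (metis le_imp_less_Suc nonneg_int_cases of_nat_le_iff)
      have add: "mat_ext (X + Y) i j = mat_ext X i j + mat_ext Y i j"
        if "X \<in> carrier_mat m' m" "Y \<in> carrier_mat m' m" for X Y i j
        using that by (auto simp: mat_ext_def)
      have "(chain_block \<mu>' m' * (Z + E)) $$ (k, l) = ((Z + F) * chain_block \<mu> m) $$ (k, l)"
        by (simp add: eq)
      then have "\<mu>' * (z i j + e i j) + of_real p * (z (i - 1) j + e (i - 1) j) =
          \<mu> * (z i j + f i j) + of_real q * (z i (j + 1) + f i (j + 1))"
        using Z E F kl
        by (simp add: chain_block_mult_left[where n = m] chain_block_mult_right[where m = m'] add
            z_def e_def f_def p_def q_def)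
      then show ?thesis
        by (simp add: d_def r_def algebra_simps)
    qed
  qed
  let ?S = "{0..<int m'} \<times> {0..<int m}"
  let ?k = "\<lambda>a b. cmod (?c a b)"
  let ?L = "\<lambda>u a b. L2_set (\<lambda>(i, j). cmod (u (i - int a) (j + int b))) ?S"
  have L: "?L e a b \<le> (if a < m' \<and> b < m then frob_norm E else 0)"
    "?L f a b \<le> (if a < m' \<and> b < m then frob_norm F else 0)" for a b
    unfolding e_def f_def by (rule frob_norm_shift_le; simp add: dims)+
  \<comment> \<open>The term (a,b) of the series meets four shifted entries: the chain on the left
    sends E to the shifts (a,b) and (a+1,b), the chain on the right sends F to (a,b) and
    (a,b+1).\<close>
  let ?t = "\<lambda>a b x. ?k a b * (p * (case x of (i, j) \<Rightarrow> cmod (e (i - int a) (j + int b)))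
      + p * (case x of (i, j) \<Rightarrow> cmod (e (i - int (Suc a)) (j + int b)))
      + q * (case x of (i, j) \<Rightarrow> cmod (f (i - int a) (j + int b)))
      + q * (case x of (i, j) \<Rightarrow> cmod (f (i - int a) (j + int (Suc b)))))"
  have r_le: "cmod (r i j) \<le> p * cmod (e i j) + p * cmod (e (i - 1) j) + q * cmod (f i j) + q * cmod (f i (j + 1))" for i j
  proof -
    have "cmod (r i j) \<le> cmod (- \<mu>' * e i j) + cmod (of_real p * e (i - 1) j) + cmod (\<mu> * f i j) + cmod (of_real q * f i (j + 1))"
      unfolding r_def by (intro norm_triangle_le add_mono norm_triangle_le_diff order_refl)
    then show ?thesis
      by (simp add: norm_mult p_def q_def)
  qed
  have z_le: "(case x of (i, j) \<Rightarrow> cmod (z i j)) \<le> (\<Sum>a<m'. \<Sum>b<m. ?t a b x)" if "x \<in> ?S" for x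
  proof -
    obtain i j where x: "x = (i, j)"
      by force
    have ij: "i \<le> int P" "0 \<le> j"
      using that by (auto simp: x simp flip: PQ(1))
    have "cmod (z i j) \<le> (\<Sum>a<m'. cmod (\<Sum>b<m. ?c a b * r (i - int a) (j + int b)))"
      unfolding sol[OF ij] PQ by (rule norm_sum)
    also have "\<dots> \<le> (\<Sum>a<m'. \<Sum>b<m. ?k a b * cmod (r (i - int a) (j + int b)))"
      by (intro sum_mono order_trans[OF norm_sum]) (simp add: norm_mult)
    also have "\<dots> \<le> (\<Sum>a<m'. \<Sum>b<m. ?t a b x)"
      using r_le[of "i - int _" "j + int _"]
      by (intro sum_mono mult_left_mono) (simp_all add: x algebra_simps diff_diff_eq)
    finally show ?thesis
      by (simp add: x)
  qed
  \<comment> \<open>Both copies of E count unless the further shift a+1 already leaves the matrix,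
    likewise for F and b+1. These are the weights 2 and 1 in \<open>phi_plus_eq_sum\<close>.\<close>
  have L_t: "L2_set (?t a b) ?S \<le>
      ?k a b * p * (if Suc a < m' then 2 else 1) * frob_norm E +
      ?k a b * q * (if Suc b < m then 2 else 1) * frob_norm F" if "a < m'" "b < m" for a b
  proof -
    have nn: "0 \<le> p" "0 \<le> q"
      by (auto simp: p_def q_def)
    have "L2_set (?t a b) ?S \<le> ?k a b * (p * ?L e a b + p * ?L e (Suc a) b + q * ?L f a b + q * ?L f a (Suc b))"
      unfolding L2_set_right_distrib[OF nn(1)] L2_set_right_distrib[OF nn(2)]
        L2_set_right_distrib[OF norm_ge_zero, symmetric]
      by (intro mult_left_mono order_trans[OF L2_set_triangle_ineq] add_mono order_refl norm_ge_zero)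
    also have "\<dots> \<le> ?k a b * (p * frob_norm E + p * (if Suc a < m' then frob_norm E else 0) +
        q * frob_norm F + q * (if Suc b < m then frob_norm F else 0))"
      using L[of a b] L[of "Suc a" b] L[of a "Suc b"] that nn
      by (intro mult_left_mono add_mono) auto
    finally show ?thesis
      by (simp add: algebra_simps split: if_splits)
  qed
  \<comment> \<open>The coefficient has one more factor 1/d than a + b. It pairs with the p in front
    of E or the q in front of F, so E gets one extra power of x and F one extra power of y.\<close>
  define x y where "x = p / cmod d" and "y = q / cmod d"
  have xy: "0 \<le> x" "x \<le> 1 / g'" "0 \<le> y" "y \<le> 1 / g"
    using g g' \<mu> d by (auto simp: x_def y_def p_def q_def d_def norm_divide field_simps)
  have kp: "?k a b * p = real ((a + b) choose a) * x ^ Suc a * y ^ b"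
    and kq: "?k a b * q = real ((a + b) choose a) * y ^ Suc b * x ^ a" for a b
    by (simp_all add: neumann_coeff_def x_def y_def p_def q_def norm_mult norm_divide norm_power
        power_divide power_add mult_ac)
  \<comment> \<open>Here a <= N' - 1 and b <= N - 1. Enlarging the pair to (N' - 1, N) gives the
    binomial of \<open>phi1\<close>, after using its symmetry, and enlarging it to (N', N - 1) gives
    that of \<open>phi2\<close>.\<close>
  have binom: "real ((a + b) choose a) \<le> real ((N' + N - 1) choose N)"
    "real ((a + b) choose a) \<le> real ((N' + N - 1) choose N')" if "a < m'" "b < m" for a b
  proof -
    have "N' + N - 1 - N = N' - 1"
      using m by simp
    then have "((N' + N - 1) choose N) = ((N' + N - 1) choose (N' - 1))"
      using m m' by (subst binomial_symmetric) auto
    then show "real ((a + b) choose a) \<le> real ((N' + N - 1) choose N)"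
      "real ((a + b) choose a) \<le> real ((N' + N - 1) choose N')"
      using binomial_add_mono[of a "N' - 1" b N] binomial_add_mono[of a N' b "N - 1"] that m m'
      by simp_all
  qed
  have "frob_norm Z = L2_set (\<lambda>(i, j). cmod (z i j)) ?S"
    unfolding z_def frob_norm_L2_set by (simp add: dims)
  also have "\<dots> \<le> L2_set (\<lambda>x. \<Sum>a<m'. \<Sum>b<m. ?t a b x) ?S"
    by (intro L2_set_mono z_le) auto
  also have "\<dots> \<le> (\<Sum>a<m'. \<Sum>b<m. L2_set (?t a b) ?S)"
    by (intro order_trans[OF L2_set_sum_le] sum_mono order_refl)
  also have "\<dots> \<le> (\<Sum>a<m'. \<Sum>b<m. ?k a b * p * (if Suc a < m' then 2 else 1) * frob_norm E +
      ?k a b * q * (if Suc b < m then 2 else 1) * frob_norm F)"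
    by (intro sum_mono L_t) auto
  \<comment> \<open>In the F part the sums are interchanged, so that the index carrying the weight
    is the outer one, as \<open>weighted_double_sum_le\<close> expects.\<close>
  also have "\<dots> = (\<Sum>a<m'. \<Sum>b<m. real ((a + b) choose a) * x ^ Suc a * y ^ b * (if Suc a < m' then 2 else 1)) * frob_norm E +
      (\<Sum>b<m. \<Sum>a<m'. real ((a + b) choose a) * y ^ Suc b * x ^ a * (if Suc b < m then 2 else 1)) * frob_norm F"
    unfolding kp kq sum.distrib sum_distrib_right
    by (subst (4) sum.swap) simp
  also have "\<dots> \<le> (real ((N' + N - 1) choose N) * phi_minus g N * phi_plus g' N') * frob_norm E +
      (real ((N' + N - 1) choose N') * phi_minus g' N' * phi_plus g N) * frob_norm F"
    by (intro add_mono mult_right_mono weighted_double_sum_le g g' xy m m' binom frob_norm_nonneg) 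
  finally show ?thesis .
qed

section \<open>Block partitions\<close>

definition submat :: "nat \<Rightarrow> nat \<Rightarrow> nat \<Rightarrow> nat \<Rightarrow> 'a mat \<Rightarrow> 'a mat" where
  "submat r c m n Y = mat m n (\<lambda>(i, j). Y $$ (i + r, j + c))"

lemma submat_carrier [simp]: "submat r c m n Y \<in> carrier_mat m n"
  by (simp add: submat_def)

lemma submat_add:
  assumes "Y \<in> carrier_mat k l" "Z \<in> carrier_mat k l" "r + m \<le> k" "c + n \<le> l"
  shows "submat r c m n (Y + Z) = submat r c m n Y + submat r c m n Z"
  using assms by (intro eq_matI) (auto simp: submat_def)

lemma sum_lessThan_add:
  fixes f :: "nat \<Rightarrow> 'a :: comm_monoid_add"
  shows "(\<Sum>i<m + n. f i) = (\<Sum>i<m. f i) + (\<Sum>i<n. f (i + m))"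
  by (induction n) (auto simp: ac_simps)

lemma submat_mult_row_window:
  assumes "Y \<in> carrier_mat k d" "S \<in> carrier_mat d n" "r + m \<le> k"
  shows "submat r 0 m n (Y * S) = submat r 0 m d Y * S"
proof (intro eq_matI)
  fix i j
  assume "i < dim_row (submat r 0 m d Y * S)" "j < dim_col (submat r 0 m d Y * S)"
  then have ij: "i < m" "j < n"
    using assms by (auto simp: submat_def)
  have "(submat r 0 m d Y * S) $$ (i, j) = (\<Sum>l<d. Y $$ (i + r, l) * S $$ (l, j))"
    unfolding index_mult_mat_sum[OF submat_carrier assms(2) ij]
    by (intro sum.cong refl) (use ij in \<open>simp add: submat_def\<close>)
  then show "submat r 0 m n (Y * S) $$ (i, j) = (submat r 0 m d Y * S) $$ (i, j)"
    using ij assms(3) by (simp add: submat_def index_mult_mat_sum[OF assms(1,2)] del: index_mult_mat)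
qed (use assms in \<open>auto simp: submat_def\<close>)

lemma submat_mult_col_window:
  assumes "T \<in> carrier_mat m d" "Y \<in> carrier_mat d k" "c + n \<le> k"
  shows "submat 0 c m n (T * Y) = T * submat 0 c d n Y"
proof (intro eq_matI)
  fix i j
  assume "i < dim_row (T * submat 0 c d n Y)" "j < dim_col (T * submat 0 c d n Y)"
  then have ij: "i < m" "j < n"
    using assms by (auto simp: submat_def)
  have "(T * submat 0 c d n Y) $$ (i, j) = (\<Sum>l<d. T $$ (i, l) * Y $$ (l, j + c))"
    unfolding index_mult_mat_sum[OF assms(1) submat_carrier ij]
    by (intro sum.cong refl) (use ij in \<open>simp add: submat_def\<close>)
  then show "submat 0 c m n (T * Y) $$ (i, j) = (T * submat 0 c d n Y) $$ (i, j)"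
    using ij assms(3) by (simp add: submat_def index_mult_mat_sum[OF assms(1,2)] del: index_mult_mat)
qed (use assms in \<open>auto simp: submat_def\<close>)

text \<open>Spelled exactly like one step of the recursion of \<open>diag_block_mat\<close>, so that
  unfolding a nonempty list produces it.\<close>

abbreviation diag2 :: "'a :: zero mat \<Rightarrow> 'a mat \<Rightarrow> 'a mat" where
  "diag2 A D \<equiv> four_block_mat A (0\<^sub>m (dim_row A) (dim_col D)) (0\<^sub>m (dim_row D) (dim_col A)) D"

lemma diag2_mult_submat:
  assumes A: "A \<in> carrier_mat m m" and D: "D \<in> carrier_mat m' m'"
    and Y: "Y \<in> carrier_mat (m + m') k" and c: "c + n \<le> k"
  shows "submat 0 c m n (diag2 A D * Y) = A * submat 0 c m n Y"
    and "submat m c m' n (diag2 A D * Y) = D * submat m c m' n Y"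
proof -
  note AD = carrier_matD[OF A] carrier_matD[OF D]
  have diag: "diag2 A D \<in> carrier_mat (m + m') (m + m')"
    using A D by auto
  show "submat 0 c m n (diag2 A D * Y) = A * submat 0 c m n Y"
  proof (intro eq_matI)
    fix i j
    assume "i < dim_row (A * submat 0 c m n Y)" "j < dim_col (A * submat 0 c m n Y)"
    then have ij: "i < m" "j < n"
      using AD by (auto simp: submat_def)
    then have ij': "i < m + m'" "j + c < k"
      using c by auto
    have "(diag2 A D * Y) $$ (i, j + c) = (A * submat 0 c m n Y) $$ (i, j)"
      unfolding index_mult_mat_sum[OF diag Y ij'] index_mult_mat_sum[OF A submat_carrier ij]
        sum_lessThan_add
      using ij AD by (simp add: submat_def)
    then show "submat 0 c m n (diag2 A D * Y) $$ (i, j) = (A * submat 0 c m n Y) $$ (i, j)"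
      using ij by (simp add: submat_def)
  qed (use AD in \<open>auto simp: submat_def\<close>)
  show "submat m c m' n (diag2 A D * Y) = D * submat m c m' n Y"
  proof (intro eq_matI)
    fix i j
    assume "i < dim_row (D * submat m c m' n Y)" "j < dim_col (D * submat m c m' n Y)"
    then have ij: "i < m'" "j < n"
      using AD by (auto simp: submat_def)
    then have ij': "i + m < m + m'" "j + c < k"
      using c by auto
    have "(diag2 A D * Y) $$ (i + m, j + c) = (D * submat m c m' n Y) $$ (i, j)"
      unfolding index_mult_mat_sum[OF diag Y ij'] index_mult_mat_sum[OF D submat_carrier ij]
        sum_lessThan_add
      using ij AD by (simp add: submat_def)
    then show "submat m c m' n (diag2 A D * Y) $$ (i, j) = (D * submat m c m' n Y) $$ (i, j)"
      using ij by (simp add: submat_def)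
  qed (use AD in \<open>auto simp: submat_def\<close>)
qed

lemma mult_diag2_submat:
  assumes A: "A \<in> carrier_mat n n" and D: "D \<in> carrier_mat n' n'"
    and Y: "Y \<in> carrier_mat k (n + n')" and r: "r + m \<le> k"
  shows "submat r 0 m n (Y * diag2 A D) = submat r 0 m n Y * A"
    and "submat r n m n' (Y * diag2 A D) = submat r n m n' Y * D"
proof -
  note AD = carrier_matD[OF A] carrier_matD[OF D]
  have diag: "diag2 A D \<in> carrier_mat (n + n') (n + n')"
    using A D by auto
  show "submat r 0 m n (Y * diag2 A D) = submat r 0 m n Y * A"
  proof (intro eq_matI)
    fix i j
    assume "i < dim_row (submat r 0 m n Y * A)" "j < dim_col (submat r 0 m n Y * A)"
    then have ij: "i < m" "j < n"
      using AD by (auto simp: submat_def)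
    then have ij': "i + r < k" "j < n + n'"
      using r by auto
    have "(Y * diag2 A D) $$ (i + r, j) = (submat r 0 m n Y * A) $$ (i, j)"
      unfolding index_mult_mat_sum[OF Y diag ij'] index_mult_mat_sum[OF submat_carrier A ij]
        sum_lessThan_add
      using ij AD by (simp add: submat_def)
    then show "submat r 0 m n (Y * diag2 A D) $$ (i, j) = (submat r 0 m n Y * A) $$ (i, j)"
      using ij by (simp add: submat_def)
  qed (use AD in \<open>auto simp: submat_def\<close>)
  show "submat r n m n' (Y * diag2 A D) = submat r n m n' Y * D"
  proof (intro eq_matI)
    fix i j
    assume "i < dim_row (submat r n m n' Y * D)" "j < dim_col (submat r n m n' Y * D)"
    then have ij: "i < m" "j < n'"
      using AD by (auto simp: submat_def)
    then have ij': "i + r < k" "j + n < n + n'"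
      using r by auto
    have "(Y * diag2 A D) $$ (i + r, j + n) = (submat r n m n' Y * D) $$ (i, j)"
      unfolding index_mult_mat_sum[OF Y diag ij'] index_mult_mat_sum[OF submat_carrier D ij]
        sum_lessThan_add
      using ij AD by (simp add: submat_def)
    then show "submat r n m n' (Y * diag2 A D) $$ (i, j) = (submat r n m n' Y * D) $$ (i, j)"
      using ij by (simp add: submat_def)
  qed (use AD in \<open>auto simp: submat_def\<close>)
qed

section \<open>Two-term Sylvester bounds for direct sums\<close>

lemma frob_norm_sq: "(frob_norm A)\<^sup>2 = (\<Sum>i<dim_row A. \<Sum>j<dim_col A. (norm (A $$ (i, j)))\<^sup>2)"
  by (simp add: frob_norm_def sum_nonneg)

lemma frob_norm_split_rows:
  fixes Y :: "complex mat"
  assumes "Y \<in> carrier_mat (m + m') n"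
  shows "frob_norm Y = sqrt ((frob_norm (submat 0 0 m n Y))\<^sup>2 + (frob_norm (submat m 0 m' n Y))\<^sup>2)"
  using assms by (subst frob_norm_def) (simp add: frob_norm_sq submat_def sum_lessThan_add)

lemma frob_norm_split_cols:
  fixes Y :: "complex mat"
  assumes "Y \<in> carrier_mat m (n + n')"
  shows "frob_norm Y = sqrt ((frob_norm (submat 0 0 m n Y))\<^sup>2 + (frob_norm (submat 0 n m n' Y))\<^sup>2)"
  using assms
  by (subst frob_norm_def) (simp add: frob_norm_sq submat_def sum_lessThan_add sum.distrib)

text \<open>Minkowski's inequality in the plane for the vectors (c1 e1, c1 e2) and (c2 f1, c2
  f2).\<close>

lemma sqrt_sum_squares_le_combination:
  fixes z1 z2 e1 e2 f1 f2 :: real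
  assumes "z1 \<le> c1 * e1 + c2 * f1" "z2 \<le> c1 * e2 + c2 * f2" "0 \<le> z1" "0 \<le> z2" "0 \<le> c1" "0 \<le> c2"
  shows "sqrt (z1\<^sup>2 + z2\<^sup>2) \<le> c1 * sqrt (e1\<^sup>2 + e2\<^sup>2) + c2 * sqrt (f1\<^sup>2 + f2\<^sup>2)"
proof -
  have scale: "c * sqrt (x\<^sup>2 + y\<^sup>2) = sqrt ((c * x)\<^sup>2 + (c * y)\<^sup>2)" if "0 \<le> c" for c x y :: real
    using that by (simp add: power_mult_distrib real_sqrt_mult flip: distrib_left)
  have "sqrt (z1\<^sup>2 + z2\<^sup>2) \<le> sqrt ((c1 * e1 + c2 * f1)\<^sup>2 + (c1 * e2 + c2 * f2)\<^sup>2)"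
    using assms by (intro real_sqrt_le_mono add_mono power_mono)
  also have "\<dots> \<le> c1 * sqrt (e1\<^sup>2 + e2\<^sup>2) + c2 * sqrt (f1\<^sup>2 + f2\<^sup>2)"
    unfolding scale[OF assms(5)] scale[OF assms(6)]
    by (rule real_sqrt_sum_squares_triangle_ineq)
  finally show ?thesis .
qed

text \<open>
  Unlike the solution operator itself, this two-term bound passes to direct sums on either side
  with unchanged constants, by Minkowski's inequality.
\<close>
definition sylvester_bounded :: "real \<Rightarrow> real \<Rightarrow> complex mat \<Rightarrow> complex mat \<Rightarrow> bool" where
  "sylvester_bounded c1 c2 T S \<longleftrightarrow>
     (\<forall>Z E F. Z \<in> carrier_mat (dim_row T) (dim_row S) \<longrightarrow> E \<in> carrier_mat (dim_row T) (dim_row S) \<longrightarrow>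
        F \<in> carrier_mat (dim_row T) (dim_row S) \<longrightarrow> T * (Z + E) = (Z + F) * S \<longrightarrow>
        frob_norm Z \<le> c1 * frob_norm E + c2 * frob_norm F)"

lemma sylvester_boundedD:
  assumes "sylvester_bounded c1 c2 T S" "T \<in> carrier_mat m m" "S \<in> carrier_mat n n"
    and "Z \<in> carrier_mat m n" "E \<in> carrier_mat m n" "F \<in> carrier_mat m n"
    and "T * (Z + E) = (Z + F) * S"
  shows "frob_norm Z \<le> c1 * frob_norm E + c2 * frob_norm F"
  using assms(1)[unfolded sylvester_bounded_def, rule_format, of Z E F] assms(2-)
  by (simp only: carrier_matD)

lemma sylvester_boundedI:
  assumes "T \<in> carrier_mat m m" "S \<in> carrier_mat n n"
    and "\<And>Z E F. Z \<in> carrier_mat m n \<Longrightarrow> E \<in> carrier_mat m n \<Longrightarrow> F \<in> carrier_mat m n \<Longrightarrow>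
      T * (Z + E) = (Z + F) * S \<Longrightarrow> frob_norm Z \<le> c1 * frob_norm E + c2 * frob_norm F"
  shows "sylvester_bounded c1 c2 T S"
  unfolding sylvester_bounded_def carrier_matD(1)[OF assms(1)] carrier_matD(1)[OF assms(2)]
  by (intro allI impI assms(3))

text \<open>The column strips of Z, E and F satisfy separate equations with the same left factor,
  and the squares of their Frobenius norms add up.\<close>

lemma sylvester_bounded_diag_right:
  assumes c: "0 \<le> c1" "0 \<le> c2" and T: "square_mat T"
    and Ss: "\<And>S. S \<in> set Ss \<Longrightarrow> square_mat S \<and> sylvester_bounded c1 c2 T S"
  shows "sylvester_bounded c1 c2 T (diag_block_mat Ss)"
  using Ss
proof (induction Ss)
  case Nil
  then show ?case
    by (auto simp: sylvester_bounded_def frob_norm_def)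
next
  case (Cons S Ss)
  define D where "D = diag_block_mat Ss"
  define k n n' where "k = dim_row T" and "n = dim_row S" and "n' = dim_row D"
  have "square_mat D"
    unfolding D_def using Cons.prems by (intro diag_block_mat_square) simp
  then have T: "T \<in> carrier_mat k k" and S: "S \<in> carrier_mat n n" and D: "D \<in> carrier_mat n' n'"
    using T Cons.prems[of S] unfolding k_def n_def n'_def carrier_mat_def by simp_all
  have SD: "diag2 S D \<in> carrier_mat (n + n') (n + n')"
    using S D by simp
  have bd: "sylvester_bounded c1 c2 T S" "sylvester_bounded c1 c2 T D"
    unfolding D_def using Cons.prems by (simp, intro Cons.IH) simp
  have "frob_norm Z \<le> c1 * frob_norm E + c2 * frob_norm F"
    if ZEF: "Z \<in> carrier_mat k (n + n')" "E \<in> carrier_mat k (n + n')" "F \<in> carrier_mat k (n + n')"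
      and eq: "T * (Z + E) = (Z + F) * diag2 S D" for Z E F
  proof -
    let ?l = "submat 0 0 k n" and ?r = "submat 0 n k n'"
    have add: "Z + E \<in> carrier_mat k (n + n')" "Z + F \<in> carrier_mat k (n + n')"
      using ZEF by auto
    have "?l (T * (Z + E)) = ?l ((Z + F) * diag2 S D)" "?r (T * (Z + E)) = ?r ((Z + F) * diag2 S D)"
      by (simp_all only: eq)
    then have eqs: "T * (?l Z + ?l E) = (?l Z + ?l F) * S" "T * (?r Z + ?r E) = (?r Z + ?r F) * D"
      using submat_add[OF ZEF(1,2), of 0 k 0 n] submat_add[OF ZEF(1,3), of 0 k 0 n]
        submat_add[OF ZEF(1,2), of 0 k n n'] submat_add[OF ZEF(1,3), of 0 k n n']
      by (simp_all add: submat_mult_col_window[OF T add(1)] mult_diag2_submat[OF S D add(2)])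
    note submat_carriers = submat_carrier submat_carrier submat_carrier
    show ?thesis
      unfolding ZEF[THEN frob_norm_split_cols]
      by (rule sqrt_sum_squares_le_combination[OF
            sylvester_boundedD[OF bd(1) T S submat_carriers eqs(1)]
            sylvester_boundedD[OF bd(2) T D submat_carriers eqs(2)]]) (use c in auto)
  qed
  then show ?case
    unfolding diag_block_mat.simps D_def[symmetric] Let_def
    by (rule sylvester_boundedI[OF T SD])
qed

text \<open>The mirror image, with row strips and a common right factor.\<close>

lemma sylvester_bounded_diag_left:
  assumes c: "0 \<le> c1" "0 \<le> c2" and S: "square_mat S"
    and Ts: "\<And>T. T \<in> set Ts \<Longrightarrow> square_mat T \<and> sylvester_bounded c1 c2 T S"
  shows "sylvester_bounded c1 c2 (diag_block_mat Ts) S"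
  using Ts
proof (induction Ts)
  case Nil
  then show ?case
    by (auto simp: sylvester_bounded_def frob_norm_def)
next
  case (Cons T Ts)
  define D where "D = diag_block_mat Ts"
  define k m m' where "k = dim_row S" and "m = dim_row T" and "m' = dim_row D"
  have "square_mat D"
    unfolding D_def using Cons.prems by (intro diag_block_mat_square) simp
  then have S: "S \<in> carrier_mat k k" and T: "T \<in> carrier_mat m m" and D: "D \<in> carrier_mat m' m'"
    using S Cons.prems[of T] unfolding k_def m_def m'_def carrier_mat_def by simp_all
  have TD: "diag2 T D \<in> carrier_mat (m + m') (m + m')"
    using T D by simp
  have bd: "sylvester_bounded c1 c2 T S" "sylvester_bounded c1 c2 D S"
    unfolding D_def using Cons.prems by (simp, intro Cons.IH) simp
  have "frob_norm Z \<le> c1 * frob_norm E + c2 * frob_norm F"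
    if ZEF: "Z \<in> carrier_mat (m + m') k" "E \<in> carrier_mat (m + m') k" "F \<in> carrier_mat (m + m') k"
      and eq: "diag2 T D * (Z + E) = (Z + F) * S" for Z E F
  proof -
    let ?u = "submat 0 0 m k" and ?d = "submat m 0 m' k"
    have add: "Z + E \<in> carrier_mat (m + m') k" "Z + F \<in> carrier_mat (m + m') k"
      using ZEF by auto
    have "?u (diag2 T D * (Z + E)) = ?u ((Z + F) * S)" "?d (diag2 T D * (Z + E)) = ?d ((Z + F) * S)"
      by (simp_all only: eq)
    then have eqs: "T * (?u Z + ?u E) = (?u Z + ?u F) * S" "D * (?d Z + ?d E) = (?d Z + ?d F) * S"
      using submat_add[OF ZEF(1,2), of 0 m 0 k] submat_add[OF ZEF(1,3), of 0 m 0 k]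
        submat_add[OF ZEF(1,2), of m m' 0 k] submat_add[OF ZEF(1,3), of m m' 0 k]
      by (simp_all add: submat_mult_row_window[OF add(2) S] diag2_mult_submat[OF T D add(1)])
    note submat_carriers = submat_carrier submat_carrier submat_carrier
    show ?thesis
      unfolding ZEF[THEN frob_norm_split_rows]
      by (rule sqrt_sum_squares_le_combination[OF
            sylvester_boundedD[OF bd(1) T S submat_carriers eqs(1)]
            sylvester_boundedD[OF bd(2) D S submat_carriers eqs(2)]]) (use c in auto)
  qed
  then show ?case
    unfolding diag_block_mat.simps D_def[symmetric] Let_def
    by (rule sylvester_boundedI[OF TD S])
qed

section \<open>Spectral and Frobenius norms\<close>

lemma dim_mat_adjoint [simp]: "dim_row (mat_adjoint A) = dim_col A" "dim_col (mat_adjoint A) = dim_row A"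
  by (simp_all add: mat_adjoint_def)

lemma mat_adjoint_carrier: "A \<in> carrier_mat m n \<Longrightarrow> mat_adjoint A \<in> carrier_mat n m"
  by auto

lemma index_mat_adjoint [simp]:
  fixes A :: "complex mat"
  shows "i < dim_col A \<Longrightarrow> j < dim_row A \<Longrightarrow> mat_adjoint A $$ (i, j) = cnj (A $$ (j, i))"
  by (simp add: mat_adjoint_def mat_of_rows_def)

lemma mat_adjoint_mat_adjoint [simp]: "mat_adjoint (mat_adjoint A) = (A :: complex mat)"
  by (intro eq_matI) auto

lemma mat_adjoint_mult:
  fixes A B :: "complex mat"
  assumes "A \<in> carrier_mat m k" "B \<in> carrier_mat k n"
  shows "mat_adjoint (A * B) = mat_adjoint B * mat_adjoint A"
proof (intro eq_matI)
  fix i j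
  assume "i < dim_row (mat_adjoint B * mat_adjoint A)" "j < dim_col (mat_adjoint B * mat_adjoint A)"
  then have ij: "i < n" "j < m"
    using assms by auto
  then have "mat_adjoint (A * B) $$ (i, j) = cnj ((A * B) $$ (j, i))"
    using assms by simp
  also have "\<dots> = (mat_adjoint B * mat_adjoint A) $$ (i, j)"
    unfolding index_mult_mat_sum[OF assms ij(2,1)]
      index_mult_mat_sum[OF mat_adjoint_carrier[OF assms(2)] mat_adjoint_carrier[OF assms(1)] ij]
    using assms ij by (simp add: mult.commute)
  finally show "mat_adjoint (A * B) $$ (i, j) = (mat_adjoint B * mat_adjoint A) $$ (i, j)" .
qed (use assms in auto)

lemma mat_adjoint_one: "mat_adjoint (1\<^sub>m n) = (1\<^sub>m n :: complex mat)"
  by (intro eq_matI) auto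

text \<open>The trace makes Frobenius norms accessible to algebra: it is cyclic, it is the sum of
  the eigenvalues, and on an identity matrix it counts dimensions.\<close>

definition mat_trace :: "'a :: comm_monoid_add mat \<Rightarrow> 'a" where
  "mat_trace A = (\<Sum>i<dim_row A. A $$ (i, i))"

lemma mat_trace_mult_commute:
  fixes A B :: "'a :: comm_semiring_0 mat"
  assumes "A \<in> carrier_mat m n" "B \<in> carrier_mat n m"
  shows "mat_trace (A * B) = mat_trace (B * A)"
proof -
  have "mat_trace (A * B) = (\<Sum>i<m. \<Sum>j<n. A $$ (i, j) * B $$ (j, i))"
    using assms by (simp add: mat_trace_def index_mult_mat_sum[OF assms] del: index_mult_mat(1))
  also have "\<dots> = mat_trace (B * A)"
    using assms by (subst sum.swap)
      (simp add: mat_trace_def index_mult_mat_sum[OF assms(2,1)] mult.commute del: index_mult_mat(1))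
  finally show ?thesis .
qed

lemma frob_norm_sq_trace:
  fixes A :: "complex mat"
  shows "complex_of_real ((frob_norm A)\<^sup>2) = mat_trace (mat_adjoint A * A)"
proof -
  have A: "A \<in> carrier_mat (dim_row A) (dim_col A)"
    by simp
  have "mat_trace (mat_adjoint A * A) = (\<Sum>j<dim_col A. \<Sum>i<dim_row A. cnj (A $$ (i, j)) * A $$ (i, j))"
    by (simp add: mat_trace_def index_mult_mat_sum[OF mat_adjoint_carrier[OF A] A] del: index_mult_mat(1))
  also have "\<dots> = complex_of_real ((frob_norm A)\<^sup>2)"
    unfolding frob_norm_sq of_real_sum
    by (subst sum.swap) (intro sum.cong refl, simp add: complex_norm_square mult.commute flip: of_real_power)
  finally show ?thesis ..
qed

lemma frob_norm_adjoint [simp]: "frob_norm (mat_adjoint A) = frob_norm (A :: complex mat)"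
  unfolding frob_norm_def by (subst sum.swap) simp

lemma frob_inner_Cauchy_Schwarz:
  fixes A B :: "complex mat"
  assumes A: "A \<in> carrier_mat m n" and B: "B \<in> carrier_mat m n"
  shows "cmod (mat_trace (mat_adjoint A * B)) \<le> frob_norm A * frob_norm B"
proof -
  let ?S = "{..<n} \<times> {..<m}"
  have "mat_trace (mat_adjoint A * B) = (\<Sum>j<n. \<Sum>i<m. cnj (A $$ (i, j)) * B $$ (i, j))"
    using assms
    by (simp add: mat_trace_def index_mult_mat_sum[OF mat_adjoint_carrier[OF A] B] del: index_mult_mat(1))
  also have "\<dots> = (\<Sum>(j, i)\<in>?S. cnj (A $$ (i, j)) * B $$ (i, j))"
    by (rule sum.cartesian_product)
  finally have "cmod (mat_trace (mat_adjoint A * B)) \<le> (\<Sum>(j, i)\<in>?S. cmod (A $$ (i, j)) * cmod (B $$ (i, j)))"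
    by (auto intro!: order_trans[OF norm_sum] sum_mono simp: norm_mult)
  also have "\<dots> = (\<Sum>x\<in>?S. \<bar>case x of (j, i) \<Rightarrow> cmod (A $$ (i, j))\<bar> * \<bar>case x of (j, i) \<Rightarrow> cmod (B $$ (i, j))\<bar>)"
    by (intro sum.cong) auto
  also have "\<dots> \<le> L2_set (\<lambda>(j, i). cmod (A $$ (i, j))) ?S * L2_set (\<lambda>(j, i). cmod (B $$ (i, j))) ?S"
    by (rule L2_set_mult_ineq)
  also have "\<dots> = frob_norm A * frob_norm B"
  proof -
    have "L2_set (\<lambda>(j, i). cmod (Y $$ (i, j))) ?S = frob_norm Y" if "Y \<in> carrier_mat m n" for Y
    proof -
      have sq: "(\<lambda>x. (case x of (j, i) \<Rightarrow> cmod (Y $$ (i, j)))\<^sup>2) = (\<lambda>(j, i). (cmod (Y $$ (i, j)))\<^sup>2)"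
        by auto
      show ?thesis
        using that unfolding L2_set_def frob_norm_def sq sum.cartesian_product[symmetric]
        by (subst sum.swap) auto
    qed
    then show ?thesis
      using assms by simp
  qed
  finally show ?thesis .
qed

section \<open>The spectral norm as an operator bound\<close>

lemma vec_norm2_eq_frob_norm: "vec_norm2 v = frob_norm (mat_of_cols (dim_vec v) [v])"
  by (simp add: vec_norm2_def frob_norm_def mat_of_cols_def)

lemma frob_norm_sq_cols:
  "(frob_norm A)\<^sup>2 = (\<Sum>j<dim_col A. (vec_norm2 (col A j))\<^sup>2)"
  unfolding frob_norm_sq by (subst sum.swap) (simp add: vec_norm2_def sum_nonneg)

lemma vec_norm2_nonneg [simp]: "0 \<le> vec_norm2 v"
  by (simp add: vec_norm2_def sum_nonneg)

lemma vec_norm2_smult: "vec_norm2 (c \<cdot>\<^sub>v v) = cmod c * vec_norm2 v"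
  by (simp add: vec_norm2_def norm_mult power_mult_distrib real_sqrt_mult flip: sum_distrib_left)

lemma vec_norm2_eq_0: "vec_norm2 v = 0 \<Longrightarrow> v = 0\<^sub>v (dim_vec v)"
  by (intro eq_vecI) (auto simp: vec_norm2_def sum_nonneg_eq_0_iff)

text \<open>A crude bound by Cauchy-Schwarz on each row; it shows that the set whose supremum
  defines \<open>spec_norm\<close> is bounded above.\<close>

lemma vec_norm2_mult_le_frob_norm:
  assumes "v \<in> carrier_vec (dim_col A)"
  shows "vec_norm2 (A *\<^sub>v v) \<le> frob_norm A * vec_norm2 v"
proof -
  have v: "vec_norm2 v = L2_set (\<lambda>j. cmod (v $ j)) {..<dim_col A}"
    using assms by (simp add: vec_norm2_def L2_set_def)
  have row: "(cmod ((A *\<^sub>v v) $ i))\<^sup>2 \<le> (\<Sum>j<dim_col A. (cmod (A $$ (i, j)))\<^sup>2) * (vec_norm2 v)\<^sup>2"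
    if i: "i < dim_row A" for i
  proof -
    have "(A *\<^sub>v v) $ i = (\<Sum>j<dim_col A. A $$ (i, j) * v $ j)"
      using i assms by (auto simp: scalar_prod_def lessThan_atLeast0 intro!: sum.cong)
    then have "cmod ((A *\<^sub>v v) $ i) \<le> (\<Sum>j<dim_col A. \<bar>cmod (A $$ (i, j))\<bar> * \<bar>cmod (v $ j)\<bar>)"
      by (auto intro!: order_trans[OF norm_sum] sum_mono simp: norm_mult)
    also have "\<dots> \<le> L2_set (\<lambda>j. cmod (A $$ (i, j))) {..<dim_col A} * vec_norm2 v"
      unfolding v by (rule L2_set_mult_ineq)
    finally have "(cmod ((A *\<^sub>v v) $ i))\<^sup>2 \<le> (L2_set (\<lambda>j. cmod (A $$ (i, j))) {..<dim_col A} * vec_norm2 v)\<^sup>2"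
      by (intro power_mono) auto
    then show ?thesis
      by (simp add: power_mult_distrib L2_set_def sum_nonneg)
  qed
  have "(vec_norm2 (A *\<^sub>v v))\<^sup>2 = (\<Sum>i<dim_row A. (cmod ((A *\<^sub>v v) $ i))\<^sup>2)"
    by (simp add: vec_norm2_def sum_nonneg)
  also have "\<dots> \<le> (\<Sum>i<dim_row A. (\<Sum>j<dim_col A. (cmod (A $$ (i, j)))\<^sup>2) * (vec_norm2 v)\<^sup>2)"
    by (intro sum_mono row) auto
  also have "\<dots> = (frob_norm A * vec_norm2 v)\<^sup>2"
    by (simp add: power_mult_distrib frob_norm_sq flip: sum_distrib_right)
  finally show ?thesis
    by (rule power2_le_imp_le) simp
qed

lemma vec_norm2_mult_le:
  assumes v: "v \<in> carrier_vec (dim_col A)"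
  shows "vec_norm2 (A *\<^sub>v v) \<le> spec_norm A * vec_norm2 v"
proof -
  let ?S = "{vec_norm2 (A *\<^sub>v v) | v. v \<in> carrier_vec (dim_col A) \<and> vec_norm2 v \<le> 1}"
  have bdd: "bdd_above ?S"
  proof (rule bdd_aboveI[of _ "frob_norm A"])
    fix s assume "s \<in> ?S"
    then obtain w where w: "s = vec_norm2 (A *\<^sub>v w)" "w \<in> carrier_vec (dim_col A)" "vec_norm2 w \<le> 1"
      by auto
    have "s \<le> frob_norm A * vec_norm2 w"
      using w vec_norm2_mult_le_frob_norm by simp
    also have "\<dots> \<le> frob_norm A * 1"
      using w by (intro mult_left_mono) auto
    finally show "s \<le> frob_norm A"
      by simp
  qed
  show ?thesis
  proof (cases "vec_norm2 v = 0")
    case True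
    then show ?thesis
      using vec_norm2_mult_le_frob_norm[OF v] by simp
  next
    case False
    then have pos: "0 < vec_norm2 v"
      using vec_norm2_nonneg[of v] by linarith
    let ?w = "complex_of_real (1 / vec_norm2 v) \<cdot>\<^sub>v v"
    have "vec_norm2 ?w \<le> 1"
      using pos by (simp add: vec_norm2_smult norm_divide)
    then have "vec_norm2 (A *\<^sub>v ?w) \<le> spec_norm A"
      unfolding spec_norm_def using v by (intro cSup_upper[OF _ bdd]) auto
    moreover have "A *\<^sub>v ?w = complex_of_real (1 / vec_norm2 v) \<cdot>\<^sub>v (A *\<^sub>v v)"
      using v by (intro mult_mat_vec) auto
    ultimately show ?thesis
      using pos by (simp add: vec_norm2_smult norm_divide field_simps)
  qed
qed

lemma spec_norm_nonneg [simp]: "0 \<le> spec_norm A"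
proof (cases "dim_col A")
  case 0
  have "\<And>v. v \<in> carrier_vec 0 \<Longrightarrow> vec_norm2 (A *\<^sub>v v) = 0"
    using 0 by (auto simp: vec_norm2_def scalar_prod_def)
  then have "{vec_norm2 (A *\<^sub>v v) | v. v \<in> carrier_vec (dim_col A) \<and> vec_norm2 v \<le> 1} = {0}"
    using 0 by (auto simp: vec_norm2_def intro!: exI[of _ "0\<^sub>v 0"])
  then show ?thesis
    by (simp add: spec_norm_def)
next
  case (Suc n)
  have "vec_norm2 (unit_vec (dim_col A) 0) = 1"
    using Suc by (simp add: vec_norm2_def unit_vec_def if_distrib[of "\<lambda>x. (cmod x)\<^sup>2"] cong: if_cong)
  then show ?thesis
    using vec_norm2_mult_le[of "unit_vec (dim_col A) 0" A] by (simp add: order_trans[OF vec_norm2_nonneg])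
qed

lemma frob_norm_mult_le_spec_left:
  assumes "A \<in> carrier_mat m k" "B \<in> carrier_mat k n"
  shows "frob_norm (A * B) \<le> spec_norm A * frob_norm B"
proof (rule power2_le_imp_le)
  have "(frob_norm (A * B))\<^sup>2 = (\<Sum>j<n. (vec_norm2 (A *\<^sub>v col B j))\<^sup>2)"
    unfolding frob_norm_sq_cols using assms(2)
    by (intro sum.cong) (auto simp: col_mult2[OF assms] simp del: col_mult)
  also have "\<dots> \<le> (\<Sum>j<n. (spec_norm A * vec_norm2 (col B j))\<^sup>2)"
    using assms by (intro sum_mono power_mono vec_norm2_mult_le) auto
  also have "\<dots> = (spec_norm A * frob_norm B)\<^sup>2"
    using assms by (simp add: power_mult_distrib frob_norm_sq_cols flip: sum_distrib_left)
  finally show "(frob_norm (A * B))\<^sup>2 \<le> (spec_norm A * frob_norm B)\<^sup>2" .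
qed simp

text \<open>The supremum controls only a factor on the left. With G = B A one has |G|^2 = tr (G G^H)
  = tr (B (A G^H)) <= |B| |A G^H|, where A does stand on the left; after bounding |A G^H| one factor
  |G| cancels. This replaces a comparison of the spectral norms of A and its adjoint.\<close>

lemma frob_norm_mult_le_spec_right:
  assumes B: "B \<in> carrier_mat m k" and A: "A \<in> carrier_mat k n"
  shows "frob_norm (B * A) \<le> spec_norm A * frob_norm B"
proof -
  define G where "G = B * A"
  have G: "G \<in> carrier_mat m n"
    using A B by (simp add: G_def)
  note adj = mat_adjoint_carrier[OF A] mat_adjoint_carrier[OF B] mat_adjoint_carrier[OF G]
  have "complex_of_real ((frob_norm G)\<^sup>2) = mat_trace (mat_adjoint (mat_adjoint G) * mat_adjoint G)"
    using frob_norm_sq_trace[of "mat_adjoint G"] by (simp del: mat_adjoint_mat_adjoint)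
  also have "mat_adjoint (mat_adjoint G) * mat_adjoint G = mat_adjoint (mat_adjoint B) * (A * mat_adjoint G)"
    using A B adj by (simp add: G_def)
  finally have "(frob_norm G)\<^sup>2 = cmod (mat_trace (mat_adjoint (mat_adjoint B) * (A * mat_adjoint G)))"
    by (metis norm_of_real abs_of_nonneg zero_le_power2)
  also have "\<dots> \<le> frob_norm B * frob_norm (A * mat_adjoint G)"
    using frob_inner_Cauchy_Schwarz[of "mat_adjoint B" k m "A * mat_adjoint G"] A adj by simp
  also have "\<dots> \<le> frob_norm B * (spec_norm A * frob_norm G)"
    using frob_norm_mult_le_spec_left[OF A adj(3)] by (intro mult_left_mono) auto
  finally have "frob_norm G * frob_norm G \<le> (spec_norm A * frob_norm B) * frob_norm G"
    by (simp add: power2_eq_square mult_ac)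
  then show ?thesis
    using frob_norm_nonneg[of G] unfolding G_def[symmetric]
    by (cases "frob_norm G = 0") (auto simp: mult_le_cancel_right)
qed

section \<open>Canonical angles\<close>

lemma mat_trace_similar:
  fixes A :: "'a :: field mat"
  assumes A: "A \<in> carrier_mat n n" and wit: "similar_mat_wit A B P Q"
  shows "mat_trace A = mat_trace B"
proof -
  note w = similar_mat_witD2[OF A wit]
  have "mat_trace A = mat_trace (P * (B * Q))"
    using w by simp
  also have "\<dots> = mat_trace ((B * Q) * P)"
    using w by (intro mat_trace_mult_commute[of _ n n]) auto
  also have "(B * Q) * P = B"
    using w by simp
  finally show ?thesis .
qed

text \<open>Similarity preserves the trace, and the diagonal of the Schur form lists the
  eigenvalues.\<close>

lemma mat_trace_eq_sum_eigenvalues: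
  fixes A :: "complex mat"
  assumes A: "A \<in> carrier_mat n n" and es: "char_poly A = (\<Prod>e\<leftarrow>es. [:- e, 1:])"
  shows "mat_trace A = sum_list es"
proof -
  obtain B P Q where schur: "schur_decomposition A es = (B, P, Q)"
    by (cases "schur_decomposition A es")
  from schur_decomposition[OF A es schur]
  have wit: "similar_mat_wit A B P Q" and diag: "diag_mat B = es"
    by auto
  have "mat_trace B = sum_list (diag_mat B)"
    by (simp add: mat_trace_def diag_mat_def sum_list_sum_nth atLeast0LessThan)
  then show ?thesis
    using mat_trace_similar[OF A wit] diag by simp
qed

text \<open>Pythagoras for the projection P = U U^H Y: because U^H U = 1, the products Y^H P, P^H Y
  and P^H P all equal (U^H Y)^H (U^H Y), so the cross terms cancel.\<close>

lemma orthonormal_projection: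
  fixes U Y :: "complex mat"
  assumes U: "U \<in> carrier_mat n k" and UU: "mat_adjoint U * U = 1\<^sub>m k" and Y: "Y \<in> carrier_mat n l"
  shows "(frob_norm (Y - U * (mat_adjoint U * Y)))\<^sup>2 = (frob_norm Y)\<^sup>2 - (frob_norm (mat_adjoint U * Y))\<^sup>2"
proof -
  define P where "P = U * (mat_adjoint U * Y)"
  note adj = mat_adjoint_carrier[OF U] mat_adjoint_carrier[OF Y]
  have UY: "mat_adjoint U * Y \<in> carrier_mat k l"
    using U Y adj by simp
  have P: "P \<in> carrier_mat n l"
    using U UY by (simp add: P_def)
  have adjP: "mat_adjoint P = mat_adjoint (mat_adjoint U * Y) * mat_adjoint U"
    unfolding P_def by (rule mat_adjoint_mult[OF U UY])
  have adjUY: "mat_adjoint (mat_adjoint U * Y) = mat_adjoint Y * U"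
    using mat_adjoint_mult[OF adj(1) Y] by simp
  let ?q = "mat_adjoint (mat_adjoint U * Y) * (mat_adjoint U * Y)"
  have YP: "mat_adjoint Y * P = ?q"
    unfolding P_def adjUY by (rule assoc_mult_mat[OF adj(2) U UY, symmetric])
  have PY: "mat_adjoint P * Y = ?q"
    unfolding adjP by (rule assoc_mult_mat[OF mat_adjoint_carrier[OF UY] adj(1) Y])
  have PP: "mat_adjoint P * P = ?q"
  proof -
    have "mat_adjoint P * P = mat_adjoint (mat_adjoint U * Y) * (mat_adjoint U * (U * (mat_adjoint U * Y)))"
      unfolding adjP unfolding P_def
      by (rule assoc_mult_mat[OF mat_adjoint_carrier[OF UY] adj(1) mult_carrier_mat[OF U UY]])
    also have "mat_adjoint U * (U * (mat_adjoint U * Y)) = (mat_adjoint U * U) * (mat_adjoint U * Y)"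
      by (rule assoc_mult_mat[OF adj(1) U UY, symmetric])
    also have "\<dots> = mat_adjoint U * Y"
      unfolding UU by (rule left_mult_one_mat[OF UY])
    finally show ?thesis .
  qed
  have q: "?q \<in> carrier_mat l l"
    using UY mat_adjoint_carrier[OF UY] by simp
  have "mat_adjoint (Y - P) = mat_adjoint Y - mat_adjoint P"
    using Y P by (intro eq_matI) auto
  then have "mat_adjoint (Y - P) * (Y - P) = (mat_adjoint Y - mat_adjoint P) * (Y - P)"
    by simp
  also have "\<dots> = (mat_adjoint Y * Y - ?q) - (?q - ?q)"
    unfolding minus_mult_distrib_mat[OF adj(2) mat_adjoint_carrier[OF P] minus_carrier_mat[OF P]]
      mult_minus_distrib_mat[OF adj(2) Y P] mult_minus_distrib_mat[OF mat_adjoint_carrier[OF P] Y P]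
      YP PY PP ..
  also have "mat_trace \<dots> = mat_trace (mat_adjoint Y * Y) - mat_trace ?q"
    using q Y adj by (simp add: mat_trace_def sum_subtractf)
  finally have "complex_of_real ((frob_norm (Y - P))\<^sup>2) =
      complex_of_real ((frob_norm Y)\<^sup>2 - (frob_norm (mat_adjoint U * Y))\<^sup>2)"
    unfolding frob_norm_sq_trace of_real_diff .
  then show ?thesis
    unfolding of_real_eq_iff P_def .
qed

lemma orthonormal_residual_le:
  fixes U Y :: "complex mat"
  assumes "U \<in> carrier_mat n k" "mat_adjoint U * U = 1\<^sub>m k" "Y \<in> carrier_mat n l"
  shows "frob_norm (Y - U * (mat_adjoint U * Y)) \<le> frob_norm Y"
    and "frob_norm (mat_adjoint U * Y) \<le> frob_norm Y"
proof -
  have sq: "(frob_norm (Y - U * (mat_adjoint U * Y)))\<^sup>2 \<le> (frob_norm Y)\<^sup>2"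
    "(frob_norm (mat_adjoint U * Y))\<^sup>2 \<le> (frob_norm Y)\<^sup>2"
    using orthonormal_projection[OF assms] zero_le_power2[of "frob_norm (mat_adjoint U * Y)"]
      zero_le_power2[of "frob_norm (Y - U * (mat_adjoint U * Y))"]
    by linarith+
  show "frob_norm (Y - U * (mat_adjoint U * Y)) \<le> frob_norm Y"
    by (rule power2_le_imp_le[OF sq(1) frob_norm_nonneg])
  show "frob_norm (mat_adjoint U * Y) \<le> frob_norm Y"
    by (rule power2_le_imp_le[OF sq(2) frob_norm_nonneg])
qed

lemma frob_norm_orthonormal_mult:
  fixes V Y :: "complex mat"
  assumes V: "V \<in> carrier_mat n k" and VV: "mat_adjoint V * V = 1\<^sub>m k"
  shows "Y \<in> carrier_mat k l \<Longrightarrow> frob_norm (V * Y) = frob_norm Y"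
    and "Y \<in> carrier_mat l n \<Longrightarrow> frob_norm (Y * V) \<le> frob_norm Y"
proof -
  note adj = mat_adjoint_carrier[OF V]
  assume Y: "Y \<in> carrier_mat k l"
  have "mat_adjoint (V * Y) * (V * Y) = mat_adjoint Y * (mat_adjoint V * (V * Y))"
    unfolding mat_adjoint_mult[OF V Y]
    by (rule assoc_mult_mat[OF mat_adjoint_carrier[OF Y] adj mult_carrier_mat[OF V Y]])
  also have "mat_adjoint V * (V * Y) = Y"
    using assoc_mult_mat[OF adj V Y] VV Y by simp
  finally have "complex_of_real ((frob_norm (V * Y))\<^sup>2) = complex_of_real ((frob_norm Y)\<^sup>2)"
    by (simp only: frob_norm_sq_trace)
  then show "frob_norm (V * Y) = frob_norm Y"
    unfolding of_real_eq_iff by simp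
next
  assume Y: "Y \<in> carrier_mat l n"
  have "frob_norm (Y * V) = frob_norm (mat_adjoint V * mat_adjoint Y)"
    using frob_norm_adjoint[of "Y * V"] mat_adjoint_mult[OF Y V] by simp
  also have "\<dots> \<le> frob_norm Y"
    using orthonormal_residual_le(2)[OF V VV mat_adjoint_carrier[OF Y]] by simp
  finally show "frob_norm (Y * V) \<le> frob_norm Y" .
qed

text \<open>Each summand is 1 - s^2, and the squares s^2 are the eigenvalues of Q^H Q, whose sum is
  its trace |Q|^2. The identity for sin (arccos s) needs s in [-1, 1]; the contraction hypothesis
  provides this.\<close>

lemma singular_values_sum:
  fixes Q :: "complex mat"
  assumes Q: "Q \<in> carrier_mat m k"
    and contr: "\<And>Y l. Y \<in> carrier_mat k l \<Longrightarrow> frob_norm (Q * Y) \<le> frob_norm Y"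
  shows "(\<Sum>s\<leftarrow>singular_values Q. (sin (arccos s))\<^sup>2) = real k - (frob_norm Q)\<^sup>2"
proof -
  define A where "A = mat_adjoint Q * Q"
  note adj = mat_adjoint_carrier[OF Q]
  have A: "A \<in> carrier_mat k k"
    using Q adj by (simp add: A_def)
  obtain es where es: "char_poly A = (\<Prod>e\<leftarrow>es. [:- e, 1:])" "length es = k"
    using char_poly_factorized[OF A] by auto
  \<comment> \<open>Rayleigh quotient: for an eigenvector v, written as a matrix Y with one column,
    |Q Y|^2 = e |Y|^2, and the left side lies between 0 and |Y|^2.\<close>
  have ev: "0 \<le> Re e \<and> Re e \<le> 1" if e: "e \<in> set es" for e
  proof -
    have "poly (char_poly A) e = 0"
      unfolding es(1) using e by (auto simp: poly_prod_list prod_list_zero_iff)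
    then obtain v where v: "v \<in> carrier_vec k" "v \<noteq> 0\<^sub>v k" "A *\<^sub>v v = e \<cdot>\<^sub>v v"
      using eigenvalue_root_char_poly[OF A, of e] A by (auto simp: eigenvalue_def eigenvector_def)
    define Y where "Y = mat_of_cols k [v]"
    have Y: "Y \<in> carrier_mat k 1"
      using mat_of_cols_carrier(1)[of k "[v]"] by (simp add: Y_def)
    have fY: "frob_norm Y = vec_norm2 v"
      using v by (simp add: Y_def vec_norm2_eq_frob_norm)
    have pos: "0 < (frob_norm Y)\<^sup>2"
      using v vec_norm2_eq_0[of v] by (auto simp: fY)
    have AY: "A * Y = e \<cdot>\<^sub>m Y"
    proof (intro eq_matI)
      fix i j assume "i < dim_row (e \<cdot>\<^sub>m Y)" "j < dim_col (e \<cdot>\<^sub>m Y)"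
      then have ij: "i < k" "j = 0"
        using Y by auto
      have "(A * Y) $$ (i, j) = (A *\<^sub>v v) $ i"
        using ij A v(1) by (simp add: Y_def)
      also have "\<dots> = e * v $ i"
        unfolding v(3) using ij v(1) by simp
      also have "\<dots> = (e \<cdot>\<^sub>m Y) $$ (i, j)"
        using ij v(1) by (simp add: Y_def mat_of_cols_def)
      finally show "(A * Y) $$ (i, j) = (e \<cdot>\<^sub>m Y) $$ (i, j)" .
    qed (use A Y in auto)
    have "complex_of_real ((frob_norm (Q * Y))\<^sup>2) = mat_trace (mat_adjoint Y * (A * Y))"
      unfolding frob_norm_sq_trace mat_adjoint_mult[OF Q Y] A_def assoc_mult_mat[OF adj Q Y]
        assoc_mult_mat[OF mat_adjoint_carrier[OF Y] adj mult_carrier_mat[OF Q Y]] ..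
    also have "\<dots> = e * mat_trace (mat_adjoint Y * Y)"
      unfolding AY mult_smult_distrib[OF mat_adjoint_carrier[OF Y] Y]
      using Y by (simp add: mat_trace_def sum_distrib_left)
    also have "\<dots> = e * complex_of_real ((frob_norm Y)\<^sup>2)"
      by (simp only: frob_norm_sq_trace)
    finally have "Re (complex_of_real ((frob_norm (Q * Y))\<^sup>2)) = Re (e * complex_of_real ((frob_norm Y)\<^sup>2))"
      by simp
    then have eq: "(frob_norm (Q * Y))\<^sup>2 = Re e * (frob_norm Y)\<^sup>2"
      by (simp del: of_real_power)
    have "(frob_norm (Q * Y))\<^sup>2 \<le> (frob_norm Y)\<^sup>2"
      using contr[OF Y] by (intro power_mono) auto
    then have "Re e * (frob_norm Y)\<^sup>2 \<le> 1 * (frob_norm Y)\<^sup>2" "0 * (frob_norm Y)\<^sup>2 \<le> Re e * (frob_norm Y)\<^sup>2"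
      unfolding eq[symmetric] by (simp_all only: mult_1 mult_zero_left zero_le_power2)
    then show ?thesis
      unfolding mult_le_cancel_right_pos[OF pos] by simp
  qed
  have "proots (char_poly A) = mset es"
    unfolding es(1)
    by (induction es) (simp_all add: proots_mult prod_list_zero_iff image_iff del: mult_pCons_left)
  then have "mset (singular_values Q) = image_mset (\<lambda>z. sqrt (Re z)) (mset es)"
    by (simp add: singular_values_def A_def)
  then have "(\<Sum>s\<in>#mset (singular_values Q). (sin (arccos s))\<^sup>2) = (\<Sum>e\<in>#mset es. (sin (arccos (sqrt (Re e))))\<^sup>2)"
    by (simp only: multiset.map_comp comp_def)
  then have "(\<Sum>s\<leftarrow>singular_values Q. (sin (arccos s))\<^sup>2) = (\<Sum>e\<leftarrow>es. (sin (arccos (sqrt (Re e))))\<^sup>2)"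
    by (metis mset_map sum_mset_sum_list)
  also have "\<dots> = (\<Sum>e\<leftarrow>es. 1 - Re e)"
  proof (intro arg_cong[of _ _ sum_list] map_cong refl)
    fix e assume "e \<in> set es"
    then have e: "0 \<le> Re e" "Re e \<le> 1"
      using ev by auto
    then have "sqrt (Re e) \<le> 1" "-1 \<le> sqrt (Re e)"
      by (simp, use real_sqrt_ge_zero[OF e(1)] in linarith)
    then show "(sin (arccos (sqrt (Re e))))\<^sup>2 = 1 - Re e"
      using e by (simp add: sin_squared_eq)
  qed
  also have "\<dots> = real (length es) - Re (sum_list es)"
    by (induction es) auto
  also have "Re (sum_list es) = (frob_norm Q)\<^sup>2"
    unfolding mat_trace_eq_sum_eigenvalues[OF A es(1), symmetric] A_def frob_norm_sq_trace[symmetric]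
    by (rule Re_complex_of_real)
  also have "real (length es) = real k"
    by (simp add: es(2))
  finally show ?thesis .
qed

text \<open>The sum of the squared sines is k - |V^H U|^2, and k = |V|^2, so Pythagoras identifies
  it with the squared residual of V. The bases are the very ones that
  \<open>canonical_angles\<close> selects.\<close>

lemma frob_norm_sin_Theta:
  fixes S T :: "complex vec set"
  defines "U \<equiv> SOME U. orthonormal_basis_mat S U" and "V \<equiv> SOME V. orthonormal_basis_mat T V"
  assumes U: "U \<in> carrier_mat n k" and V: "V \<in> carrier_mat n k"
    and UU: "mat_adjoint U * U = 1\<^sub>m k" and VV: "mat_adjoint V * V = 1\<^sub>m k"
  shows "frob_norm (sin_Theta S T) = frob_norm (V - U * (mat_adjoint U * V))"
proof -
  define Q where "Q = mat_adjoint V * U"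
  note adj = mat_adjoint_carrier[OF U] mat_adjoint_carrier[OF V]
  have Q: "Q \<in> carrier_mat k k"
    using U adj by (simp add: Q_def)
  have "frob_norm (Q * Y) \<le> frob_norm Y" if Y: "Y \<in> carrier_mat k l" for Y l
  proof -
    have "frob_norm (Q * Y) = frob_norm (mat_adjoint V * (U * Y))"
      using U Y adj by (simp add: Q_def)
    also have "\<dots> \<le> frob_norm (U * Y)"
      using U Y by (intro orthonormal_residual_le(2)[OF V VV]) auto
    also have "\<dots> = frob_norm Y"
      by (rule frob_norm_orthonormal_mult(1)[OF U UU Y])
    finally show ?thesis .
  qed
  note sv = singular_values_sum[OF Q this]
  define \<theta> where "\<theta> = map arccos (singular_values Q)"
  have "sin_Theta S T = mat_diag (length \<theta>) (\<lambda>j. sin (\<theta> ! j))"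
    by (simp add: sin_Theta_def canonical_angles_def \<theta>_def Q_def U_def V_def Let_def)
  then have "(frob_norm (sin_Theta S T))\<^sup>2 = (\<Sum>j<length \<theta>. (sin (\<theta> ! j))\<^sup>2)"
    unfolding frob_norm_sq
    by (simp add: mat_diag_def if_distrib[of "\<lambda>x. x\<^sup>2"] if_distrib[of abs] cong: if_cong)
  also have "\<dots> = (\<Sum>t\<leftarrow>\<theta>. (sin t)\<^sup>2)"
    by (simp add: sum_list_sum_nth atLeast0LessThan)
  also have "\<dots> = real k - (frob_norm Q)\<^sup>2"
    using sv by (simp add: \<theta>_def comp_def)
  also have "frob_norm Q = frob_norm (mat_adjoint U * V)"
    using frob_norm_adjoint[of Q] mat_adjoint_mult[OF adj(2) U] by (simp add: Q_def)
  also have "real k = (frob_norm V)\<^sup>2"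
  proof -
    have "mat_trace (1\<^sub>m k :: complex mat) = of_nat k"
      by (simp add: mat_trace_def)
    then have "complex_of_real ((frob_norm V)\<^sup>2) = complex_of_real (real k)"
      unfolding frob_norm_sq_trace VV by simp
    then show ?thesis
      unfolding of_real_eq_iff by simp
  qed
  also have "\<dots> - (frob_norm (mat_adjoint U * V))\<^sup>2 = (frob_norm (V - U * (mat_adjoint U * V)))\<^sup>2"
    by (rule orthonormal_projection[OF U UU V, symmetric])
  finally show ?thesis
    by simp
qed

section \<open>Orthonormal bases of column spaces\<close>

lemma col_span_eq:
  assumes "X \<in> carrier_mat n k"
  shows "col_span X = {X *\<^sub>v x | x. x \<in> carrier_vec k}"
proof -
  interpret vec_space "TYPE(complex)" n .
  show ?thesis
    using assms col_space_eq[OF assms] unfolding col_span_def by auto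
qed

lemma col_span_subset_iff:
  assumes X: "X \<in> carrier_mat n k" and Y: "Y \<in> carrier_mat n l"
  shows "col_span X \<subseteq> col_span Y \<longleftrightarrow> (\<exists>R \<in> carrier_mat l k. X = Y * R)"
proof
  assume sub: "col_span X \<subseteq> col_span Y"
  have "\<exists>x. x \<in> carrier_vec l \<and> col X j = Y *\<^sub>v x" if "j < k" for j
  proof -
    have "col X j = X *\<^sub>v unit_vec k j"
      using X that by (intro eq_vecI) auto
    then have "col X j \<in> col_span X"
      unfolding col_span_eq[OF X] using that by auto
    then show ?thesis
      using sub unfolding col_span_eq[OF Y] by auto
  qed
  then obtain r where r: "\<And>j. j < k \<Longrightarrow> r j \<in> carrier_vec l" "\<And>j. j < k \<Longrightarrow> col X j = Y *\<^sub>v r j"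
    by metis
  define R where "R = mat_of_cols l (map r [0..<k])"
  have R: "R \<in> carrier_mat l k"
    using mat_of_cols_carrier(1)[of l "map r [0..<k]"] by (simp add: R_def)
  have "col R j = r j" if "j < k" for j
    using r(1)[OF that] that by (simp add: R_def)
  then have "X = Y * R"
    using X Y R r(2) by (intro mat_col_eqI) auto
  then show "\<exists>R \<in> carrier_mat l k. X = Y * R"
    using R by auto
next
  assume "\<exists>R \<in> carrier_mat l k. X = Y * R"
  then obtain R where R: "R \<in> carrier_mat l k" "X = Y * R"
    by auto
  show "col_span X \<subseteq> col_span Y"
  proof
    fix v assume "v \<in> col_span X"
    then obtain x where x: "x \<in> carrier_vec k" "v = X *\<^sub>v x"
      unfolding col_span_eq[OF X] by auto
    then have "v = Y *\<^sub>v (R *\<^sub>v x)"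
      using R Y by (simp add: assoc_mult_mat_vec)
    then show "v \<in> col_span Y"
      unfolding col_span_eq[OF Y] using R x by auto
  qed
qed

text \<open>Gives meaning to the \<open>SOME\<close> in \<open>canonical_angles\<close>.
  \<open>gram_schmidt\<close> returns orthogonal columns that are not normalised, hence the diagonal
  rescaling \<open>D\<close>; its inverse \<open>D'\<close> shows that the span is
  unchanged.\<close>

lemma orthonormal_basis_mat_exists:
  assumes X: "X \<in> carrier_mat n k" and dist: "distinct (cols X)"
    and indpt: "\<not> module.lin_dep class_ring (module_vec TYPE(complex) n) (set (cols X))"
  shows "\<exists>U. orthonormal_basis_mat (col_span X) U"
proof -
  interpret cof_vec_space n "TYPE(complex)" .
  define us where "us = gram_schmidt n (cols X)"
  have cX: "set (cols X) \<subseteq> carrier_vec n"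
    using X cols_dim[of X] by simp
  note gs = gram_schmidt_result[OF cX dist indpt us_def]
  have len: "length us = k"
    using gs(4) X by simp
  have us: "us ! j \<in> carrier_vec n" if "j < k" for j
    using gs(3) len that by auto
  define W where "W = mat_of_cols n us"
  have W: "W \<in> carrier_mat n k"
    using mat_of_cols_carrier(1)[of n us] len by (simp add: W_def)
  have spanW: "col_span W = col_span X"
    using gs(1,3) X W by (simp add: col_span_def col_space_def W_def)
  define s where "s j = vec_norm2 (us ! j)" for j
  have s: "us ! j \<bullet>c us ! j = complex_of_real ((s j)\<^sup>2)" if "j < k" for j
    using us[OF that]
    by (auto simp: scalar_prod_def s_def vec_norm2_def sum_nonneg complex_norm_square lessThan_atLeast0
        simp del: of_real_power intro!: sum.cong)
  have s0: "s j \<noteq> 0" if "j < k" for j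
    using corthogonalD[OF gs(2), of j j] s[OF that] that len by auto
  define D where "D = mat_diag k (\<lambda>j. complex_of_real (1 / s j))"
  define D' where "D' = mat_diag k (\<lambda>j. complex_of_real (s j))"
  have D: "D \<in> carrier_mat k k" and D': "D' \<in> carrier_mat k k"
    by (simp_all add: D_def D'_def)
  have DD': "D * D' = 1\<^sub>m k"
    unfolding D_def D'_def mat_diag_diag by (intro eq_matI) (auto simp: mat_diag_def s0)
  define U where "U = W * D"
  have U: "U \<in> carrier_mat n k"
    using W D by (simp add: U_def)
  have "U * D' = W"
    unfolding U_def assoc_mult_mat[OF W D D'] DD' by (rule right_mult_one_mat[OF W])
  then have "col_span U = col_span W"
    using col_span_subset_iff[OF U W] col_span_subset_iff[OF W U] D D' U_def by blast
  moreover have "mat_adjoint U * U = 1\<^sub>m k"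
  proof (intro eq_matI)
    fix i j assume "i < dim_row (1\<^sub>m k :: complex mat)" "j < dim_col (1\<^sub>m k :: complex mat)"
    then have ij: "i < k" "j < k"
      by auto
    have ent: "U $$ (l, j) = us ! j $ l / complex_of_real (s j)" if "l < n" "j < k" for l j
      using that W us[OF that(2)] len unfolding U_def D_def
      by (simp add: mat_diag_mult_right[of _ n] W_def mat_of_cols_def)
    have "(mat_adjoint U * U) $$ (i, j) = (\<Sum>l<n. cnj (us ! i $ l) * us ! j $ l / complex_of_real (s i * s j))"
      unfolding index_mult_mat_sum[OF mat_adjoint_carrier[OF U] U ij]
      using U ij by (intro sum.cong refl) (simp add: ent)
    also have "\<dots> = (us ! j \<bullet>c us ! i) / complex_of_real (s i * s j)"
      using us[OF ij(1)] us[OF ij(2)] by (simp add: scalar_prod_def sum_divide_distrib lessThan_atLeast0 mult.commute)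
    also have "\<dots> = 1\<^sub>m k $$ (i, j)"
      using ij s[OF ij(1)] s0[OF ij(1)] corthogonalD[OF gs(2), of j i] len
      by (cases "i = j") (auto simp: power2_eq_square)
    finally show "(mat_adjoint U * U) $$ (i, j) = 1\<^sub>m k $$ (i, j)" .
  qed (use U in auto)
  ultimately show ?thesis
    unfolding orthonormal_basis_mat_def spanW using U by auto
qed

text \<open>\<open>orthonormal_basis_mat\<close> leaves the shape of U open. As the spans agree, X =
  U R and U = X S, and the left inverses of U and X make R and S mutually inverse; then R S and S R
  have the same trace, so U has k columns.\<close>

lemma orthonormal_basis_mat_carrier:
  assumes X: "X \<in> carrier_mat n k" and L: "L \<in> carrier_mat k n" and LX: "L * X = 1\<^sub>m k"
    and U: "orthonormal_basis_mat (col_span X) U"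
  shows "U \<in> carrier_mat n k"
proof -
  define l where "l = dim_col U"
  have U': "U \<in> carrier_mat (dim_row U) l"
    by (simp add: l_def)
  have span: "col_span U = col_span X" and UU: "mat_adjoint U * U = 1\<^sub>m l"
    using U by (simp_all add: orthonormal_basis_mat_def l_def)
  \<comment> \<open>The zero vector of the common span already reveals the number of rows of
    U.\<close>
  have "U *\<^sub>v 0\<^sub>v l \<in> col_span X"
    unfolding span[symmetric] col_span_eq[OF U'] by auto
  then obtain x where "U *\<^sub>v 0\<^sub>v l = X *\<^sub>v x"
    unfolding col_span_eq[OF X] by auto
  then have dim: "dim_row U = n"
    using X by (metis carrier_matD(1) dim_mult_mat_vec)
  have U: "U \<in> carrier_mat n l"
    by (rule U'[unfolded dim])
  have sub: "col_span X \<subseteq> col_span U" "col_span U \<subseteq> col_span X"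
    by (simp_all only: span order_refl)
  obtain R where R: "R \<in> carrier_mat l k" "X = U * R"
    using iffD1[OF col_span_subset_iff[OF X U] sub(1)] by (elim bexE)
  obtain S where S: "S \<in> carrier_mat k l" "U = X * S"
    using iffD1[OF col_span_subset_iff[OF U X] sub(2)] by (elim bexE)
  note adj = mat_adjoint_carrier[OF U]
  have "mat_adjoint U * X = R"
    unfolding R(2) assoc_mult_mat[OF adj U R(1), symmetric] UU by (rule left_mult_one_mat[OF R(1)])
  then have "R * S = mat_adjoint U * X * S"
    by simp
  also have "\<dots> = 1\<^sub>m l"
    unfolding assoc_mult_mat[OF adj X S(1)] S(2)[symmetric] by (rule UU)
  finally have RS: "R * S = 1\<^sub>m l" .
  have "L * U = S"
    unfolding S(2) assoc_mult_mat[OF L X S(1), symmetric] LX by (rule left_mult_one_mat[OF S(1)])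
  then have "S * R = L * U * R"
    by simp
  also have "\<dots> = 1\<^sub>m k"
    unfolding assoc_mult_mat[OF L U R(1)] R(2)[symmetric] by (rule LX)
  finally have SR: "S * R = 1\<^sub>m k" .
  have "(of_nat l :: complex) = of_nat k"
    using mat_trace_mult_commute[OF R(1) S(1)] unfolding RS SR by (simp add: mat_trace_def)
  then show ?thesis
    using U by simp
qed

section \<open>Splitting a nonsingular matrix into two column blocks\<close>

lemma hcat_carrier:
  assumes "X1 \<in> carrier_mat n k1" "X2 \<in> carrier_mat n k2"
  shows "hcat X1 X2 \<in> carrier_mat n (k1 + k2)"
  using assms mat_of_cols_carrier(1)[of n "cols X1 @ cols X2"] by (simp add: hcat_def)

lemma submat_hcat:
  assumes "X1 \<in> carrier_mat n k1" "X2 \<in> carrier_mat n k2"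
  shows "submat 0 0 n k1 (hcat X1 X2) = X1" "submat 0 k1 n k2 (hcat X1 X2) = X2"
  using assms by (auto intro!: eq_matI simp: submat_def hcat_def mat_of_cols_def nth_append)

lemma hcat_mult:
  assumes X1: "X1 \<in> carrier_mat n k1" and X2: "X2 \<in> carrier_mat n k2" and G: "G \<in> carrier_mat (k1 + k2) l"
  shows "hcat X1 X2 * G = X1 * submat 0 0 k1 l G + X2 * submat k1 0 k2 l G"
proof (intro eq_matI)
  fix i j
  assume "i < dim_row (X1 * submat 0 0 k1 l G + X2 * submat k1 0 k2 l G)"
    "j < dim_col (X1 * submat 0 0 k1 l G + X2 * submat k1 0 k2 l G)"
  then have ij: "i < n" "j < l"
    using X2 by (auto simp: submat_def)
  have "X1 $$ (i, a) = hcat X1 X2 $$ (i, a)" if "a < k1" for a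
    by (subst (1) submat_hcat(1)[OF X1 X2, symmetric]) (use that ij in \<open>simp add: submat_def\<close>)
  moreover have "X2 $$ (i, a) = hcat X1 X2 $$ (i, a + k1)" if "a < k2" for a
    by (subst (1) submat_hcat(2)[OF X1 X2, symmetric]) (use that ij in \<open>simp add: submat_def\<close>)
  ultimately have "(hcat X1 X2 * G) $$ (i, j) =
      (X1 * submat 0 0 k1 l G) $$ (i, j) + (X2 * submat k1 0 k2 l G) $$ (i, j)"
    unfolding index_mult_mat_sum[OF hcat_carrier[OF X1 X2] G ij] index_mult_mat_sum[OF X1 submat_carrier ij]
      index_mult_mat_sum[OF X2 submat_carrier ij] sum_lessThan_add
    using ij by (simp add: submat_def)
  then show "(hcat X1 X2 * G) $$ (i, j) = (X1 * submat 0 0 k1 l G + X2 * submat k1 0 k2 l G) $$ (i, j)"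
    using ij X1 X2 by (simp add: carrier_matD[OF submat_carrier] del: index_mult_mat(1))
qed (use X1 X2 G hcat_carrier[OF X1 X2] in \<open>auto simp: submat_def\<close>)

lemma submat_mult:
  assumes Y: "Y \<in> carrier_mat k d" and X: "X \<in> carrier_mat d l" and "r + m \<le> k" "c + n \<le> l"
  shows "submat r c m n (Y * X) = submat r 0 m d Y * submat 0 c d n X"
proof -
  have "submat r c m n (Y * X) = submat r 0 m n (submat 0 c k n (Y * X))"
    using assms by (intro eq_matI) (auto simp: submat_def)
  also have "\<dots> = submat r 0 m d Y * submat 0 c d n X"
    unfolding submat_mult_col_window[OF Y X assms(4)]
    by (rule submat_mult_row_window[OF Y submat_carrier assms(3)])
  finally show ?thesis .
qed

lemma submat_one:
  assumes "m \<le> k"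
  shows "submat 0 0 m m (1\<^sub>m k) = 1\<^sub>m m"
  using assms by (intro eq_matI) (auto simp: submat_def)

text \<open>The nonzero determinant of the whole matrix makes the columns of X1 distinct and
  independent, so that the selected U really is an orthonormal basis. A left inverse of X1 is formed
  by the top rows of Y.\<close>

lemma hcat_orthonormal_basis:
  assumes X1: "X1 \<in> carrier_mat N k1" and X2: "X2 \<in> carrier_mat N k2" and N: "N = k1 + k2"
    and Y: "Y \<in> carrier_mat N N" and YX: "Y * hcat X1 X2 = 1\<^sub>m N"
  defines "U \<equiv> SOME U. orthonormal_basis_mat (col_span X1) U"
  shows "submat 0 0 k1 N Y * X1 = 1\<^sub>m k1" and "U \<in> carrier_mat N k1"
    and "mat_adjoint U * U = 1\<^sub>m k1" and "col_span U = col_span X1"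
proof -
  interpret vec_space "TYPE(complex)" N .
  have X: "hcat X1 X2 \<in> carrier_mat N N"
    using hcat_carrier[OF X1 X2] N by simp
  have "det Y * det (hcat X1 X2) = 1"
    using det_mult[OF Y X] YX by simp
  then have det: "det (hcat X1 X2) \<noteq> 0"
    by auto
  have cols: "cols (hcat X1 X2) = cols X1 @ cols X2"
    unfolding hcat_def using X1 X2 cols_dim[of X1] cols_dim[of X2] by (intro cols_mat_of_cols) auto
  have "distinct (cols (hcat X1 X2))"
  proof (rule ccontr)
    assume "\<not> distinct (cols (hcat X1 X2))"
    then obtain i j where ij: "i < N" "j < N" "i \<noteq> j" "cols (hcat X1 X2) ! i = cols (hcat X1 X2) ! j"
      using X by (auto simp: distinct_conv_nth)
    then show False
      using det_identical_columns[OF X ij(3,1,2)] det X by simp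
  qed
  then have dist: "distinct (cols X1)"
    unfolding cols by simp
  have "\<not> lin_dep (set (cols (hcat X1 X2)))"
    using lin_dep_cols_imp_det_0[OF X] det by blast
  then have indpt: "\<not> lin_dep (set (cols X1))"
    by (rule subset_li_is_li) (simp add: cols)
  have U: "orthonormal_basis_mat (col_span X1) U"
    unfolding U_def by (rule someI_ex[OF orthonormal_basis_mat_exists[OF X1 dist indpt]])
  show LX: "submat 0 0 k1 N Y * X1 = 1\<^sub>m k1"
  proof -
    have "submat 0 0 k1 N Y * X1 = submat 0 0 k1 k1 (Y * hcat X1 X2)"
      using submat_mult[OF Y X, of 0 k1 0 k1] N submat_hcat(1)[OF X1 X2] by simp
    then show ?thesis
      unfolding YX using N by (simp add: submat_one)
  qed
  show "U \<in> carrier_mat N k1"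
    by (rule orthonormal_basis_mat_carrier[OF X1 submat_carrier LX U])
  then show "mat_adjoint U * U = 1\<^sub>m k1" "col_span U = col_span X1"
    using U by (simp_all add: orthonormal_basis_mat_def)
qed

text \<open>X2 B is the whole matrix applied to B padded with zero rows on top. In this way
  \<open>kappa2\<close> of the full matrix suffices, and no norm of a single column block
  enters.\<close>

lemma frob_norm_mult_hcat_right_le:
  assumes X1: "X1 \<in> carrier_mat n k1" and X2: "X2 \<in> carrier_mat n k2" and B: "B \<in> carrier_mat k2 l"
  shows "frob_norm (X2 * B) \<le> spec_norm (hcat X1 X2) * frob_norm B"
proof -
  define H where "H = mat (k1 + k2) l (\<lambda>(i, j). if i < k1 then 0 else B $$ (i - k1, j))"
  have H: "H \<in> carrier_mat (k1 + k2) l"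
    by (simp add: H_def)
  have sub: "submat 0 0 k1 l H = 0\<^sub>m k1 l" "submat k1 0 k2 l H = B"
    using B by (auto intro!: eq_matI simp: submat_def H_def)
  have "hcat X1 X2 * H = X2 * B"
    unfolding hcat_mult[OF X1 X2 H] sub using X1 X2 B by simp
  moreover have "frob_norm H = frob_norm B"
    unfolding frob_norm_split_rows[OF H] sub by (simp add: frob_norm_def[of "0\<^sub>m _ _"])
  ultimately show ?thesis
    using frob_norm_mult_le_spec_left[OF hcat_carrier[OF X1 X2] H] by simp
qed

text \<open>The same device on the other side: Z is padded with zero columns.\<close>

lemma frob_norm_mult_top_rows_le:
  assumes Y: "Y \<in> carrier_mat (k1 + k2) l" and Z: "Z \<in> carrier_mat m k1"
  shows "frob_norm (Z * submat 0 0 k1 l Y) \<le> spec_norm Y * frob_norm Z"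
proof -
  define H where "H = mat m (k1 + k2) (\<lambda>(i, j). if j < k1 then Z $$ (i, j) else 0)"
  have H: "H \<in> carrier_mat m (k1 + k2)"
    by (simp add: H_def)
  have sub: "submat 0 0 m k1 H = Z" "submat 0 k1 m k2 H = 0\<^sub>m m k2"
    using Z by (auto intro!: eq_matI simp: submat_def H_def)
  have "H * Y = Z * submat 0 0 k1 l Y"
  proof (intro eq_matI)
    fix i j assume "i < dim_row (Z * submat 0 0 k1 l Y)" "j < dim_col (Z * submat 0 0 k1 l Y)"
    then have ij: "i < m" "j < l"
      using Z by (auto simp: submat_def)
    show "(H * Y) $$ (i, j) = (Z * submat 0 0 k1 l Y) $$ (i, j)"
      unfolding index_mult_mat_sum[OF H Y ij] index_mult_mat_sum[OF Z submat_carrier ij] sum_lessThan_add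
      using ij by (simp add: H_def submat_def)
  qed (use H Y Z in \<open>auto simp: submat_def\<close>)
  moreover have "frob_norm H = frob_norm Z"
    unfolding frob_norm_split_cols[OF H] sub by (simp add: frob_norm_def[of "0\<^sub>m _ _"])
  ultimately show ?thesis
    using frob_norm_mult_le_spec_right[OF H Y] by simp
qed

text \<open>Expanding V in the columns of the first matrix gives V = X1 G1 + X2 G2 with G = Y V. The
  first part lies in the span of U, so I - U U^H annihilates it and only X2 G2 remains to be
  bounded.\<close>

lemma frob_norm_sin_Theta_le:
  assumes X1: "X1 \<in> carrier_mat N k1" and X2: "X2 \<in> carrier_mat N k2"
    and X1': "X1' \<in> carrier_mat N k1" and X2': "X2' \<in> carrier_mat N k2" and N: "N = k1 + k2"
    and Y: "Y \<in> carrier_mat N N" and YX: "Y * hcat X1 X2 = 1\<^sub>m N" and XY: "hcat X1 X2 * Y = 1\<^sub>m N"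
    and Y': "Y' \<in> carrier_mat N N" and YX': "Y' * hcat X1' X2' = 1\<^sub>m N"
  shows "frob_norm (sin_Theta (col_span X1) (col_span X1')) \<le>
    spec_norm (hcat X1 X2) * spec_norm Y' * frob_norm (submat k1 0 k2 k1 (Y * hcat X1' X2'))"
proof -
  define U where "U = (SOME U. orthonormal_basis_mat (col_span X1) U)"
  define V where "V = (SOME V. orthonormal_basis_mat (col_span X1') V)"
  note bU = hcat_orthonormal_basis[OF X1 X2 N Y YX, folded U_def]
  note bV = hcat_orthonormal_basis[OF X1' X2' N Y' YX', folded V_def]
  note U = bU(2) and V = bV(2)
  have X: "hcat X1 X2 \<in> carrier_mat N N" and X': "hcat X1' X2' \<in> carrier_mat N N"
    using hcat_carrier[OF X1 X2] hcat_carrier[OF X1' X2'] N by simp_all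
  obtain R where R: "R \<in> carrier_mat k1 k1" "X1 = U * R"
    using col_span_subset_iff[OF X1 U] bU(4) by auto
  obtain R' where R': "R' \<in> carrier_mat k1 k1" "V = X1' * R'"
    using col_span_subset_iff[OF V X1'] bV(4) by auto
  define G where "G = Y * V"
  have G: "G \<in> carrier_mat N k1"
    using Y V by (simp add: G_def)
  define G1 G2 B where "G1 = submat 0 0 k1 k1 G" and "G2 = submat k1 0 k2 k1 G" and "B = X2 * G2"
  have B: "B \<in> carrier_mat N k1"
    using X2 by (simp add: B_def G2_def)
  note adj = mat_adjoint_carrier[OF U]
  have C: "R * G1 \<in> carrier_mat k1 k1"
    using R by (simp add: G1_def)
  have "hcat X1 X2 * G = V"
    unfolding G_def assoc_mult_mat[OF X Y V, symmetric] XY by (rule left_mult_one_mat[OF V])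
  moreover have "hcat X1 X2 * G = X1 * G1 + B"
    unfolding B_def G1_def G2_def by (rule hcat_mult[OF X1 X2]) (use G N in simp)
  moreover have "X1 * G1 = U * (R * G1)"
    unfolding R(2) G1_def by (rule assoc_mult_mat[OF U R(1) submat_carrier])
  ultimately have V_eq: "V = U * (R * G1) + B"
    by simp
  have UC: "U * (R * G1) \<in> carrier_mat N k1"
    using U C by simp
  have "mat_adjoint U * V = R * G1 + mat_adjoint U * B"
    unfolding V_eq mult_add_distrib_mat[OF adj UC B] assoc_mult_mat[OF adj U C, symmetric] bU(3)
      left_mult_one_mat[OF C] ..
  then have UV: "U * (mat_adjoint U * V) = U * (R * G1) + U * (mat_adjoint U * B)"
    using mult_add_distrib_mat[OF U C mult_carrier_mat[OF adj B]] by simp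
  have cancel: "(P + B) - (P + Q) = B - Q" if "P \<in> carrier_mat N k1" "Q \<in> carrier_mat N k1" for P Q
    using that B by (intro eq_matI) auto
  have "V - U * (mat_adjoint U * V) = B - U * (mat_adjoint U * B)"
    using cancel[OF UC mult_carrier_mat[OF U mult_carrier_mat[OF adj B]]]
    unfolding UV[symmetric] V_eq[symmetric] .
  then have "frob_norm (sin_Theta (col_span X1) (col_span X1')) = frob_norm (B - U * (mat_adjoint U * B))"
    using frob_norm_sin_Theta[of "col_span X1" N k1 "col_span X1'"] bU bV
    unfolding U_def[symmetric] V_def[symmetric] by simp
  also have "\<dots> \<le> frob_norm B"
    by (rule orthonormal_residual_le(1)[OF U bU(3) B])
  also have "\<dots> \<le> spec_norm (hcat X1 X2) * frob_norm G2"
    unfolding B_def G2_def by (rule frob_norm_mult_hcat_right_le[OF X1 X2 submat_carrier])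
  also have "frob_norm G2 \<le> spec_norm Y' * frob_norm (submat k1 0 k2 k1 (Y * hcat X1' X2'))"
  proof -
    define Z where "Z = submat k1 0 k2 k1 (Y * hcat X1' X2')"
    define L' where "L' = submat 0 0 k1 N Y'"
    have Z: "Z \<in> carrier_mat k2 k1" and L': "L' \<in> carrier_mat k1 N"
      by (simp_all add: Z_def L'_def)
    have Z_eq: "Z = submat k1 0 k2 N Y * X1'"
      using submat_mult[OF Y X', of k1 k2 0 k1] submat_hcat(1)[OF X1' X2'] N by (simp add: Z_def)
    \<comment> \<open>Since V = X1' R', the left inverse L' of X1' recovers R' = L' V. This replaces
      the unknown change of basis R' by rows of Y' and an orthonormal V, both of which have
      controlled norms.\<close>
    have "L' * V = R'"
      unfolding R'(2) assoc_mult_mat[OF L' X1' R'(1), symmetric] bV(1)[folded L'_def]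
      by (rule left_mult_one_mat[OF R'(1)])
    moreover have "G2 = submat k1 0 k2 N Y * V"
      unfolding G2_def G_def by (rule submat_mult_row_window[OF Y V]) (use N in simp)
    then have "G2 = Z * R'"
      unfolding R'(2) Z_eq by (simp add: assoc_mult_mat[OF submat_carrier X1' R'(1)])
    ultimately have "G2 = Z * L' * V"
      using assoc_mult_mat[OF Z L' V] by simp
    then have "frob_norm G2 \<le> frob_norm (Z * L')"
      using frob_norm_orthonormal_mult(2)[OF V bV(3) mult_carrier_mat[OF Z L']] by simp
    also have "\<dots> \<le> spec_norm Y' * frob_norm Z"
      unfolding L'_def by (rule frob_norm_mult_top_rows_le[OF _ Z, of _ k2]) (use Y' N in simp)
    finally show ?thesis
      unfolding Z_def .
  qed
  finally show ?thesis
    by (simp add: mult.assoc mult_left_mono)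
qed

section \<open>Canonical blocks\<close>

lemma det_zero_row:
  fixes A :: "'a :: comm_ring_1 mat"
  assumes "A \<in> carrier_mat n n" "i < n" "\<And>j. j < n \<Longrightarrow> A $$ (i, j) = 0"
  shows "det A = 0"
  using laplace_expansion_row[OF assms(1,2)] assms(3) by simp

lemma det_diag_block_mat:
  fixes As :: "'a :: idom mat list"
  assumes "\<And>A. A \<in> set As \<Longrightarrow> square_mat A"
  shows "det (diag_block_mat As) = prod_list (map det As)"
  using assms
proof (induction As)
  case (Cons A As)
  have "square_mat (diag_block_mat As)"
    using Cons.prems by (intro diag_block_mat_square) simp
  then have "det (diag_block_mat (A # As)) = det A * det (diag_block_mat As)"
    unfolding diag_block_mat.simps Let_def using Cons.prems[of A]
    by (intro det_four_block_mat_upper_right_zero) auto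
  then show ?case
    using Cons by simp
qed simp

lemma diag_block_mat_map_mult:
  fixes f g :: "'b \<Rightarrow> 'a :: comm_semiring_1 mat"
  assumes "\<And>x. x \<in> set xs \<Longrightarrow> f x \<in> carrier_mat (s x) (s x) \<and> g x \<in> carrier_mat (s x) (s x)"
  shows "diag_block_mat (map f xs) * diag_block_mat (map g xs) = diag_block_mat (map (\<lambda>x. f x * g x) xs)"
  using assms
proof (induction xs)
  case (Cons x xs)
  define n where "n = sum_list (map s xs)"
  have fg: "f x \<in> carrier_mat (s x) (s x)" "g x \<in> carrier_mat (s x) (s x)"
    using Cons.prems by auto
  have dims: "map dim_row (map h xs) = map s xs" "map dim_col (map h xs) = map s xs"
    if "\<And>y. y \<in> set xs \<Longrightarrow> h y \<in> carrier_mat (s y) (s y)" for h :: "'b \<Rightarrow> 'a mat"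
    using that by auto
  have D: "diag_block_mat (map h xs) \<in> carrier_mat n n"
    if "\<And>y. y \<in> set xs \<Longrightarrow> h y \<in> carrier_mat (s y) (s y)" for h :: "'b \<Rightarrow> 'a mat"
    using dims[OF that] by (intro carrier_matI) (simp_all only: dim_diag_block_mat n_def)
  have DD: "diag_block_mat (map f xs) \<in> carrier_mat n n" "diag_block_mat (map g xs) \<in> carrier_mat n n"
    "diag_block_mat (map (\<lambda>x. f x * g x) xs) \<in> carrier_mat n n"
    using Cons.prems by (auto intro!: D mult_carrier_mat)
  have IH: "diag_block_mat (map f xs) * diag_block_mat (map g xs) = diag_block_mat (map (\<lambda>x. f x * g x) xs)"
    using Cons by simp
  show ?case
    using fg DD
    by (simp add: Let_def mult_four_block_mat[where ?nr1.0 = "s x" and ?n1.0 = "s x" and ?nc1.0 = "s x"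
          and ?nr2.0 = n and ?n2.0 = n and ?nc2.0 = n] IH)
qed simp

lemma diag_block_mat_map_minus_smult:
  fixes f g :: "'b \<Rightarrow> 'a :: comm_ring_1 mat"
  assumes "\<And>x. x \<in> set xs \<Longrightarrow> f x \<in> carrier_mat (s x) (s x) \<and> g x \<in> carrier_mat (s x) (s x)"
  shows "diag_block_mat (map f xs) - z \<cdot>\<^sub>m diag_block_mat (map g xs) =
    diag_block_mat (map (\<lambda>x. f x - z \<cdot>\<^sub>m g x) xs)"
  using assms
proof (induction xs)
  case (Cons x xs)
  have fg: "f x \<in> carrier_mat (s x) (s x)" "g x \<in> carrier_mat (s x) (s x)"
    using Cons.prems by auto
  have dims: "map (dim_row \<circ> f) xs = map s xs" "map (dim_col \<circ> f) xs = map s xs"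
    "map (dim_row \<circ> g) xs = map s xs" "map (dim_col \<circ> g) xs = map s xs"
    using Cons.prems by auto
  have IH: "diag_block_mat (map f xs) - z \<cdot>\<^sub>m diag_block_mat (map g xs) =
    diag_block_mat (map (\<lambda>x. f x - z \<cdot>\<^sub>m g x) xs)"
    using Cons by simp
  have D: "diag_block_mat (map f xs) \<in> carrier_mat (sum_list (map s xs)) (sum_list (map s xs))"
    "diag_block_mat (map g xs) \<in> carrier_mat (sum_list (map s xs)) (sum_list (map s xs))"
    by (intro carrier_matI; simp add: dim_diag_block_mat dims)+
  show ?case
    using fg D by (intro eq_matI) (auto simp: Let_def simp flip: IH)
qed (auto intro!: eq_matI)

lemma one_smult_mat [simp]: "(1 :: 'a :: monoid_mult) \<cdot>\<^sub>m A = A"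
  by (intro eq_matI) auto

lemma smult_smult_mat: "a \<cdot>\<^sub>m (b \<cdot>\<^sub>m A) = (a * b :: 'a :: semigroup_mult) \<cdot>\<^sub>m A"
  by (intro eq_matI) (auto simp: mult.assoc)

section \<open>The four block types and their chains\<close>

lemma F_mat_carrier [simp]: "F_mat m \<in> carrier_mat m m"
  by (simp add: F_mat_def)

lemma G_mat_carrier [simp]: "G_mat m \<in> carrier_mat m m"
  by (simp add: G_mat_def)

lemma index_F_mat_mult:
  assumes "Y \<in> carrier_mat m n" "i < m" "j < n"
  shows "((c \<cdot>\<^sub>m F_mat m) * Y) $$ (i, j) = c * Y $$ (m - 1 - i, j)"
proof -
  have "((c \<cdot>\<^sub>m F_mat m) * Y) $$ (i, j) = (\<Sum>l<m. if l = m - 1 - i then c * Y $$ (l, j) else 0)"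
    unfolding index_mult_mat_sum[OF smult_carrier_mat[OF F_mat_carrier] assms]
    using assms by (intro sum.cong refl) (auto simp: F_mat_def)
  then show ?thesis
    using assms by simp
qed

lemma F_mat_mult_self: "F_mat m * F_mat m = 1\<^sub>m m"
proof (intro eq_matI)
  fix i j assume "i < dim_row (1\<^sub>m m :: complex mat)" "j < dim_col (1\<^sub>m m :: complex mat)"
  then have ij: "i < m" "j < m"
    by auto
  have "(F_mat m * F_mat m) $$ (i, j) = F_mat m $$ (m - 1 - i, j)"
    using index_F_mat_mult[OF F_mat_carrier ij, of 1] by simp
  then show "(F_mat m * F_mat m) $$ (i, j) = 1\<^sub>m m $$ (i, j)"
    using ij by (auto simp: F_mat_def)
qed (auto simp: F_mat_def)

lemma block_pair_carrier:
  "fst (block_pair b) \<in> carrier_mat (block_size b) (block_size b)"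
  "snd (block_pair b) \<in> carrier_mat (block_size b) (block_size b)"
  by (cases b; auto simp: F_mat_def G_mat_def)+

text \<open>Holds for the types whose eigenvalue is neither 0 nor \<open>Infty\<close>; R2 is
  excluded although 0 is a finite number.\<close>

fun is_finite_block :: "canon_block \<Rightarrow> bool" where
  "is_finite_block (R1 \<delta> k) = False"
| "is_finite_block (R2 \<eta> l) = False"
| "is_finite_block (R3 \<eta> \<alpha> l) = True"
| "is_finite_block (R4 \<beta> m) = True"

text \<open>Multiplication by \<open>F_mat\<close> from the left reverses the rows and so turns the
  antidiagonal shape of R4 into a diagonal one. The lower left corner of the block moves up, which
  is why the chain of the conjugate comes first.\<close>

fun block_chains :: "canon_block \<Rightarrow> complex mat list" where
  "block_chains (R3 \<eta> \<alpha> l) = [chain_block (of_real \<alpha>) l]"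
| "block_chains (R4 \<beta> m) = [chain_block (cnj \<beta>) m, chain_block \<beta> m]"
| "block_chains _ = []"

text \<open>
  For R4 the product splits into two chains of half the size, while \<open>block_size\<close> is the full size; this is
  why the single-block bound is stated for sizes \<open>m \<le> N\<close>, \<open>m' \<le> N'\<close>.
\<close>
lemma block_pair_product:
  assumes "valid_block b" "is_finite_block b"
  shows "snd (block_pair b) * snd (block_pair b) = 1\<^sub>m (block_size b)"
    and "snd (block_pair b) * fst (block_pair b) = diag_block_mat (block_chains b)"
proof -
  show "snd (block_pair b) * snd (block_pair b) = 1\<^sub>m (block_size b)"
  proof (cases b)
    case (R3 \<eta> \<alpha> l)
    then have \<eta>: "complex_of_real \<eta> * complex_of_real \<eta> = 1"
      using assms by auto
    show ?thesis
      using R3 \<eta> F_mat_mult_self[of l]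
      by (simp add: mult_smult_assoc_mat[of _ l l _ l] mult_smult_distrib[of _ l l _ l] smult_smult_mat)
  next
    case (R4 \<beta> m)
    then show ?thesis
      by (simp add: F_mat_mult_self)
  qed (use assms in auto)
  show "snd (block_pair b) * fst (block_pair b) = diag_block_mat (block_chains b)"
  proof (cases b)
    case (R3 \<eta> \<alpha> l)
    define Y where "Y = of_real \<eta> \<cdot>\<^sub>m (of_real \<alpha> \<cdot>\<^sub>m F_mat l + of_real \<bar>\<alpha>\<bar> \<cdot>\<^sub>m G_mat l)"
    have Y: "Y \<in> carrier_mat l l"
      by (simp add: Y_def)
    have "(of_real \<eta> \<cdot>\<^sub>m F_mat l) * Y = chain_block (of_real \<alpha>) l"
    proof (intro eq_matI)
      fix i j assume "i < dim_row (chain_block (of_real \<alpha>) l)" "j < dim_col (chain_block (of_real \<alpha>) l)"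
      then have ij: "i < l" "j < l"
        by (auto simp: chain_block_def)
      show "((of_real \<eta> \<cdot>\<^sub>m F_mat l) * Y) $$ (i, j) = chain_block (of_real \<alpha>) l $$ (i, j)"
        unfolding index_F_mat_mult[OF Y ij]
        using ij R3 assms by (auto simp: Y_def chain_block_def F_mat_def G_mat_def)
    qed (use Y in \<open>auto simp: chain_block_def F_mat_def\<close>)
    then show ?thesis
      using R3 by (simp add: Y_def del: diag_block_mat.simps)
  next
    case (R4 \<beta> m)
    define Y where "Y = four_block_mat
        (0\<^sub>m m m) (\<beta> \<cdot>\<^sub>m F_mat m + of_real (cmod \<beta>) \<cdot>\<^sub>m G_mat m)
        (cnj \<beta> \<cdot>\<^sub>m F_mat m + of_real (cmod \<beta>) \<cdot>\<^sub>m G_mat m) (0\<^sub>m m m)"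
    have Y: "Y \<in> carrier_mat (2 * m) (2 * m)"
      unfolding Y_def mult_2 by (intro four_block_carrier_mat) auto
    define D where "D = four_block_mat (chain_block (cnj \<beta>) m) (0\<^sub>m m m) (0\<^sub>m m m) (chain_block \<beta> m)"
    have chains: "diag_block_mat (block_chains b) = D"
      unfolding R4 D_def block_chains.simps diag_block_mat.simps(2)[of _ "[_]"] diag_block_mat_singleton Let_def
        carrier_matD[OF chain_block_carrier] ..
    have FY: "F_mat (2 * m) * Y = D"
    proof (intro eq_matI)
      fix i j assume "i < dim_row D" "j < dim_col D"
      then have ij: "i < 2 * m" "j < 2 * m"
        by (auto simp: D_def chain_block_def)
      have "(F_mat (2 * m) * Y) $$ (i, j) = Y $$ (2 * m - 1 - i, j)"
        using index_F_mat_mult[OF Y ij, of 1] by simp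
      also have "\<dots> = D $$ (i, j)"
      \<comment> \<open>Reversing the rows exchanges the halves: a row i < m of the product is a row
        of the lower half of \<open>Y\<close>, where \<open>cnj \<beta>\<close> stands. In the two
        mixed quadrants both sides are zero.\<close>
      proof (cases "i < m"; cases "j < m")
        assume *: "i < m" "j < m"
        then obtain p where p: "2 * m - 1 - i = m + p" "p < m" "m = i + p + 1"
          by (intro that[of "m - 1 - i"]) auto
        have cond: "p + j + 1 = m \<longleftrightarrow> i = j" "p + j + 2 = m \<longleftrightarrow> i = Suc j"
          using p(3) by linarith+
        have "Y $$ (m + p, j) = (cnj \<beta> \<cdot>\<^sub>m F_mat m + of_real (cmod \<beta>) \<cdot>\<^sub>m G_mat m) $$ (p, j)"
          using * p(2) by (simp add: Y_def F_mat_def G_mat_def)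
        also have "\<dots> = (if i = j then cnj \<beta> else if i = Suc j then of_real (cmod \<beta>) else 0)"
          using * p(2) unfolding cond[symmetric] by (simp add: F_mat_def G_mat_def)
        finally show ?thesis
          using * unfolding p(1) by (simp add: D_def chain_block_def)
      next
        assume *: "\<not> i < m" "\<not> j < m"
        then obtain p where p: "2 * m - 1 - i = p" "p < m" "2 * m = i + p + 1"
          using ij by (intro that[of "2 * m - 1 - i"]) auto
        obtain q where q: "j = m + q" "q < m"
          using * ij by (intro that[of "j - m"]) auto
        have cond: "p + q + 1 = m \<longleftrightarrow> i = j" "p + q + 2 = m \<longleftrightarrow> i = Suc j"
          using p(3) q(1) by linarith+
        have "Y $$ (p, j) = (\<beta> \<cdot>\<^sub>m F_mat m + of_real (cmod \<beta>) \<cdot>\<^sub>m G_mat m) $$ (p, q)"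
          using p(2) q by (simp add: Y_def F_mat_def G_mat_def)
        also have "\<dots> = (if i = j then \<beta> else if i = Suc j then of_real (cmod \<beta>) else 0)"
          using p(2) q(2) unfolding cond[symmetric] by (simp add: F_mat_def G_mat_def)
        also have "\<dots> = D $$ (i, j)"
          using * ij q by (auto simp: D_def chain_block_def)
        finally show ?thesis
          unfolding p(1) .
      qed (use ij in \<open>auto simp: Y_def D_def chain_block_def F_mat_def G_mat_def\<close>)
      finally show "(F_mat (2 * m) * Y) $$ (i, j) = D $$ (i, j)" .
    qed (use Y in \<open>auto simp: D_def chain_block_def F_mat_def\<close>)
    show ?thesis
      using FY unfolding chains by (simp add: R4 Y_def)
  qed (use assms in auto)
qed

text \<open>The last row of \<open>G_mat\<close> is zero, so R1 has a singular second component and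
  R2 a singular first one.\<close>

lemma finite_block_if_nonsingular:
  assumes "valid_block b" "det (fst (block_pair b)) \<noteq> 0" "det (snd (block_pair b)) \<noteq> 0"
  shows "is_finite_block b"
proof (cases b)
  case (R1 \<delta> k)
  then have "det (snd (block_pair b)) = 0"
    using assms(1) by (intro det_zero_row[of _ k "k - 1"]) (auto simp: G_mat_def)
  then show ?thesis
    using assms by simp
next
  case (R2 \<eta> l)
  then have "det (fst (block_pair b)) = 0"
    using assms(1) by (intro det_zero_row[of _ l "l - 1"]) (auto simp: G_mat_def)
  then show ?thesis
    using assms by simp
qed auto

lemma finite_block_eigenvalue:
  assumes "valid_block b" "is_finite_block b"
  obtains l where "block_eigenvalue b = Fin l" "l \<noteq> 0"
    "\<And>z. z \<in> {l, cnj l} \<Longrightarrow> det (fst (block_pair b) - z \<cdot>\<^sub>m snd (block_pair b)) = 0"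
    "\<And>C. C \<in> set (block_chains b) \<Longrightarrow>
       \<exists>\<mu> m. C = chain_block \<mu> m \<and> \<mu> \<in> {l, cnj l} \<and> 1 \<le> m \<and> m \<le> block_size b"
    "1 \<le> block_size b"
proof (cases b)
  case (R3 \<eta> \<alpha> k)
  show ?thesis
  proof (rule that)
    show "det (fst (block_pair b) - z \<cdot>\<^sub>m snd (block_pair b)) = 0"
      if "z \<in> {complex_of_real \<alpha>, cnj (complex_of_real \<alpha>)}" for z
      using R3 assms(1) that by (intro det_zero_row[of _ k "k - 1"]) (auto simp: F_mat_def G_mat_def)
  qed (use R3 assms in auto)
next
  case (R4 \<beta> m)
  show ?thesis
  proof (rule that)
    show "det (fst (block_pair b) - z \<cdot>\<^sub>m snd (block_pair b)) = 0" if "z \<in> {\<beta>, cnj \<beta>}" for z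
    proof -
      have "det (fst (block_pair b) - \<beta> \<cdot>\<^sub>m snd (block_pair b)) = 0"
        using R4 assms(1)
        \<comment> \<open>Row m - 1 of the pencil has the single entry \<beta> - z, because the last
          row of \<open>G_mat\<close> vanishes; row 2m - 1 has the single entry cnj \<beta> - z in
          the same way.\<close>
        by (intro det_zero_row[of _ "2 * m" "m - 1"]) (auto simp: F_mat_def G_mat_def)
      moreover have "det (fst (block_pair b) - cnj \<beta> \<cdot>\<^sub>m snd (block_pair b)) = 0"
        using R4 assms(1)
        by (intro det_zero_row[of _ "2 * m" "2 * m - 1"]) (auto simp: F_mat_def G_mat_def)
      ultimately show ?thesis
        using that by auto
    qed
    show "\<beta> \<noteq> 0"
      using R4 assms by auto
    show "\<exists>\<mu> k. C = chain_block \<mu> k \<and> \<mu> \<in> {\<beta>, cnj \<beta>} \<and> 1 \<le> k \<and> k \<le> block_size b"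
      if "C \<in> set (block_chains b)" for C
    proof -
      have "C = chain_block \<beta> m \<or> C = chain_block (cnj \<beta>) m"
        using that R4 by auto
      then show ?thesis
        using R4 assms(1) by (elim disjE) (intro exI[of _ m] exI[of _ \<beta>] exI[of _ "cnj \<beta>"]; force)+
    qed
  qed (use R4 assms in auto)
qed (use assms in auto)

text \<open>The block \<open>b\<close> acts on the columns and \<open>b'\<close> on the rows of the
  unknown, in accordance with the argument order of \<open>phi1\<close> and \<open>phi2\<close>.
  Every pair of chains obeys the bound with the same two constants, so the direct sums do as
  well.\<close>

lemma finite_blocks_sylvester_bounded:
  assumes b: "valid_block b" "is_finite_block b" and b': "valid_block b'" "is_finite_block b'"
    and disj: "\<And>z. det (fst (block_pair b) - z \<cdot>\<^sub>m snd (block_pair b)) = 0 \<Longrightarrow>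
      det (fst (block_pair b') - z \<cdot>\<^sub>m snd (block_pair b')) = 0 \<Longrightarrow> False"
  defines "\<phi> f \<equiv> f (block_eigenvalue b) (block_eigenvalue b') (block_size b) (block_size b')"
  shows "sylvester_bounded (\<phi> phi1) (\<phi> phi2) (diag_block_mat (block_chains b')) (diag_block_mat (block_chains b))"
    and "0 \<le> \<phi> phi1" "0 \<le> \<phi> phi2"
proof -
  obtain l where l: "block_eigenvalue b = Fin l" "l \<noteq> 0"
    "\<And>z. z \<in> {l, cnj l} \<Longrightarrow> det (fst (block_pair b) - z \<cdot>\<^sub>m snd (block_pair b)) = 0"
    "\<And>C. C \<in> set (block_chains b) \<Longrightarrow>
       \<exists>\<mu> m. C = chain_block \<mu> m \<and> \<mu> \<in> {l, cnj l} \<and> 1 \<le> m \<and> m \<le> block_size b"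
    "1 \<le> block_size b"
    using finite_block_eigenvalue[OF b] by metis
  obtain l' where l': "block_eigenvalue b' = Fin l'" "l' \<noteq> 0"
    "\<And>z. z \<in> {l', cnj l'} \<Longrightarrow> det (fst (block_pair b') - z \<cdot>\<^sub>m snd (block_pair b')) = 0"
    "\<And>C. C \<in> set (block_chains b') \<Longrightarrow>
       \<exists>\<mu> m. C = chain_block \<mu> m \<and> \<mu> \<in> {l', cnj l'} \<and> 1 \<le> m \<and> m \<le> block_size b'"
    "1 \<le> block_size b'"
    using finite_block_eigenvalue[OF b'] by metis
  define g g' N N' where "g = rel_gap l l'" and "g' = rel_gap' l l'" and "N = block_size b" and "N' = block_size b'"
  \<comment> \<open>Each block has its recorded eigenvalue and the conjugate as eigenvalues, so
    disjointness also excludes cnj l' = l; both distances in the gaps are then positive.\<close>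
  have ne: "l' \<noteq> l" "cnj l' \<noteq> l"
    using l(3)[of l] l'(3)[of l'] l'(3)[of "cnj l'"] disj by auto
  have pos: "0 < g" "0 < g'"
    using ne l(2) l'(2) by (auto simp: g_def g'_def rel_gap_def rel_gap'_def)
  have phi: "\<phi> phi1 = real ((N' + N - 1) choose N) * phi_minus g N * phi_plus g' N'"
    "\<phi> phi2 = real ((N' + N - 1) choose N') * phi_minus g' N' * phi_plus g N"
    using l(1,2) l'(1,2) by (simp_all add: \<phi>_def g_def g'_def N_def N'_def)
  show nn: "0 \<le> \<phi> phi1" "0 \<le> \<phi> phi2"
    unfolding phi using pos l(5) l'(5)
    by (auto simp: N_def N'_def intro!: mult_nonneg_nonneg phi_minus_nonneg phi_plus_nonneg)
  have sq: "square_mat C" if "C \<in> set (block_chains b)" for C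
    using l(4)[OF that] by (auto simp: chain_block_def)
  have sq': "square_mat C" if "C \<in> set (block_chains b')" for C
    using l'(4)[OF that] by (auto simp: chain_block_def)
  have bd: "sylvester_bounded (\<phi> phi1) (\<phi> phi2) C' C"
    if C: "C \<in> set (block_chains b)" and C': "C' \<in> set (block_chains b')" for C C'
  proof -
    obtain \<mu> m where \<mu>: "C = chain_block \<mu> m" "\<mu> \<in> {l, cnj l}" "1 \<le> m" "m \<le> N"
      using l(4)[OF C] by (auto simp: N_def)
    obtain \<mu>' m' where \<mu>': "C' = chain_block \<mu>' m'" "\<mu>' \<in> {l', cnj l'}" "1 \<le> m'" "m' \<le> N'"
      using l'(4)[OF C'] by (auto simp: N'_def)
    \<comment> \<open>Four pairings of conjugates occur, but conjugation leaves only two distances,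
      exactly those over which the gaps take the minimum.\<close>
    have "cmod (cnj l' - cnj l) = cmod (l' - l)" "cmod (l' - cnj l) = cmod (cnj l' - l)"
      by (metis complex_cnj_diff complex_mod_cnj complex_cnj_cnj)+
    then have "cmod \<mu> = cmod l" "cmod \<mu>' = cmod l'" "cmod (\<mu>' - \<mu>) \<in> {cmod (l' - l), cmod (cnj l' - l)}"
      using \<mu>(2) \<mu>'(2) by auto
    then have gap: "g \<le> cmod ((\<mu>' - \<mu>) / \<mu>)" "g' \<le> cmod ((\<mu>' - \<mu>) / \<mu>')"
      by (auto simp: g_def g'_def rel_gap_def rel_gap'_def norm_divide)
    have \<mu>0: "\<mu> \<noteq> 0" "\<mu>' \<noteq> 0"
      using \<mu>(2) \<mu>'(2) l(2) l'(2) by auto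
    show ?thesis
      unfolding \<mu>(1) \<mu>'(1) phi
      by (rule sylvester_boundedI[OF chain_block_carrier chain_block_carrier],
          rule chain_block_sylvester_bound[OF _ _ _ _ \<mu>0 pos(1) gap(1) pos(2) gap(2) \<mu>(3,4) \<mu>'(3,4)])
  qed
  have "square_mat (diag_block_mat (block_chains b))"
    by (rule diag_block_mat_square) (use sq in blast)
  moreover have "sylvester_bounded (\<phi> phi1) (\<phi> phi2) C' (diag_block_mat (block_chains b))"
    if "C' \<in> set (block_chains b')" for C'
    by (rule sylvester_bounded_diag_right[OF nn sq'[OF that]]) (use sq bd that in blast)
  ultimately show "sylvester_bounded (\<phi> phi1) (\<phi> phi2) (diag_block_mat (block_chains b')) (diag_block_mat (block_chains b))"
    by (intro sylvester_bounded_diag_left[OF nn]) (use sq' in blast)+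
qed

lemma sylvester_bounded_mono:
  assumes "sylvester_bounded c1 c2 T S" "c1 \<le> d1" "c2 \<le> d2"
  shows "sylvester_bounded d1 d2 T S"
  unfolding sylvester_bounded_def
proof (intro allI impI)
  fix Z E F
  assume "Z \<in> carrier_mat (dim_row T) (dim_row S)" "E \<in> carrier_mat (dim_row T) (dim_row S)"
    "F \<in> carrier_mat (dim_row T) (dim_row S)" "T * (Z + E) = (Z + F) * S"
  then have "frob_norm Z \<le> c1 * frob_norm E + c2 * frob_norm F"
    using assms(1) unfolding sylvester_bounded_def by blast
  also have "\<dots> \<le> d1 * frob_norm E + d2 * frob_norm F"
    using assms(2,3) by (intro add_mono mult_right_mono frob_norm_nonneg)
  finally show "frob_norm Z \<le> d1 * frob_norm E + d2 * frob_norm F" .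
qed

section \<open>From single blocks to whole pencils\<close>

lemma phi_max_ge:
  assumes "b \<in> set bs" "b' \<in> set bs'"
  shows "\<phi> (block_eigenvalue b) (block_eigenvalue b') (block_size b) (block_size b') \<le> phi_max \<phi> bs bs'"
proof -
  let ?h = "\<lambda>(j, j'). \<phi> (block_eigenvalue (bs ! j)) (block_eigenvalue (bs' ! j'))
    (block_size (bs ! j)) (block_size (bs' ! j'))"
  have "{\<phi> (block_eigenvalue (bs ! j)) (block_eigenvalue (bs' ! j'))
      (block_size (bs ! j)) (block_size (bs' ! j')) | j j'. j < length bs \<and> j' < length bs'} =
    ?h ` ({..<length bs} \<times> {..<length bs'})"
    by auto
  moreover have "\<phi> (block_eigenvalue b) (block_eigenvalue b') (block_size b) (block_size b')
      \<in> ?h ` ({..<length bs} \<times> {..<length bs'})"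
    using assms by (auto simp: in_set_conv_nth image_iff)
  ultimately show ?thesis
    unfolding phi_max_def by (simp add: Max_ge)
qed

text \<open>The determinant of a direct sum is the product over its blocks. Hence nonsingularity
  passes to every block, leaving only R3 and R4, and an eigenvalue of one block is an eigenvalue of
  the sum.\<close>

lemma nonsingular_pencil_blocks:
  assumes eq: "(\<Lambda>, \<Omega>) = pair_sum (map block_pair bs)" and valid: "\<forall>b \<in> set bs. valid_block b"
    and det: "det \<Lambda> \<noteq> 0" "det \<Omega> \<noteq> 0"
  shows "b \<in> set bs \<Longrightarrow> is_finite_block b"
    and "b \<in> set bs \<Longrightarrow> det (fst (block_pair b) - z \<cdot>\<^sub>m snd (block_pair b)) = 0 \<Longrightarrow>
      Fin z \<in> pair_eigenvalues (\<Lambda>, \<Omega>)"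
    and "\<Lambda> \<in> carrier_mat k k \<Longrightarrow> \<Omega> * \<Omega> = 1\<^sub>m k"
    and "\<Omega> * \<Lambda> = diag_block_mat (map (\<lambda>b. diag_block_mat (block_chains b)) bs)"
proof -
  let ?f = "\<lambda>b. fst (block_pair b)" and ?s = "\<lambda>b. snd (block_pair b)"
  have \<Lambda>: "\<Lambda> = diag_block_mat (map ?f bs)" and \<Omega>: "\<Omega> = diag_block_mat (map ?s bs)"
    using eq by (simp_all add: pair_sum_def comp_def)
  have sq: "square_mat (?f b)" "square_mat (?s b)" "square_mat (?f b - z \<cdot>\<^sub>m ?s b)" for b z
    using block_pair_carrier[of b] by auto
  have "prod_list (map det (map ?f bs)) \<noteq> 0" "prod_list (map det (map ?s bs)) \<noteq> 0"
    using det sq unfolding \<Lambda> \<Omega> by (subst (asm) (1 2) det_diag_block_mat; force)+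
  then have "det (?f b) \<noteq> 0 \<and> det (?s b) \<noteq> 0" if "b \<in> set bs" for b
    using that by (auto simp: prod_list_zero_iff)
  then show fin: "is_finite_block b" if "b \<in> set bs" for b
    using that valid finite_block_if_nonsingular by blast
  have "\<Lambda> - z \<cdot>\<^sub>m \<Omega> = diag_block_mat (map (\<lambda>b. ?f b - z \<cdot>\<^sub>m ?s b) bs)"
    unfolding \<Lambda> \<Omega> by (rule diag_block_mat_map_minus_smult[where s = block_size]) (simp add: block_pair_carrier)
  moreover have "det (diag_block_mat (map (\<lambda>b. ?f b - z \<cdot>\<^sub>m ?s b) bs)) = 0"
    if "b \<in> set bs" "det (?f b - z \<cdot>\<^sub>m ?s b) = 0"
    by (subst det_diag_block_mat) (use sq that in \<open>auto simp: prod_list_zero_iff image_iff\<close>)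
  ultimately show "Fin z \<in> pair_eigenvalues (\<Lambda>, \<Omega>)" if "b \<in> set bs" "det (?f b - z \<cdot>\<^sub>m ?s b) = 0"
    using that by (simp add: pair_eigenvalues_def)
  show "\<Omega> * \<Lambda> = diag_block_mat (map (\<lambda>b. diag_block_mat (block_chains b)) bs)"
    unfolding \<Lambda> \<Omega>
    by (subst diag_block_mat_map_mult[where s = block_size])
      (use block_pair_product(2) valid fin in \<open>auto simp: block_pair_carrier intro!: arg_cong[of _ _ diag_block_mat]\<close>)
  have size: "map (\<lambda>b. ?s b * ?s b) bs = map (\<lambda>A. 1\<^sub>m (dim_row A)) (map ?f bs)"
  proof -
    have "?s b * ?s b = 1\<^sub>m (dim_row (?f b))" if "b \<in> set bs" for b
      using block_pair_product(1)[of b] valid fin that carrier_matD(1)[OF block_pair_carrier(1)[of b]] by simp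
    then show ?thesis
      by simp
  qed
  have "\<Omega> * \<Omega> = diag_block_mat (map (\<lambda>b. ?s b * ?s b) bs)"
    unfolding \<Omega> by (rule diag_block_mat_map_mult[where s = block_size]) (simp add: block_pair_carrier)
  also have "\<dots> = 1\<^sub>m (dim_row \<Lambda>)"
    unfolding size diag_block_one_mat \<Lambda> dim_diag_block_mat ..
  finally show "\<Omega> * \<Omega> = 1\<^sub>m k" if "\<Lambda> \<in> carrier_mat k k"
    using that by simp
qed

text \<open>The unprimed pair acts on the columns and the primed pair on the rows. In the
  application the unprimed pair is the perturbed \<open>(\<Lambda>1', \<Omega>1')\<close> and the
  primed one the unperturbed \<open>(\<Lambda>2, \<Omega>2)\<close>.\<close>

lemma pencil_sylvester_bound:
  assumes eq: "(\<Lambda>, \<Omega>) = pair_sum (map block_pair bs)" "\<forall>b \<in> set bs. valid_block b"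
    and eq': "(\<Lambda>', \<Omega>') = pair_sum (map block_pair bs')" "\<forall>b \<in> set bs'. valid_block b"
    and det: "det \<Lambda> \<noteq> 0" "det \<Omega> \<noteq> 0" "det \<Lambda>' \<noteq> 0" "det \<Omega>' \<noteq> 0"
    and disj: "pair_eigenvalues (\<Lambda>, \<Omega>) \<inter> pair_eigenvalues (\<Lambda>', \<Omega>') = {}"
    and carr: "\<Lambda> \<in> carrier_mat k k" "\<Omega> \<in> carrier_mat k k" "\<Lambda>' \<in> carrier_mat k' k'" "\<Omega>' \<in> carrier_mat k' k'"
    and k: "1 \<le> k" "1 \<le> k'"
  shows "0 \<le> phi_max phi1 bs bs'" and "0 \<le> phi_max phi2 bs bs'"
    and "Z \<in> carrier_mat k' k \<Longrightarrow> E \<in> carrier_mat k' k \<Longrightarrow> F \<in> carrier_mat k' k \<Longrightarrow> W \<in> carrier_mat k' k \<Longrightarrow>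
      \<Lambda>' * (Z + E) = W * \<Lambda> \<Longrightarrow> \<Omega>' * (Z + F) = W * \<Omega> \<Longrightarrow>
      frob_norm Z \<le> phi_max phi1 bs bs' * frob_norm E + phi_max phi2 bs bs' * frob_norm F"
proof -
  note blk = nonsingular_pencil_blocks[OF eq det(1,2)]
  note blk' = nonsingular_pencil_blocks[OF eq' det(3,4)]
  have bd: "sylvester_bounded (phi_max phi1 bs bs') (phi_max phi2 bs bs')
        (diag_block_mat (block_chains b')) (diag_block_mat (block_chains b))"
      "0 \<le> phi_max phi1 bs bs'" "0 \<le> phi_max phi2 bs bs'"
    if b: "b \<in> set bs" "b' \<in> set bs'" for b b'
  proof -
    have "False" if "det (fst (block_pair b) - z \<cdot>\<^sub>m snd (block_pair b)) = 0"
      "det (fst (block_pair b') - z \<cdot>\<^sub>m snd (block_pair b')) = 0" for z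
      using blk(2)[OF b(1) that(1)] blk'(2)[OF b(2) that(2)] disj by auto
    then have *: "sylvester_bounded
        (phi1 (block_eigenvalue b) (block_eigenvalue b') (block_size b) (block_size b'))
        (phi2 (block_eigenvalue b) (block_eigenvalue b') (block_size b) (block_size b'))
        (diag_block_mat (block_chains b')) (diag_block_mat (block_chains b))"
      "0 \<le> phi1 (block_eigenvalue b) (block_eigenvalue b') (block_size b) (block_size b')"
      "0 \<le> phi2 (block_eigenvalue b) (block_eigenvalue b') (block_size b) (block_size b')"
      using finite_blocks_sylvester_bounded[of b b'] blk(1)[OF b(1)] blk'(1)[OF b(2)] eq(2) eq'(2) b
      by blast+
    show "sylvester_bounded (phi_max phi1 bs bs') (phi_max phi2 bs bs')
        (diag_block_mat (block_chains b')) (diag_block_mat (block_chains b))"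
      by (rule sylvester_bounded_mono[OF *(1) phi_max_ge[OF b, of phi1] phi_max_ge[OF b, of phi2]])
    show "0 \<le> phi_max phi1 bs bs'" "0 \<le> phi_max phi2 bs bs'"
      using *(2,3) phi_max_ge[OF b, of phi1] phi_max_ge[OF b, of phi2] by linarith+
  qed
  \<comment> \<open>Positive sizes force both lists to be nonempty, so \<open>phi_max\<close> is the
    maximum of a nonempty set and inherits its sign from one pair of blocks.\<close>
  have "bs \<noteq> []" "bs' \<noteq> []"
    using eq(1) eq'(1) carr k by (auto simp: pair_sum_def)
  then obtain b0 b0' where b0: "b0 \<in> set bs" "b0' \<in> set bs'"
    by (meson list.set_sel(1))
  show nn: "0 \<le> phi_max phi1 bs bs'" "0 \<le> phi_max phi2 bs bs'"
    using bd(2,3)[OF b0] by auto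
  have sq: "square_mat (diag_block_mat (block_chains b))" for b
    by (rule diag_block_mat_square) (cases b; auto simp: chain_block_def)
  have "square_mat (diag_block_mat (map (\<lambda>b. diag_block_mat (block_chains b)) bs))"
    by (rule diag_block_mat_square) (use sq in auto)
  moreover have "sylvester_bounded (phi_max phi1 bs bs') (phi_max phi2 bs bs') (diag_block_mat (block_chains b'))
      (diag_block_mat (map (\<lambda>b. diag_block_mat (block_chains b)) bs))" if "b' \<in> set bs'" for b'
    by (rule sylvester_bounded_diag_right[OF nn sq]) (use sq bd(1) that in auto)
  ultimately have main: "sylvester_bounded (phi_max phi1 bs bs') (phi_max phi2 bs bs') (\<Omega>' * \<Lambda>') (\<Omega> * \<Lambda>)"
    unfolding blk(4) blk'(4) by (intro sylvester_bounded_diag_left[OF nn]) (use sq in auto)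
  assume ZEFW: "Z \<in> carrier_mat k' k" "E \<in> carrier_mat k' k" "F \<in> carrier_mat k' k" "W \<in> carrier_mat k' k"
    and eqs: "\<Lambda>' * (Z + E) = W * \<Lambda>" "\<Omega>' * (Z + F) = W * \<Omega>"
  have ZE: "Z + E \<in> carrier_mat k' k" and ZF: "Z + F \<in> carrier_mat k' k"
    using ZEFW by auto
  \<comment> \<open>Because \<Omega>' is an involution, the second equation gives Z + F = \<Omega>'
    W \<Omega>. Multiplying by \<Omega> \<Lambda> on the right, the two factors \<Omega> cancel and
    W \<Lambda> becomes the right-hand side of the first equation.\<close>
  have "Z + F = \<Omega>' * \<Omega>' * (Z + F)"
    unfolding blk'(3)[OF carr(3)] using left_mult_one_mat[OF ZF] ..
  also have "\<dots> = \<Omega>' * (W * \<Omega>)"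
    unfolding assoc_mult_mat[OF carr(4,4) ZF] eqs(2) ..
  finally have "(Z + F) * (\<Omega> * \<Lambda>) = \<Omega>' * (W * \<Omega>) * (\<Omega> * \<Lambda>)"
    by simp
  also have "\<dots> = \<Omega>' * (W * (\<Omega> * \<Omega>) * \<Lambda>)"
    using carr ZEFW(4)
    by (simp add: assoc_mult_mat[OF carr(4) mult_carrier_mat[OF ZEFW(4) carr(2)] mult_carrier_mat[OF carr(2,1)]]
        assoc_mult_mat[OF ZEFW(4) carr(2) mult_carrier_mat[OF carr(2,1)]]
        assoc_mult_mat[OF carr(2,2,1)] assoc_mult_mat[OF ZEFW(4) mult_carrier_mat[OF carr(2,2)] carr(1)])
  also have "\<dots> = \<Omega>' * (\<Lambda>' * (Z + E))"
    unfolding blk(3)[OF carr(1)] right_mult_one_mat[OF ZEFW(4)] eqs(1) ..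
  also have "\<dots> = \<Omega>' * \<Lambda>' * (Z + E)"
    by (rule assoc_mult_mat[OF carr(4,3) ZE, symmetric])
  finally show "frob_norm Z \<le> phi_max phi1 bs bs' * frob_norm E + phi_max phi2 bs bs' * frob_norm F"
    by (intro sylvester_boundedD[OF main mult_carrier_mat[OF carr(4,3)] mult_carrier_mat[OF carr(2,1)] ZEFW(1,2,3)]) simp
qed

section \<open>Linearized quadratic pencils\<close>

text \<open>An inverse makes X a unit of the matrix ring, and for units \<open>mat_inverse\<close>
  cannot return \<open>None\<close>; so \<open>the\<close> in the definition of
  \<open>inv_mat\<close> yields the inverse.\<close>

lemma inv_mat:
  assumes inv: "invertible_mat X" and X: "X \<in> carrier_mat n n"
  shows "inv_mat X \<in> carrier_mat n n" "X * inv_mat X = 1\<^sub>m n" "inv_mat X * X = 1\<^sub>m n"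
proof -
  obtain B where B: "X * B = 1\<^sub>m n" "B * X = 1\<^sub>m (dim_row B)"
    using inv X by (auto simp: invertible_mat_def inverts_mat_def)
  have "dim_row B = n"
    using arg_cong[OF B(2), of dim_col] X by simp
  moreover have "dim_col B = n"
    using arg_cong[OF B(1), of dim_col] by simp
  ultimately have "X \<in> Units (ring_mat TYPE(complex) n ())"
    using B X by (auto simp: Units_def ring_mat_def intro!: bexI[of _ B])
  then obtain Y where "mat_inverse X = Some Y"
    using mat_inverse(1)[OF X, of "()"] by (cases "mat_inverse X") auto
  then show "inv_mat X \<in> carrier_mat n n" "X * inv_mat X = 1\<^sub>m n" "inv_mat X * X = 1\<^sub>m n"
    using mat_inverse(2)[OF X] by (auto simp: inv_mat_def)
qed

lemma det_ne_0_if_left_inverse: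
  fixes A :: "'a :: idom mat"
  assumes "B \<in> carrier_mat n n" "A \<in> carrier_mat n n" "B * A = 1\<^sub>m n"
  shows "det A \<noteq> 0"
  using det_mult[OF assms(1,2)] assms(3) by auto

lemma uminus_zero_mat [simp]: "- 0\<^sub>m m n = (0\<^sub>m m n :: 'a :: group_add mat)"
  by (intro eq_matI) auto

text \<open>Both sides equal X^H (A + dA) X': on the left X Y and A Ai collapse, on the right Y'^H
  X'^H does. The factor X^H Y'^H does not involve A, so the instances for A and for B share
  it.\<close>

lemma congruence_perturbation:
  fixes X Y X' Y' A Ai dA :: "complex mat"
  assumes carr: "X \<in> carrier_mat n n" "Y \<in> carrier_mat n n" "X' \<in> carrier_mat n n" "Y' \<in> carrier_mat n n"
    "A \<in> carrier_mat n n" "Ai \<in> carrier_mat n n" "dA \<in> carrier_mat n n"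
    and XY: "X * Y = 1\<^sub>m n" and XY': "X' * Y' = 1\<^sub>m n" and AAi: "A * Ai = 1\<^sub>m n"
  shows "(mat_adjoint X * A * X) * (Y * X' + Y * (Ai * dA) * X') =
    (mat_adjoint X * mat_adjoint Y') * (mat_adjoint X' * (A + dA) * X')"
proof -
  note adj = mat_adjoint_carrier[OF carr(1)] mat_adjoint_carrier[OF carr(3)] mat_adjoint_carrier[OF carr(4)]
  note mc = mult_carrier_mat[of _ n n _ n]
  note assoc = assoc_mult_mat[of _ n n _ n _ n]
  have "Y * X' + Y * (Ai * dA) * X' = Y * (X' + (Ai * dA) * X')"
    using carr by (simp add: mult_add_distrib_mat[of _ n n _ n] assoc mc)
  then have "(mat_adjoint X * A * X) * (Y * X' + Y * (Ai * dA) * X') =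
      mat_adjoint X * (A * ((X * Y) * (X' + (Ai * dA) * X')))"
    using carr adj by (simp add: assoc mc)
  also have "\<dots> = mat_adjoint X * (A * X' + (A * Ai) * (dA * X'))"
    using carr adj
    by (simp add: XY assoc mc left_mult_one_mat[of _ n n] mult_add_distrib_mat[of _ n n _ n] del: AAi)
  also have "\<dots> = mat_adjoint X * ((A + dA) * X')"
    using carr adj by (simp add: AAi add_mult_distrib_mat[of _ n n _ _ n] mc left_mult_one_mat[of _ n n])
  also have "\<dots> = mat_adjoint X * ((mat_adjoint Y' * mat_adjoint X') * ((A + dA) * X'))"
    unfolding mat_adjoint_mult[OF carr(3,4), symmetric] XY'
    using carr by (simp add: mc left_mult_one_mat[of _ n n] mat_adjoint_one)
  also have "\<dots> = (mat_adjoint X * mat_adjoint Y') * (mat_adjoint X' * (A + dA) * X')"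
    using carr adj by (simp add: assoc mc)
  finally show ?thesis .
qed

lemma frob_norm_submat_le:
  fixes Y :: "complex mat"
  assumes "Y \<in> carrier_mat (k1 + k2) (k1 + k2)"
  shows "frob_norm (submat k1 0 k2 k1 Y) \<le> frob_norm Y"
proof -
  have le: "y \<le> sqrt (x\<^sup>2 + y\<^sup>2)" "x \<le> sqrt (x\<^sup>2 + y\<^sup>2)" for x y :: real
    by (auto intro: real_le_rsqrt)
  have "submat k1 0 k2 k1 Y = submat 0 0 k2 k1 (submat k1 0 k2 (k1 + k2) Y)"
    by (intro eq_matI) (auto simp: submat_def)
  then have "frob_norm (submat k1 0 k2 k1 Y) \<le> frob_norm (submat k1 0 k2 (k1 + k2) Y)"
    by (simp add: frob_norm_split_cols[OF submat_carrier[of k1 0 k2 "k1 + k2" Y]] le)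
  also have "\<dots> \<le> frob_norm Y"
    unfolding frob_norm_split_rows[OF assms] by (rule le)
  finally show ?thesis .
qed

lemma frob_norm_four_block_mat:
  assumes "P \<in> carrier_mat n n" "Q \<in> carrier_mat n n" "R \<in> carrier_mat n n" "S \<in> carrier_mat n n"
  shows "frob_norm (four_block_mat P Q R S) =
    sqrt ((frob_norm P)\<^sup>2 + (frob_norm Q)\<^sup>2 + (frob_norm R)\<^sup>2 + (frob_norm S)\<^sup>2)"
  using assms
  by (subst frob_norm_def) (simp add: frob_norm_sq sum_lessThan_add sum.distrib add_ac)

lemma congruent_pencil_nonsingular:
  fixes A X :: "complex mat"
  assumes carr: "X \<in> carrier_mat n n" "Y \<in> carrier_mat n n" "A \<in> carrier_mat n n" "Ai \<in> carrier_mat n n"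
    and inv: "X * Y = 1\<^sub>m n" "Y * X = 1\<^sub>m n" "Ai * A = 1\<^sub>m n"
    and eq: "mat_adjoint X * A * X = diag_block_mat [P, Q]"
    and PQ: "P \<in> carrier_mat k k" "Q \<in> carrier_mat l l"
  shows "det P \<noteq> 0" "det Q \<noteq> 0"
proof -
  note adj = mat_adjoint_carrier[OF carr(1)] mat_adjoint_carrier[OF carr(2)]
  have "mat_adjoint Y * mat_adjoint X = 1\<^sub>m n"
    unfolding mat_adjoint_mult[OF carr(1,2), symmetric] inv(1) by (rule mat_adjoint_one)
  then have "det (mat_adjoint X) \<noteq> 0" "det A \<noteq> 0" "det X \<noteq> 0"
    using det_ne_0_if_left_inverse[OF adj(2,1)] det_ne_0_if_left_inverse[OF carr(4,3) inv(3)]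
      det_ne_0_if_left_inverse[OF carr(2,1) inv(2)] by auto
  then have "det (mat_adjoint X * A * X) \<noteq> 0"
    using det_mult[OF mult_carrier_mat[OF adj(1) carr(3)] carr(1)] det_mult[OF adj(1) carr(3)] by simp
  moreover have "det (diag_block_mat [P, Q]) = prod_list (map det [P, Q])"
    using PQ by (intro det_diag_block_mat) auto
  ultimately show "det P \<noteq> 0" "det Q \<noteq> 0"
    unfolding eq by auto
qed

text \<open>Instantiated both with the original and with the perturbed coefficients, as both
  linearizations have to be shown nonsingular.\<close>

locale quadratic_linearization =
  fixes n :: nat and M C K :: "complex mat"
  assumes carr: "M \<in> carrier_mat n n" "C \<in> carrier_mat n n" "K \<in> carrier_mat n n"
    and inv: "invertible_mat M" "invertible_mat K"
begin

definition "lin_A = four_block_mat (- K) (0\<^sub>m n n) (0\<^sub>m n n) M"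
definition "lin_B = four_block_mat C M M (0\<^sub>m n n)"
definition "lin_A_inv = four_block_mat (- inv_mat K) (0\<^sub>m n n) (0\<^sub>m n n) (inv_mat M)"
text \<open>The inverse of a block matrix with a zero lower right corner; its own corner -M^-1 C
  M^-1 is the origin of the mixed term in the bound for B.\<close>

definition "lin_B_inv = four_block_mat (0\<^sub>m n n) (inv_mat M) (inv_mat M) (- (inv_mat M * C * inv_mat M))"

lemmas invM = inv_mat[OF inv(1) carr(1)]
lemmas invK = inv_mat[OF inv(2) carr(3)]

lemma lin_carrier:
  "lin_A \<in> carrier_mat (2 * n) (2 * n)" "lin_B \<in> carrier_mat (2 * n) (2 * n)"
  "lin_A_inv \<in> carrier_mat (2 * n) (2 * n)" "lin_B_inv \<in> carrier_mat (2 * n) (2 * n)"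
  using carr invM(1) invK(1)
  by (auto simp: lin_A_def lin_B_def lin_A_inv_def lin_B_inv_def mult_2)

lemma lin_A_inv: "lin_A_inv * lin_A = 1\<^sub>m (2 * n)" "lin_A * lin_A_inv = 1\<^sub>m (2 * n)"
proof -
  have "(- inv_mat K) * (- K) = 1\<^sub>m n"
    using invK carr by simp
  then show "lin_A_inv * lin_A = 1\<^sub>m (2 * n)"
    using invM invK carr
    by (simp add: lin_A_def lin_A_inv_def mult_four_block_mat[where ?nr1.0 = n and ?n1.0 = n and ?nc1.0 = n
          and ?nr2.0 = n and ?n2.0 = n and ?nc2.0 = n] mult_2)
  then show "lin_A * lin_A_inv = 1\<^sub>m (2 * n)"
    by (rule mat_mult_left_right_inverse[OF lin_carrier(3,1)])
qed

lemma lin_B_inv: "lin_B_inv * lin_B = 1\<^sub>m (2 * n)" "lin_B * lin_B_inv = 1\<^sub>m (2 * n)"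
proof -
  have MiC: "inv_mat M * C \<in> carrier_mat n n"
    using invM(1) carr by simp
  have "inv_mat M * C * inv_mat M * M = inv_mat M * C"
    unfolding assoc_mult_mat[OF MiC invM(1) carr(1)] invM(3) by (rule right_mult_one_mat[OF MiC])
  then have "inv_mat M * C + (- (inv_mat M * C * inv_mat M)) * M = 0\<^sub>m n n"
    using invM(1) carr MiC by (simp add: uminus_mult_left_mat) (intro eq_matI, auto)
  then show "lin_B_inv * lin_B = 1\<^sub>m (2 * n)"
    using invM carr
    by (simp add: lin_B_def lin_B_inv_def mult_four_block_mat[where ?nr1.0 = n and ?n1.0 = n and ?nc1.0 = n
          and ?nr2.0 = n and ?n2.0 = n and ?nc2.0 = n] mult_2)
  then show "lin_B * lin_B_inv = 1\<^sub>m (2 * n)"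
    by (rule mat_mult_left_right_inverse[OF lin_carrier(4,2)])
qed

context
  fixes dM dC dK :: "complex mat"
  assumes d: "dM \<in> carrier_mat n n" "dC \<in> carrier_mat n n" "dK \<in> carrier_mat n n"
begin

lemma lin_A_perturbed:
  "four_block_mat (- (K + dK)) (0\<^sub>m n n) (0\<^sub>m n n) (M + dM) =
    lin_A + four_block_mat (- dK) (0\<^sub>m n n) (0\<^sub>m n n) dM"
  using carr d unfolding lin_A_def by (intro eq_matI) auto

lemma lin_B_perturbed:
  "four_block_mat (C + dC) (M + dM) (M + dM) (0\<^sub>m n n) =
    lin_B + four_block_mat dC dM dM (0\<^sub>m n n)"
  using carr d unfolding lin_B_def by (intro eq_matI) auto

lemma frob_norm_lin_A_inv_perturbation:
  "frob_norm (lin_A_inv * four_block_mat (- dK) (0\<^sub>m n n) (0\<^sub>m n n) dM) =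
    sqrt ((frob_norm (inv_mat K * dK))\<^sup>2 + (frob_norm (inv_mat M * dM))\<^sup>2)"
proof -
  have "lin_A_inv * four_block_mat (- dK) (0\<^sub>m n n) (0\<^sub>m n n) dM =
      four_block_mat (inv_mat K * dK) (0\<^sub>m n n) (0\<^sub>m n n) (inv_mat M * dM)"
    using invM(1) invK(1) d
    by (simp add: lin_A_inv_def mult_four_block_mat[where ?nr1.0 = n and ?n1.0 = n and ?nc1.0 = n
          and ?nr2.0 = n and ?n2.0 = n and ?nc2.0 = n])
  then show ?thesis
    using invM(1) invK(1) d
    by (simp add: frob_norm_four_block_mat[of _ n] frob_norm_def[of "0\<^sub>m _ _"])
qed

text \<open>The product is block lower triangular with M^-1 dM twice on the diagonal, hence the
  factor 2, and with the mixed term in the corner. So \<open>db\<close> is the exact norm of B^-1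
  dB.\<close>

lemma frob_norm_lin_B_inv_perturbation:
  "frob_norm (lin_B_inv * four_block_mat dC dM dM (0\<^sub>m n n)) =
    sqrt (2 * (frob_norm (inv_mat M * dM))\<^sup>2
      + (frob_norm (inv_mat M * dC - inv_mat M * C * inv_mat M * dM))\<^sup>2)"
proof -
  have carr': "inv_mat M * C * inv_mat M \<in> carrier_mat n n"
    using invM(1) carr by simp
  have "inv_mat M * dC + - (inv_mat M * C * inv_mat M) * dM = inv_mat M * dC - inv_mat M * C * inv_mat M * dM"
    using invM(1) d carr' by (simp add: uminus_mult_left_mat) (intro eq_matI, auto)
  then have "lin_B_inv * four_block_mat dC dM dM (0\<^sub>m n n) =
      four_block_mat (inv_mat M * dM) (0\<^sub>m n n)
        (inv_mat M * dC - inv_mat M * C * inv_mat M * dM) (inv_mat M * dM)"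
    using invM(1) d carr'
    by (simp add: lin_B_inv_def mult_four_block_mat[where ?nr1.0 = n and ?n1.0 = n and ?nc1.0 = n
          and ?nr2.0 = n and ?n2.0 = n and ?nc2.0 = n])
  moreover have "inv_mat M * dM \<in> carrier_mat n n"
    "inv_mat M * dC - inv_mat M * C * inv_mat M * dM \<in> carrier_mat n n"
    using invM(1) d mult_carrier_mat[OF carr' d(1)] by (auto intro!: mult_carrier_mat minus_carrier_mat)
  ultimately show ?thesis
    by (simp add: frob_norm_four_block_mat frob_norm_def[of "0\<^sub>m _ _"])
qed

end

end

theorem theorem4p1:
  fixes n k1 k2 :: nat
    and M C K dM dC dK M' C' K' A B A' B' X1 X2 X1' X2' X X' :: "complex mat"
    and \<Lambda>1 \<Omega>1 \<Lambda>2 \<Omega>2 \<Lambda>1' \<Omega>1' \<Lambda>2' \<Omega>2' :: "complex mat"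
    and bs1 bs2 bs1' bs2' :: "canon_block list"
    and da db :: real
  assumes
    "M \<in> carrier_mat n n" "C \<in> carrier_mat n n" "K \<in> carrier_mat n n"
    "dM \<in> carrier_mat n n" "dC \<in> carrier_mat n n" "dK \<in> carrier_mat n n"
    and "M' = M + dM" "C' = C + dC" "K' = K + dK"
    and "hermitian_mat M" "hermitian_mat C" "hermitian_mat K"
    and "hermitian_mat M'" "hermitian_mat C'" "hermitian_mat K'"
    and "invertible_mat M" "invertible_mat K" "invertible_mat M'" "invertible_mat K'"
    and "A = four_block_mat (- K) (0\<^sub>m n n) (0\<^sub>m n n) M"
    and "B = four_block_mat C M M (0\<^sub>m n n)"
    and "A' = four_block_mat (- K') (0\<^sub>m n n) (0\<^sub>m n n) M'"
    and "B' = four_block_mat C' M' M' (0\<^sub>m n n)"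
    and "k1 \<ge> 1" "k2 \<ge> 1"
    and "X1 \<in> carrier_mat (2 * n) k1" "X2 \<in> carrier_mat (2 * n) k2"
    and "X1' \<in> carrier_mat (2 * n) k1" "X2' \<in> carrier_mat (2 * n) k2"
    and "X = hcat X1 X2" "X' = hcat X1' X2'"
    and "invertible_mat X" "invertible_mat X'"
    and A1: "regular_pair (A, B)" "regular_pair (A', B')"
    and A2a: "pair_congr X (A, B) = pair_sum [(\<Lambda>1, \<Omega>1), (\<Lambda>2, \<Omega>2)]"
      "(\<Lambda>1, \<Omega>1) = pair_sum (map block_pair bs1)" "\<forall>b \<in> set bs1. valid_block b"
      "(\<Lambda>2, \<Omega>2) = pair_sum (map block_pair bs2)" "\<forall>b \<in> set bs2. valid_block b"
    and A2b: "pair_congr X' (A', B') = pair_sum [(\<Lambda>1', \<Omega>1'), (\<Lambda>2', \<Omega>2')]"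
      "(\<Lambda>1', \<Omega>1') = pair_sum (map block_pair bs1')" "\<forall>b \<in> set bs1'. valid_block b"
      "(\<Lambda>2', \<Omega>2') = pair_sum (map block_pair bs2')" "\<forall>b \<in> set bs2'. valid_block b"
    and A2c: "\<Lambda>1 \<in> carrier_mat k1 k1" "\<Omega>1 \<in> carrier_mat k1 k1"
      "\<Lambda>1' \<in> carrier_mat k1 k1" "\<Omega>1' \<in> carrier_mat k1 k1"
      "\<Lambda>2 \<in> carrier_mat k2 k2" "\<Omega>2 \<in> carrier_mat k2 k2"
      "\<Lambda>2' \<in> carrier_mat k2 k2" "\<Omega>2' \<in> carrier_mat k2 k2"
    and A3: "pair_eigenvalues (\<Lambda>1, \<Omega>1) \<inter> pair_eigenvalues (\<Lambda>2, \<Omega>2) = {}"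
      "pair_eigenvalues (\<Lambda>1', \<Omega>1') \<inter> pair_eigenvalues (\<Lambda>2', \<Omega>2') = {}"
      "pair_eigenvalues (\<Lambda>1, \<Omega>1) \<inter> pair_eigenvalues (\<Lambda>2', \<Omega>2') = {}"
      "pair_eigenvalues (\<Lambda>2, \<Omega>2) \<inter> pair_eigenvalues (\<Lambda>1', \<Omega>1') = {}"
    and A4: "Infty \<notin> pair_eigenvalues (\<Lambda>1, \<Omega>1)" "Fin 0 \<notin> pair_eigenvalues (\<Lambda>2, \<Omega>2)"
      "Infty \<notin> pair_eigenvalues (\<Lambda>1', \<Omega>1')" "Fin 0 \<notin> pair_eigenvalues (\<Lambda>2', \<Omega>2')"
    and "da = sqrt ((frob_norm (inv_mat K * dK))\<^sup>2 + (frob_norm (inv_mat M * dM))\<^sup>2)"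
    and "db = sqrt (2 * (frob_norm (inv_mat M * dM))\<^sup>2
           + (frob_norm (inv_mat M * dC - inv_mat M * C * inv_mat M * dM))\<^sup>2)"
  shows "frob_norm (sin_Theta (col_span X1) (col_span X1'))
    \<le> kappa2 X * kappa2 X' * (phi_max phi1 bs1' bs2 * da + phi_max phi2 bs1' bs2 * db)"
proof -
  note carr = assms(1-6) and inv = assms(16-19)
  have carr': "M' \<in> carrier_mat n n" "C' \<in> carrier_mat n n" "K' \<in> carrier_mat n n"
    using carr assms(7-9) by simp_all
  interpret L: quadratic_linearization n M C K
    by unfold_locales (use carr inv in auto)
  interpret L': quadratic_linearization n M' C' K'
    by unfold_locales (use carr' inv in auto)
  let ?N = "2 * n"
  define dA dB where "dA = four_block_mat (- dK) (0\<^sub>m n n) (0\<^sub>m n n) dM"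
    and "dB = four_block_mat dC dM dM (0\<^sub>m n n)"
  have A: "A = L.lin_A" and B: "B = L.lin_B" and A'_lin: "A' = L'.lin_A" and B'_lin: "B' = L'.lin_B"
    using assms(20-23) by (simp_all add: L.lin_A_def L.lin_B_def L'.lin_A_def L'.lin_B_def)
  have A': "A' = A + dA" and B': "B' = B + dB"
    using L.lin_A_perturbed[OF carr(4-6)] L.lin_B_perturbed[OF carr(4-6)] assms(7-9,22,23) A B
    by (simp_all add: dA_def dB_def)
  have d: "dA \<in> carrier_mat ?N ?N" "dB \<in> carrier_mat ?N ?N"
    using carr by (auto simp: dA_def dB_def mult_2)
  note AB = L.lin_carrier[folded A B]
  note AB' = L'.lin_carrier[folded A'_lin B'_lin]
  note X12 = assms(26-29) and X_eq = assms(30) and X'_eq = assms(31)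
  \<comment> \<open>\<open>invertible_mat\<close> includes being square, and this is what makes the
    two column blocks fill the whole space.\<close>
  have N: "?N = k1 + k2"
    using assms(32) hcat_carrier[OF X12(1,2)] by (simp add: X_eq invertible_mat_def)
  have X: "X \<in> carrier_mat ?N ?N" and X': "X' \<in> carrier_mat ?N ?N"
    using hcat_carrier[OF X12(1,2)] hcat_carrier[OF X12(3,4)] N by (simp_all add: X_eq X'_eq)
  define Y Y' where "Y = inv_mat X" and "Y' = inv_mat X'"
  note Y = inv_mat[OF assms(32) X, folded Y_def] and Y' = inv_mat[OF assms(33) X', folded Y'_def]
  have \<Lambda>: "mat_adjoint X * A * X = diag_block_mat [\<Lambda>1, \<Lambda>2]"
    and \<Omega>: "mat_adjoint X * B * X = diag_block_mat [\<Omega>1, \<Omega>2]"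
    and \<Lambda>': "mat_adjoint X' * A' * X' = diag_block_mat [\<Lambda>1', \<Lambda>2']"
    and \<Omega>': "mat_adjoint X' * B' * X' = diag_block_mat [\<Omega>1', \<Omega>2']"
    using A2a(1) A2b(1) by (simp_all add: pair_congr_def pair_sum_def del: diag_block_mat.simps)
  \<comment> \<open>The second unperturbed pair and the first perturbed pair are the two that meet
    in the (2,1) block.\<close>
  have det2: "det \<Lambda>2 \<noteq> 0" "det \<Omega>2 \<noteq> 0"
    using congruent_pencil_nonsingular(2)[OF X Y(1) AB(1,3) Y(2,3) L.lin_A_inv(1)[folded A] \<Lambda> A2c(1,5)]
      congruent_pencil_nonsingular(2)[OF X Y(1) AB(2,4) Y(2,3) L.lin_B_inv(1)[folded B] \<Omega> A2c(2,6)]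
    by auto
  have det1': "det \<Lambda>1' \<noteq> 0" "det \<Omega>1' \<noteq> 0"
    using congruent_pencil_nonsingular(1)[OF X' Y'(1) AB'(1,3) Y'(2,3) L'.lin_A_inv(1)[folded A'_lin] \<Lambda>' A2c(3,7)]
      congruent_pencil_nonsingular(1)[OF X' Y'(1) AB'(2,4) Y'(2,3) L'.lin_B_inv(1)[folded B'_lin] \<Omega>' A2c(4,8)]
    by auto
  have disj: "pair_eigenvalues (\<Lambda>1', \<Omega>1') \<inter> pair_eigenvalues (\<Lambda>2, \<Omega>2) = {}"
    using A3(4) by blast
  note bound = pencil_sylvester_bound[OF A2b(2,3) A2a(4,5) det1' det2 disj A2c(3,4,5,6) assms(24,25)]

  define Zh Eh Fh Wh where "Zh = Y * X'" and "Eh = Y * (L.lin_A_inv * dA) * X'"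
    and "Fh = Y * (L.lin_B_inv * dB) * X'" and "Wh = mat_adjoint X * mat_adjoint Y'"
  have h: "Zh \<in> carrier_mat ?N ?N" "Eh \<in> carrier_mat ?N ?N" "Fh \<in> carrier_mat ?N ?N" "Wh \<in> carrier_mat ?N ?N"
    using X X' Y(1) Y'(1) d AB mat_adjoint_carrier[OF X] mat_adjoint_carrier[OF Y'(1)]
    unfolding Zh_def Eh_def Fh_def Wh_def by (auto intro!: mult_carrier_mat)
  have sum_h: "Zh + Eh \<in> carrier_mat (k1 + k2) (k1 + k2)" "Zh + Fh \<in> carrier_mat (k1 + k2) (k1 + k2)"
    "Wh \<in> carrier_mat (k1 + k2) (k1 + k2)"
    using h N by simp_all
  have "diag_block_mat [\<Lambda>1, \<Lambda>2] * (Zh + Eh) = Wh * diag_block_mat [\<Lambda>1', \<Lambda>2']"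
    using congruence_perturbation[OF X Y(1) X' Y'(1) AB(1,3) d(1) Y(2) Y'(2) L.lin_A_inv(2)[folded A]]
    unfolding \<Lambda> A'[symmetric] \<Lambda>' Zh_def Eh_def Wh_def .
  then have eqA: "diag2 \<Lambda>1 \<Lambda>2 * (Zh + Eh) = Wh * diag2 \<Lambda>1' \<Lambda>2'"
    unfolding diag_block_mat.simps(2)[of _ "[_]"] diag_block_mat_singleton Let_def .
  have "diag_block_mat [\<Omega>1, \<Omega>2] * (Zh + Fh) = Wh * diag_block_mat [\<Omega>1', \<Omega>2']"
    using congruence_perturbation[OF X Y(1) X' Y'(1) AB(2,4) d(2) Y(2) Y'(2) L.lin_B_inv(2)[folded B]]
    unfolding \<Omega> B'[symmetric] \<Omega>' Zh_def Fh_def Wh_def .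
  then have eqB: "diag2 \<Omega>1 \<Omega>2 * (Zh + Fh) = Wh * diag2 \<Omega>1' \<Omega>2'"
    unfolding diag_block_mat.simps(2)[of _ "[_]"] diag_block_mat_singleton Let_def .
  \<comment> \<open>Passing to the (2,1) block keeps the second diagonal block of the left factor
    and the first one of the right factor, which decouples the equations from the other
    blocks.\<close>
  let ?s = "submat k1 0 k2 k1"
  have add: "?s (Zh + Eh) = ?s Zh + ?s Eh" "?s (Zh + Fh) = ?s Zh + ?s Fh"
    using h N by (intro submat_add[of _ ?N ?N]; simp)+
  have "\<Lambda>2 * (?s Zh + ?s Eh) = ?s Wh * \<Lambda>1'"
    using arg_cong[OF eqA, of ?s]
    unfolding diag2_mult_submat(2)[OF A2c(1,5) sum_h(1), of 0 k1, simplified]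
      mult_diag2_submat(1)[OF A2c(3,7) sum_h(3), of k1 k2, simplified] add .
  moreover have "\<Omega>2 * (?s Zh + ?s Fh) = ?s Wh * \<Omega>1'"
    using arg_cong[OF eqB, of ?s]
    unfolding diag2_mult_submat(2)[OF A2c(2,6) sum_h(2), of 0 k1, simplified]
      mult_diag2_submat(1)[OF A2c(4,8) sum_h(3), of k1 k2, simplified] add .
  ultimately have "frob_norm (?s Zh) \<le>
      phi_max phi1 bs1' bs2 * frob_norm (?s Eh) + phi_max phi2 bs1' bs2 * frob_norm (?s Fh)"
    by (rule bound(3)[OF submat_carrier submat_carrier submat_carrier submat_carrier])
  also have "\<dots> \<le> phi_max phi1 bs1' bs2 * (spec_norm Y * spec_norm X' * da) +
      phi_max phi2 bs1' bs2 * (spec_norm Y * spec_norm X' * db)"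
  proof -
    \<comment> \<open>Supplies |X^-1| and |X'|, the factors that complete |X| |X'^-1| from the angle
      estimate to the product of the two condition numbers.\<close>
    have sandwich: "frob_norm (?s (Y * G * X')) \<le> spec_norm Y * spec_norm X' * frob_norm G"
      if G: "G \<in> carrier_mat ?N ?N" for G
    proof -
      have YG: "Y * G \<in> carrier_mat ?N ?N"
        using Y(1) G by simp
      have "frob_norm (?s (Y * G * X')) \<le> frob_norm (Y * G * X')"
        using mult_carrier_mat[OF YG X'] N by (intro frob_norm_submat_le) simp
      also have "\<dots> \<le> spec_norm X' * frob_norm (Y * G)"
        by (rule frob_norm_mult_le_spec_right[OF YG X'])
      also have "\<dots> \<le> spec_norm X' * (spec_norm Y * frob_norm G)"
        by (intro mult_left_mono frob_norm_mult_le_spec_left[OF Y(1) G] spec_norm_nonneg)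
      finally show ?thesis
        by (simp add: mult_ac)
    qed
    have "frob_norm (?s Eh) \<le> spec_norm Y * spec_norm X' * da"
      using sandwich[OF mult_carrier_mat[OF AB(3) d(1)]]
      unfolding Eh_def assms(62) dA_def L.frob_norm_lin_A_inv_perturbation[OF carr(4-6)] .
    moreover have "frob_norm (?s Fh) \<le> spec_norm Y * spec_norm X' * db"
      using sandwich[OF mult_carrier_mat[OF AB(4) d(2)]]
      unfolding Fh_def assms(63) dB_def L.frob_norm_lin_B_inv_perturbation[OF carr(4-6)] .
    ultimately show ?thesis
      by (intro add_mono mult_left_mono bound(1,2))
  qed
  finally have Z: "frob_norm (?s Zh) \<le>
      spec_norm Y * spec_norm X' * (phi_max phi1 bs1' bs2 * da + phi_max phi2 bs1' bs2 * db)"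
    by (simp add: algebra_simps)
  have "frob_norm (sin_Theta (col_span X1) (col_span X1')) \<le> spec_norm X * spec_norm Y' * frob_norm (?s Zh)"
    using frob_norm_sin_Theta_le[OF X12 N Y(1) _ _ Y'(1)] Y(2,3) Y'(3) by (simp add: X_eq X'_eq Zh_def)
  also have "\<dots> \<le> spec_norm X * spec_norm Y' *
      (spec_norm Y * spec_norm X' * (phi_max phi1 bs1' bs2 * da + phi_max phi2 bs1' bs2 * db))"
    by (intro mult_left_mono Z mult_nonneg_nonneg spec_norm_nonneg)
  finally show ?thesis
    by (simp add: kappa2_def Y_def Y'_def mult_ac)
qed

end
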